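(* Let $\lambda$ be an infinite regular cardinal and let $\mathcal{C}$ be a $\lambda$-accessible additive category with products. For a functor $F:\mathcal{C}\to\mathrm{Ab}$, the following are equivalent. (a) $F$ is $\lambda$-accessible and preserves products. (b) There is an exact sequence $$\mathrm{Hom}_{\mathcal{C}}(B,-)\to\mathrm{Hom}_{\mathcal{C}}(A,-)\to F\to 0$$ where $A$ and $B$ are $\lambda$-presented objects of $\mathcal{C}$.
   Context: A functor $F:\mathcal{C}\to\mathcal{D}$ is *$\lambda$-accessible* if $\mathcal{C}$ and $\mathcal{D}$ are $\lambda$-accessible categories and $F$ preserves $\lambda$-directed colimits. An object is *$\lambda$-presented* (i.e. $\lambda$-presentable) if its covariant hom-functor preserves $\lambda$-directed colimits. Exactness of sequences of functors to $\mathrm{Ab}$ is pointwise. Products are arbitrary small products. *)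

theory Defs
  imports "HOL-Algebra.Coset" "HOL-Library.FuncSet"
begin

unbundle cardinal_syntax

section \<open>Universe and smallness\<close>

text \<open>
  Size conditions are relative to a universe, given by a type \<open>'u\<close> whose cardinality is an
  uncountable inaccessible cardinal. A set (of any type) is small if it has fewer elements
  than \<open>'u\<close>. Thus, up to bijection, the small sets are the small subsets of \<open>'u\<close>, and it is no
  restriction to index small diagrams and small products by subsets of \<open>'u\<close>.
\<close>

definition inaccessible_universe :: "'u itself \<Rightarrow> bool" where
  "inaccessible_universe U \<longleftrightarrow>
     |UNIV :: nat set| <o |UNIV :: 'u set| \<and>
     regularCard |UNIV :: 'u set| \<and>
     (\<forall>A :: 'u set. |A| <o |UNIV :: 'u set| \<longrightarrow> |Pow A| <o |UNIV :: 'u set| )"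

definition small :: "'u itself \<Rightarrow> 'a set \<Rightarrow> bool" where
  "small U A \<longleftrightarrow> |A| <o |UNIV :: 'u set|"


section \<open>Categories and functors\<close>

text \<open>
  \<open>Mor C A B\<close> is the set of morphisms from \<open>A\<close> to \<open>B\<close>, and \<open>Cmp C X Y Z g f\<close> is the
  composite of \<open>f : X \<rightarrow> Y\<close> and \<open>g : Y \<rightarrow> Z\<close>. The objects need not form a small set,
  and different morphism sets need not be disjoint.
\<close>

record ('o, 'a) category =
  Ob  :: "'o set"
  Mor :: "'o \<Rightarrow> 'o \<Rightarrow> 'a set"
  Idn :: "'o \<Rightarrow> 'a"
  Cmp :: "'o \<Rightarrow> 'o \<Rightarrow> 'o \<Rightarrow> 'a \<Rightarrow> 'a \<Rightarrow> 'a"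

definition is_category :: "('o, 'a, 'z) category_scheme \<Rightarrow> bool" where
  "is_category C \<longleftrightarrow>
     (\<forall>X\<in>Ob C. Idn C X \<in> Mor C X X) \<and>
     (\<forall>X\<in>Ob C. \<forall>Y\<in>Ob C. \<forall>Z\<in>Ob C. \<forall>f\<in>Mor C X Y. \<forall>g\<in>Mor C Y Z.
        Cmp C X Y Z g f \<in> Mor C X Z) \<and>
     (\<forall>X\<in>Ob C. \<forall>Y\<in>Ob C. \<forall>f\<in>Mor C X Y.
        Cmp C X X Y f (Idn C X) = f \<and> Cmp C X Y Y (Idn C Y) f = f) \<and>
     (\<forall>W\<in>Ob C. \<forall>X\<in>Ob C. \<forall>Y\<in>Ob C. \<forall>Z\<in>Ob C. \<forall>f\<in>Mor C W X. \<forall>g\<in>Mor C X Y. \<forall>h\<in>Mor C Y Z.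
        Cmp C W X Z (Cmp C X Y Z h g) f = Cmp C W Y Z h (Cmp C W X Y g f))"

definition locally_small :: "'u itself \<Rightarrow> ('o, 'a, 'z) category_scheme \<Rightarrow> bool" where
  "locally_small U C \<longleftrightarrow> (\<forall>X\<in>Ob C. \<forall>Y\<in>Ob C. small U (Mor C X Y))"

record ('o, 'a, 'p, 'b) funct =
  fob :: "'o \<Rightarrow> 'p"
  fmor :: "'o \<Rightarrow> 'o \<Rightarrow> 'a \<Rightarrow> 'b"

definition is_functor ::
  "('o, 'a, 'y) category_scheme \<Rightarrow> ('p, 'b, 'z) category_scheme \<Rightarrow> ('o, 'a, 'p, 'b) funct \<Rightarrow> bool"
where
  "is_functor C D F \<longleftrightarrow>
     (\<forall>X\<in>Ob C. fob F X \<in> Ob D) \<and>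
     (\<forall>X\<in>Ob C. \<forall>Y\<in>Ob C. \<forall>f\<in>Mor C X Y. fmor F X Y f \<in> Mor D (fob F X) (fob F Y)) \<and>
     (\<forall>X\<in>Ob C. fmor F X X (Idn C X) = Idn D (fob F X)) \<and>
     (\<forall>X\<in>Ob C. \<forall>Y\<in>Ob C. \<forall>Z\<in>Ob C. \<forall>f\<in>Mor C X Y. \<forall>g\<in>Mor C Y Z.
        fmor F X Z (Cmp C X Y Z g f) =
        Cmp D (fob F X) (fob F Y) (fob F Z) (fmor F Y Z g) (fmor F X Y f))"

definition fcomp ::
  "('p, 'b, 'q, 'c) funct \<Rightarrow> ('o, 'a, 'p, 'b) funct \<Rightarrow> ('o, 'a, 'q, 'c) funct" where
  "fcomp G F = \<lparr> fob = (\<lambda>X. fob G (fob F X)),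
                 fmor = (\<lambda>X Y f. fmor G (fob F X) (fob F Y) (fmor F X Y f)) \<rparr>"

definition is_nat_trans ::
  "('o, 'a, 'y) category_scheme \<Rightarrow> ('p, 'b, 'z) category_scheme \<Rightarrow>
   ('o, 'a, 'p, 'b) funct \<Rightarrow> ('o, 'a, 'p, 'b) funct \<Rightarrow> ('o \<Rightarrow> 'b) \<Rightarrow> bool" where
  "is_nat_trans C D F G \<eta> \<longleftrightarrow>
     (\<forall>X\<in>Ob C. \<eta> X \<in> Mor D (fob F X) (fob G X)) \<and>
     (\<forall>X\<in>Ob C. \<forall>Y\<in>Ob C. \<forall>f\<in>Mor C X Y.
        Cmp D (fob F X) (fob F Y) (fob G Y) (\<eta> Y) (fmor F X Y f) =
        Cmp D (fob F X) (fob G X) (fob G Y) (fmor G X Y f) (\<eta> X))"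


section \<open>Products and colimits\<close>

definition is_product ::
  "('o, 'a, 'z) category_scheme \<Rightarrow> 'i set \<Rightarrow> ('i \<Rightarrow> 'o) \<Rightarrow> 'o \<Rightarrow> ('i \<Rightarrow> 'a) \<Rightarrow> bool" where
  "is_product C I X P \<pi> \<longleftrightarrow>
     P \<in> Ob C \<and> (\<forall>i\<in>I. X i \<in> Ob C \<and> \<pi> i \<in> Mor C P (X i)) \<and>
     (\<forall>T\<in>Ob C. \<forall>f. (\<forall>i\<in>I. f i \<in> Mor C T (X i)) \<longrightarrow>
        (\<exists>!h. h \<in> Mor C T P \<and> (\<forall>i\<in>I. Cmp C T P (X i) (\<pi> i) h = f i)))"

definition has_products :: "'u itself \<Rightarrow> ('o, 'a, 'z) category_scheme \<Rightarrow> bool" where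
  "has_products U C \<longleftrightarrow>
     (\<forall>(I :: 'u set) X. small U I \<longrightarrow> (\<forall>i\<in>I. X i \<in> Ob C) \<longrightarrow> (\<exists>P \<pi>. is_product C I X P \<pi>))"

definition preserves_products ::
  "'u itself \<Rightarrow> ('o, 'a, 'y) category_scheme \<Rightarrow> ('p, 'b, 'z) category_scheme \<Rightarrow>
   ('o, 'a, 'p, 'b) funct \<Rightarrow> bool" where
  "preserves_products U C D F \<longleftrightarrow>
     (\<forall>(I :: 'u set) X P \<pi>. small U I \<longrightarrow> is_product C I X P \<pi> \<longrightarrow>
        is_product D I (\<lambda>i. fob F (X i)) (fob F P) (\<lambda>i. fmor F P (X i) (\<pi> i)))"

definition is_cocone ::
  "('j, 'c, 'y) category_scheme \<Rightarrow> ('o, 'a, 'z) category_scheme \<Rightarrow> ('j, 'c, 'o, 'a) funct \<Rightarrow>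
   'o \<Rightarrow> ('j \<Rightarrow> 'a) \<Rightarrow> bool" where
  "is_cocone J C D L \<iota> \<longleftrightarrow>
     L \<in> Ob C \<and> (\<forall>i\<in>Ob J. \<iota> i \<in> Mor C (fob D i) L) \<and>
     (\<forall>i\<in>Ob J. \<forall>j\<in>Ob J. \<forall>u\<in>Mor J i j. Cmp C (fob D i) (fob D j) L (\<iota> j) (fmor D i j u) = \<iota> i)"

definition is_colimit ::
  "('j, 'c, 'y) category_scheme \<Rightarrow> ('o, 'a, 'z) category_scheme \<Rightarrow> ('j, 'c, 'o, 'a) funct \<Rightarrow>
   'o \<Rightarrow> ('j \<Rightarrow> 'a) \<Rightarrow> bool" where
  "is_colimit J C D L \<iota> \<longleftrightarrow>
     is_cocone J C D L \<iota> \<and>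
     (\<forall>T \<kappa>. is_cocone J C D T \<kappa> \<longrightarrow>
        (\<exists>!h. h \<in> Mor C L T \<and> (\<forall>i\<in>Ob J. Cmp C (fob D i) L T h (\<iota> i) = \<kappa> i)))"

definition poset_cat :: "'i set \<Rightarrow> 'i rel \<Rightarrow> ('i, unit) category" where
  "poset_cat I r = \<lparr> Ob = I, Mor = (\<lambda>i j. if (i, j) \<in> r then {()} else {}),
                     Idn = (\<lambda>i. ()), Cmp = (\<lambda>i j k v u. ()) \<rparr>"

text \<open>
  The bound is required for the empty subset too, so a \<open>\<mu>\<close>-directed poset is nonempty.
\<close>

definition directed_poset :: "'u itself \<Rightarrow> 'l rel \<Rightarrow> 'u set \<Rightarrow> 'u rel \<Rightarrow> bool" where
  "directed_poset U \<mu> I r \<longleftrightarrow>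
     small U I \<and> partial_order_on I r \<and>
     (\<forall>K\<subseteq>I. |K| <o \<mu> \<longrightarrow> (\<exists>j\<in>I. \<forall>k\<in>K. (k, j) \<in> r))"

definition has_directed_colimits ::
  "'u itself \<Rightarrow> 'l rel \<Rightarrow> ('o, 'a, 'z) category_scheme \<Rightarrow> bool" where
  "has_directed_colimits U \<mu> C \<longleftrightarrow>
     (\<forall>I r D. directed_poset U \<mu> I r \<longrightarrow> is_functor (poset_cat I r) C D \<longrightarrow>
        (\<exists>L \<iota>. is_colimit (poset_cat I r) C D L \<iota>))"

definition preserves_directed_colimits ::
  "'u itself \<Rightarrow> 'l rel \<Rightarrow> ('o, 'a, 'y) category_scheme \<Rightarrow> ('p, 'b, 'z) category_scheme \<Rightarrow>
   ('o, 'a, 'p, 'b) funct \<Rightarrow> bool" where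
  "preserves_directed_colimits U \<mu> C E F \<longleftrightarrow>
     (\<forall>I r D L \<iota>. directed_poset U \<mu> I r \<longrightarrow> is_functor (poset_cat I r) C D \<longrightarrow>
        is_colimit (poset_cat I r) C D L \<iota> \<longrightarrow>
        is_colimit (poset_cat I r) E (fcomp F D) (fob F L) (\<lambda>i. fmor F (fob D i) L (\<iota> i)))"


section \<open>Presented objects and accessibility\<close>

text \<open>
  The category of small subsets of a type \<open>'a\<close>. Functions are extensional (undefined outside
  their domain), so that equality of morphisms is equality of HOL functions. If \<open>'a\<close> has at
  least as many elements as \<open>'u\<close>, this is equivalent to the category of small sets.
\<close>

definition SetCat :: "'u itself \<Rightarrow> ('a set, 'a \<Rightarrow> 'a) category" where
  "SetCat U = \<lparr> Ob = {A. small U A}, Mor = (\<lambda>A B. A \<rightarrow>\<^sub>E B),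
                Idn = (\<lambda>A. \<lambda>x\<in>A. x), Cmp = (\<lambda>A B C g f. compose A g f) \<rparr>"

definition hom_functor_set ::
  "('o, 'a, 'z) category_scheme \<Rightarrow> 'o \<Rightarrow> ('o, 'a, 'a set, 'a \<Rightarrow> 'a) funct" where
  "hom_functor_set C A = \<lparr> fob = (\<lambda>X. Mor C A X),
                           fmor = (\<lambda>X Y f. \<lambda>g\<in>Mor C A X. Cmp C A X Y f g) \<rparr>"

definition presented ::
  "'u itself \<Rightarrow> 'l rel \<Rightarrow> ('o, 'a, 'z) category_scheme \<Rightarrow> 'o \<Rightarrow> bool" where
  "presented U \<mu> C A \<longleftrightarrow>
     A \<in> Ob C \<and> preserves_directed_colimits U \<mu> C (SetCat U) (hom_functor_set C A)"

definition accessible_category ::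
  "'u itself \<Rightarrow> 'l rel \<Rightarrow> ('o, 'a, 'z) category_scheme \<Rightarrow> bool" where
  "accessible_category U \<mu> C \<longleftrightarrow>
     is_category C \<and> locally_small U C \<and> has_directed_colimits U \<mu> C \<and>
     (\<exists>S. small U S \<and> (\<forall>A\<in>S. presented U \<mu> C A) \<and>
        (\<forall>X\<in>Ob C. \<exists>I r D \<iota>. directed_poset U \<mu> I r \<and> is_functor (poset_cat I r) C D \<and>
           (\<forall>i\<in>I. fob D i \<in> S) \<and> is_colimit (poset_cat I r) C D X \<iota>))"

definition accessible_functor ::
  "'u itself \<Rightarrow> 'l rel \<Rightarrow> ('o, 'a, 'y) category_scheme \<Rightarrow> ('p, 'b, 'z) category_scheme \<Rightarrow>
   ('o, 'a, 'p, 'b) funct \<Rightarrow> bool" where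
  "accessible_functor U \<mu> C D F \<longleftrightarrow>
     accessible_category U \<mu> C \<and> accessible_category U \<mu> D \<and>
     is_functor C D F \<and> preserves_directed_colimits U \<mu> C D F"


section \<open>Additive categories\<close>

record ('o, 'a) preadditive = "('o, 'a) category" +
  Add :: "'o \<Rightarrow> 'o \<Rightarrow> 'a \<Rightarrow> 'a \<Rightarrow> 'a"
  Zer :: "'o \<Rightarrow> 'o \<Rightarrow> 'a"

definition hom_group :: "('o, 'a, 'z) preadditive_scheme \<Rightarrow> 'o \<Rightarrow> 'o \<Rightarrow> 'a monoid" where
  "hom_group C A B = \<lparr> carrier = Mor C A B, mult = Add C A B, one = Zer C A B \<rparr>"

definition is_preadditive :: "('o, 'a, 'z) preadditive_scheme \<Rightarrow> bool" where
  "is_preadditive C \<longleftrightarrow>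
     is_category C \<and>
     (\<forall>A\<in>Ob C. \<forall>B\<in>Ob C. comm_group (hom_group C A B)) \<and>
     (\<forall>X\<in>Ob C. \<forall>Y\<in>Ob C. \<forall>Z\<in>Ob C. \<forall>f\<in>Mor C X Y. \<forall>g\<in>Mor C Y Z. \<forall>g'\<in>Mor C Y Z.
        Cmp C X Y Z (Add C Y Z g g') f = Add C X Z (Cmp C X Y Z g f) (Cmp C X Y Z g' f)) \<and>
     (\<forall>X\<in>Ob C. \<forall>Y\<in>Ob C. \<forall>Z\<in>Ob C. \<forall>f\<in>Mor C X Y. \<forall>f'\<in>Mor C X Y. \<forall>g\<in>Mor C Y Z.
        Cmp C X Y Z g (Add C X Y f f') = Add C X Z (Cmp C X Y Z g f) (Cmp C X Y Z g f'))"

definition is_zero_object :: "('o, 'a, 'z) category_scheme \<Rightarrow> 'o \<Rightarrow> bool" where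
  "is_zero_object C Z \<longleftrightarrow>
     Z \<in> Ob C \<and> (\<forall>X\<in>Ob C. (\<exists>!f. f \<in> Mor C X Z) \<and> (\<exists>!f. f \<in> Mor C Z X))"

definition is_biproduct ::
  "('o, 'a, 'z) preadditive_scheme \<Rightarrow> 'o \<Rightarrow> 'o \<Rightarrow> 'o \<Rightarrow> 'a \<Rightarrow> 'a \<Rightarrow> 'a \<Rightarrow> 'a \<Rightarrow> bool" where
  "is_biproduct C A B P p q i j \<longleftrightarrow>
     P \<in> Ob C \<and> p \<in> Mor C P A \<and> q \<in> Mor C P B \<and> i \<in> Mor C A P \<and> j \<in> Mor C B P \<and>
     Cmp C A P A p i = Idn C A \<and> Cmp C B P B q j = Idn C B \<and>
     Cmp C A P B q i = Zer C A B \<and> Cmp C B P A p j = Zer C B A \<and>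
     Add C P P (Cmp C P A P i p) (Cmp C P B P j q) = Idn C P"

definition is_additive :: "('o, 'a, 'z) preadditive_scheme \<Rightarrow> bool" where
  "is_additive C \<longleftrightarrow>
     is_preadditive C \<and> (\<exists>Z. is_zero_object C Z) \<and>
     (\<forall>A\<in>Ob C. \<forall>B\<in>Ob C. \<exists>P p q i j. is_biproduct C A B P p q i j)"


section \<open>Functors to abelian groups\<close>

text \<open>
  The category of small abelian groups, with underlying sets contained in \<open>'u\<close> and written
  multiplicatively as in HOL-Algebra. As above, homomorphisms are taken to be extensional.
\<close>

definition Ab :: "'u itself \<Rightarrow> ('u monoid, 'u \<Rightarrow> 'u) category" where
  "Ab U = \<lparr> Ob = {G. comm_group G \<and> small U (carrier G)},
            Mor = (\<lambda>G H. hom G H \<inter> extensional (carrier G)),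
            Idn = (\<lambda>G. \<lambda>x\<in>carrier G. x),
            Cmp = (\<lambda>G H K g f. compose (carrier G) g f) \<rparr>"

text \<open>
  The functor \<open>Hom(A, -)\<close> from a preadditive category to abelian groups. It lands in \<open>Ab U\<close>
  when the morphism sets are small subsets of \<open>'u\<close>, which is no restriction on a
  locally small category.
\<close>

definition hom_functor ::
  "('o, 'a, 'z) preadditive_scheme \<Rightarrow> 'o \<Rightarrow> ('o, 'a, 'a monoid, 'a \<Rightarrow> 'a) funct" where
  "hom_functor C A = \<lparr> fob = hom_group C A,
                       fmor = (\<lambda>X Y f. \<lambda>g\<in>Mor C A X. Cmp C A X Y f g) \<rparr>"

text \<open>
  Pointwise exactness of \<open>F \<rightarrow> G \<rightarrow> H \<rightarrow> 0\<close>, with maps \<open>\<alpha> : F \<rightarrow> G\<close> and \<open>\<beta> : G \<rightarrow> H\<close>.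
\<close>

definition right_exact_sequence ::
  "'u itself \<Rightarrow> ('o, 'a, 'z) category_scheme \<Rightarrow> ('o, 'a, 'u monoid, 'u \<Rightarrow> 'u) funct \<Rightarrow>
   ('o, 'a, 'u monoid, 'u \<Rightarrow> 'u) funct \<Rightarrow> ('o, 'a, 'u monoid, 'u \<Rightarrow> 'u) funct \<Rightarrow>
   ('o \<Rightarrow> 'u \<Rightarrow> 'u) \<Rightarrow> ('o \<Rightarrow> 'u \<Rightarrow> 'u) \<Rightarrow> bool" where
  "right_exact_sequence U C F G H \<alpha> \<beta> \<longleftrightarrow>
     is_nat_trans C (Ab U) F G \<alpha> \<and> is_nat_trans C (Ab U) G H \<beta> \<and>
     (\<forall>X\<in>Ob C. \<alpha> X ` carrier (fob F X) = kernel (fob G X) (fob H X) (\<beta> X) \<and>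
                \<beta> X ` carrier (fob G X) = carrier (fob H X))"

end

theory Submission
  imports Defs "HOL-Algebra.Generated_Groups"
begin

text \<open>
  If \<open>F\<close> is the cokernel of \<open>Hom(B, -) \<rightarrow> Hom(A, -)\<close> with \<open>A\<close> and \<open>B\<close> presented, then an element of
  \<open>F X\<close> is represented by a map \<open>A \<rightarrow> X\<close>, and two maps represent the same element if and only if
  their difference comes from a map \<open>B \<rightarrow> X\<close>. Both kinds of data pass through products, and they
  factor through a stage of a directed colimit because \<open>A\<close> and \<open>B\<close> are presented; so \<open>F\<close>
  preserves products and directed colimits (\<open>products_preserved\<close>, \<open>colimits_preserved\<close>).

  Conversely, let \<open>F\<close> preserve both. Take a small set \<open>S\<close> of presented objects that generates
  \<open>C\<close> under directed colimits, and form the product \<open>P\<close> of one copy of \<open>s\<close> for each pair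
  \<open>(s, x)\<close> with \<open>s \<in> S\<close> and \<open>x \<in> F s\<close>. The group \<open>F P\<close> contains an element with all the components
  \<open>x\<close>. As \<open>P\<close> is a directed colimit of objects of \<open>S\<close>, this element comes from some \<open>a \<in> F A\<close>
  with \<open>A \<in> S\<close>, and every element of every \<open>F X\<close> is then an image of \<open>a\<close>. By the Yoneda lemma
  \<open>a\<close> corresponds to an epimorphism \<open>Hom(A, -) \<rightarrow> F\<close>; it is additive since \<open>F\<close> preserves biproducts. Its
  kernel also lifts elements to products and to stages of directed colimits, so the same argument
  (\<open>generated_by_one_element\<close>) covers the kernel by some \<open>Hom(B, -)\<close>.

  An accessible functor has an accessible codomain, so the category of abelian groups must be
  shown to be accessible (\<open>accessible_Ab\<close>). Directed colimits are constructed from elements.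
  For a subset \<open>X\<close> of a group \<open>G\<close> consider the abelian group with generators \<open>X\<close> and the relations
  \<open>x \<cdot> y = z\<close> that hold in \<open>G\<close> between elements of \<open>X\<close>. If \<open>X\<close> has fewer than \<open>\<mu>\<close> elements, there
  are fewer than \<open>\<mu>\<close> generators and relations, so this group is presented
  (\<open>table_group_presented\<close>), and \<open>G\<close> is the directed colimit of these groups over all such \<open>X\<close>
  (\<open>colimit_of_table_groups\<close>). This treats the countable and the uncountable \<open>\<mu>\<close> alike.

  Universal properties are turned throughout into statements about elements: a directed colimit
  of sets or groups is a cocone that is jointly surjective and identifies only what is identified
  at a later stage, and a product of groups is a group in which each family of components has
  exactly one element.
\<close>

section \<open>Small sets and sets below a regular cardinal\<close>

locale regular_cardinal =
  fixes \<mu> :: "'l rel"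
  assumes card_order: "Card_order \<mu>" and infinite: "cinfinite \<mu>" and regular: "regularCard \<mu>"
begin

lemma less_infinite: "\<not> finite (Field \<mu>)"
  using infinite by (simp add: cinfinite_def)

lemma stable: "stable \<mu>"
  using regularCard_stable card_order less_infinite regular by blast

lemma less_mono: "|A| <o \<mu>" if "A \<subseteq> B" "|B| <o \<mu>" for A B :: "'a set"
  using that card_of_mono1 ordLeq_ordLess_trans by blast

lemma less_image: "|f ` A| <o \<mu>" if "|A| <o \<mu>"
  using that card_of_image ordLeq_ordLess_trans by blast

lemma less_finite: "|A| <o \<mu>" if "finite A"
proof (rule ordLess_ordIso_trans)
  show "|A| <o |Field \<mu>|"
    by (rule finite_ordLess_infinite) (use that less_infinite in \<open>simp_all add: Field_card_of card_of_well_order_on\<close>)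
  show "|Field \<mu>| =o \<mu>" by (rule card_of_Field_ordIso[OF card_order])
qed

lemma less_Sigma: "|Sigma A B| <o \<mu>" if "|A| <o \<mu>" "\<And>a. a \<in> A \<Longrightarrow> |B a| <o \<mu>"
  using stable_elim[OF stable] that by blast

lemma less_UNION: "|\<Union>a\<in>A. B a| <o \<mu>" if "|A| <o \<mu>" "\<And>a. a \<in> A \<Longrightarrow> |B a| <o \<mu>"
  using stable_UNION[OF stable] that by blast

lemma less_Times: "|A \<times> B| <o \<mu>" if "|A| <o \<mu>" "|B| <o \<mu>"
  by (rule less_Sigma) (use that in auto)

lemma less_Un: "|A \<union> B| <o \<mu>" if "|A| <o \<mu>" "|B| <o \<mu>" for A B :: "'a set"
proof -
  have "|\<Union>b\<in>(UNIV :: bool set). if b then A else B| <o \<mu>"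
    by (rule less_UNION) (auto simp: that less_finite)
  moreover have "(\<Union>b\<in>(UNIV :: bool set). if b then A else B) = A \<union> B" by auto
  ultimately show ?thesis by simp
qed

end

locale small_universe =
  fixes U :: "'u itself"
  assumes inaccessible: "inaccessible_universe U"

sublocale small_universe \<subseteq> univ: regular_cardinal "|UNIV :: 'u set|"
proof
  show "Card_order |UNIV :: 'u set|" by (rule card_of_Card_order)
  have "|UNIV :: nat set| \<le>o |UNIV :: 'u set|"
    using inaccessible ordLess_imp_ordLeq by (auto simp: inaccessible_universe_def)
  then show "cinfinite |UNIV :: 'u set|"
    unfolding cinfinite_def Field_card_of using infinite_iff_card_of_nat by blast
  show "regularCard |UNIV :: 'u set|"
    using inaccessible by (simp add: inaccessible_universe_def)
qed

context small_universe
begin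

lemma small_mono: "small U B \<Longrightarrow> A \<subseteq> B \<Longrightarrow> small U A"
  unfolding small_def using univ.less_mono by blast

lemma small_image: "small U A \<Longrightarrow> small U (f ` A)"
  unfolding small_def using univ.less_image by blast

lemma small_inj: "inj_on f A \<Longrightarrow> f ` A \<subseteq> B \<Longrightarrow> small U B \<Longrightarrow> small U A"
  unfolding small_def by (rule ordLeq_ordLess_trans[OF card_of_ordLeqI]) auto

lemma small_finite: "finite A \<Longrightarrow> small U A"
  unfolding small_def by (rule univ.less_finite)

lemma small_Sigma: "small U A \<Longrightarrow> (\<And>a. a \<in> A \<Longrightarrow> small U (B a)) \<Longrightarrow> small U (Sigma A B)"
  unfolding small_def by (rule univ.less_Sigma)

lemma small_nat: "small U (UNIV :: nat set)"
  using inaccessible by (simp add: small_def inaccessible_universe_def)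

lemma small_embeds: "small U A \<Longrightarrow> \<exists>f :: 'a \<Rightarrow> 'u. inj_on f A" for A :: "'a set"
  unfolding small_def using card_of_ordLeq ordLess_imp_ordLeq by (metis subset_UNIV)

lemma two_elements: "\<exists>a b :: 'u. a \<noteq> b"
proof (rule ccontr)
  assume "\<not> (\<exists>a b :: 'u. a \<noteq> b)"
  then have "(UNIV :: 'u set) \<subseteq> {undefined}" by auto
  then have "finite (UNIV :: 'u set)" by (rule finite_subset) simp
  then show False using univ.less_infinite by (simp add: Field_card_of)
qed

lemma small_Pow:
  fixes A :: "'a set"
  assumes "small U A"
  shows "small U (Pow A)"
proof -
  obtain f :: "'a \<Rightarrow> 'u" where f: "inj_on f A" using small_embeds[OF assms] by blast
  have "small U (f ` A)" using assms by (rule small_image)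
  then have "small U (Pow (f ` A))"
    using inaccessible by (simp add: small_def inaccessible_universe_def)
  moreover have "inj_on ((`) f) (Pow A)" using f by (rule inj_on_image_Pow)
  moreover have "(`) f ` Pow A \<subseteq> Pow (f ` A)" by blast
  ultimately show ?thesis by (rule small_inj[rotated 2])
qed

lemma small_PiE: "small U A \<Longrightarrow> small U B \<Longrightarrow> small U (A \<rightarrow>\<^sub>E B)"
  for A :: "'a set" and B :: "'b set"
proof -
  assume A: "small U A" and B: "small U B"
  let ?G = "\<lambda>f :: 'a \<Rightarrow> 'b. {(x, f x) |x. x \<in> A}"
  have "inj_on ?G (A \<rightarrow>\<^sub>E B)"
  proof (rule inj_onI)
    fix f g assume f: "f \<in> A \<rightarrow>\<^sub>E B" and g: "g \<in> A \<rightarrow>\<^sub>E B" and eq: "?G f = ?G g"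
    show "f = g"
    proof (rule PiE_ext[OF f g])
      fix x assume "x \<in> A"
      then have "(x, f x) \<in> ?G g" using eq by blast
      then show "f x = g x" by blast
    qed
  qed
  moreover have "?G ` (A \<rightarrow>\<^sub>E B) \<subseteq> Pow (A \<times> B)" by (auto simp: PiE_def Pi_def)
  ultimately show ?thesis
    by (rule small_inj) (simp add: small_Pow small_Sigma A B)
qed

lemma small_lists:
  fixes A :: "'a set"
  assumes "small U A"
  shows "small U (lists A)"
proof -
  let ?G = "\<lambda>xs :: 'a list. {(i, xs ! i) |i. i < length xs}"
  have "inj_on ?G (lists A)"
  proof (rule inj_onI)
    fix xs ys :: "'a list" assume eq: "?G xs = ?G ys"
    have dom: "fst ` ?G zs = {..<length zs}" for zs :: "'a list" by force
    have "{..<length xs} = {..<length ys}" using dom[of xs] dom[of ys] eq by simp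
    then have len: "length xs = length ys" by simp
    show "xs = ys"
    proof (rule nth_equalityI[OF len])
      fix i assume "i < length xs"
      then have "(i, xs ! i) \<in> ?G ys" using eq by blast
      then show "xs ! i = ys ! i" by blast
    qed
  qed
  moreover have "?G ` lists A \<subseteq> Pow (UNIV \<times> A)" by (auto simp: in_lists_conv_set)
  ultimately show ?thesis
    by (rule small_inj) (simp add: small_Pow small_Sigma small_nat assms)
qed

end

section \<open>Categories and directed diagrams\<close>

lemma category_idn: "is_category C \<Longrightarrow> X \<in> Ob C \<Longrightarrow> Idn C X \<in> Mor C X X"
  by (simp add: is_category_def)

lemma category_cmp:
  "is_category C \<Longrightarrow> X \<in> Ob C \<Longrightarrow> Y \<in> Ob C \<Longrightarrow> Z \<in> Ob C \<Longrightarrow> f \<in> Mor C X Y \<Longrightarrow> g \<in> Mor C Y Z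
   \<Longrightarrow> Cmp C X Y Z g f \<in> Mor C X Z"
  unfolding is_category_def by blast

lemma category_idl:
  "is_category C \<Longrightarrow> X \<in> Ob C \<Longrightarrow> Y \<in> Ob C \<Longrightarrow> f \<in> Mor C X Y \<Longrightarrow> Cmp C X Y Y (Idn C Y) f = f"
  unfolding is_category_def by blast

lemma category_assoc:
  "is_category C \<Longrightarrow> W \<in> Ob C \<Longrightarrow> X \<in> Ob C \<Longrightarrow> Y \<in> Ob C \<Longrightarrow> Z \<in> Ob C \<Longrightarrow>
   f \<in> Mor C W X \<Longrightarrow> g \<in> Mor C X Y \<Longrightarrow> h \<in> Mor C Y Z \<Longrightarrow>
   Cmp C W X Z (Cmp C X Y Z h g) f = Cmp C W Y Z h (Cmp C W X Y g f)"
  unfolding is_category_def by blast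

lemma functor_ob: "is_functor C D F \<Longrightarrow> X \<in> Ob C \<Longrightarrow> fob F X \<in> Ob D"
  by (simp add: is_functor_def)

lemma functor_mor:
  "is_functor C D F \<Longrightarrow> X \<in> Ob C \<Longrightarrow> Y \<in> Ob C \<Longrightarrow> f \<in> Mor C X Y
   \<Longrightarrow> fmor F X Y f \<in> Mor D (fob F X) (fob F Y)"
  by (simp add: is_functor_def)

lemma functor_idn: "is_functor C D F \<Longrightarrow> X \<in> Ob C \<Longrightarrow> fmor F X X (Idn C X) = Idn D (fob F X)"
  by (simp add: is_functor_def)

lemma functor_cmp:
  "is_functor C D F \<Longrightarrow> X \<in> Ob C \<Longrightarrow> Y \<in> Ob C \<Longrightarrow> Z \<in> Ob C \<Longrightarrow> f \<in> Mor C X Y \<Longrightarrow> g \<in> Mor C Y Z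
   \<Longrightarrow> fmor F X Z (Cmp C X Y Z g f) =
       Cmp D (fob F X) (fob F Y) (fob F Z) (fmor F Y Z g) (fmor F X Y f)"
  unfolding is_functor_def by blast

lemma functor_fcomp:
  assumes "is_functor B C F" "is_functor C D G"
  shows "is_functor B D (fcomp G F)"
  using assms unfolding is_functor_def fcomp_def by simp

lemma poset_cat_simps [simp]:
  "Ob (poset_cat I r) = I"
  "u \<in> Mor (poset_cat I r) i j \<longleftrightarrow> (i, j) \<in> r"
  by (auto simp: poset_cat_def)

lemma directed_posetD:
  assumes "directed_poset U \<mu> I r"
  shows "small U I" "partial_order_on I r"
    "\<And>K. K \<subseteq> I \<Longrightarrow> |K| <o \<mu> \<Longrightarrow> \<exists>j\<in>I. \<forall>k\<in>K. (k, j) \<in> r"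
  using assms by (auto simp: directed_poset_def)

lemma partial_order_onE:
  assumes "partial_order_on I r"
  shows "r \<subseteq> I \<times> I" "\<And>i. i \<in> I \<Longrightarrow> (i, i) \<in> r"
    "\<And>i j k. (i, j) \<in> r \<Longrightarrow> (j, k) \<in> r \<Longrightarrow> (i, k) \<in> r"
  using assms by (auto simp: partial_order_on_def preorder_on_def refl_on_def dest: transD)

lemma poset_functorD:
  assumes "is_functor (poset_cat I r) C D" "partial_order_on I r"
  shows "\<And>i. i \<in> I \<Longrightarrow> fob D i \<in> Ob C"
    "\<And>i j. (i, j) \<in> r \<Longrightarrow> fmor D i j () \<in> Mor C (fob D i) (fob D j)"
    "\<And>i. i \<in> I \<Longrightarrow> fmor D i i () = Idn C (fob D i)"
    "\<And>i j k. (i, j) \<in> r \<Longrightarrow> (j, k) \<in> r \<Longrightarrow>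
       Cmp C (fob D i) (fob D j) (fob D k) (fmor D j k ()) (fmor D i j ()) = fmor D i k ()"
proof -
  note r = partial_order_onE[OF assms(2)]
  show "fob D i \<in> Ob C" if "i \<in> I" for i using functor_ob[OF assms(1)] that by simp
  show "fmor D i j () \<in> Mor C (fob D i) (fob D j)" if "(i, j) \<in> r" for i j
    using functor_mor[OF assms(1), of i j "()"] that r(1) by auto
  show "fmor D i i () = Idn C (fob D i)" if "i \<in> I" for i
    using functor_idn[OF assms(1), of i] that by simp
  show "Cmp C (fob D i) (fob D j) (fob D k) (fmor D j k ()) (fmor D i j ()) = fmor D i k ()"
    if "(i, j) \<in> r" "(j, k) \<in> r" for i j k
  proof -
    have "i \<in> I" "j \<in> I" "k \<in> I" using that r(1) by auto
    then show ?thesis using functor_cmp[OF assms(1), of i j k "()" "()"] that by simp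
  qed
qed

lemma cocone_poset_iff:
  assumes "r \<subseteq> I \<times> I"
  shows "is_cocone (poset_cat I r) C D L \<iota> \<longleftrightarrow>
    L \<in> Ob C \<and> (\<forall>i\<in>I. \<iota> i \<in> Mor C (fob D i) L) \<and>
    (\<forall>(i, j)\<in>r. Cmp C (fob D i) (fob D j) L (\<iota> j) (fmor D i j ()) = \<iota> i)"
  using assms by (auto simp: is_cocone_def)

lemma colimit_factor:
  assumes "is_colimit J C D L \<iota>" "is_cocone J C D T \<kappa>"
  shows "\<exists>!h. h \<in> Mor C L T \<and> (\<forall>i\<in>Ob J. Cmp C (fob D i) L T h (\<iota> i) = \<kappa> i)"
  using assms unfolding is_colimit_def by blast

locale directed_system = regular_cardinal \<mu> for \<mu> :: "'l rel" +
  fixes I :: "'i set" and r :: "'i rel" and X :: "'i \<Rightarrow> 'x set" and t :: "'i \<Rightarrow> 'i \<Rightarrow> 'x \<Rightarrow> 'x"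
  assumes partial_order: "partial_order_on I r"
    and upper_bound: "K \<subseteq> I \<Longrightarrow> |K| <o \<mu> \<Longrightarrow> \<exists>j\<in>I. \<forall>k\<in>K. (k, j) \<in> r"
    and t_closed: "(i, j) \<in> r \<Longrightarrow> x \<in> X i \<Longrightarrow> t i j x \<in> X j"
    and t_id: "i \<in> I \<Longrightarrow> x \<in> X i \<Longrightarrow> t i i x = x"
    and t_comp: "(i, j) \<in> r \<Longrightarrow> (j, k) \<in> r \<Longrightarrow> x \<in> X i \<Longrightarrow> t j k (t i j x) = t i k x"
begin

lemmas r_closed = partial_order_onE(1)[OF partial_order]
  and r_refl = partial_order_onE(2)[OF partial_order]
  and r_trans = partial_order_onE(3)[OF partial_order]

definition elementwise_colimit :: "'y set \<Rightarrow> ('i \<Rightarrow> 'x \<Rightarrow> 'y) \<Rightarrow> bool" where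
  "elementwise_colimit L \<iota> \<longleftrightarrow>
     (\<forall>i\<in>I. \<forall>x\<in>X i. \<iota> i x \<in> L) \<and>
     (\<forall>(i, j)\<in>r. \<forall>x\<in>X i. \<iota> j (t i j x) = \<iota> i x) \<and>
     (\<forall>l\<in>L. \<exists>i\<in>I. \<exists>x\<in>X i. \<iota> i x = l) \<and>
     (\<forall>i\<in>I. \<forall>x\<in>X i. \<forall>y\<in>X i. \<iota> i x = \<iota> i y \<longrightarrow> (\<exists>j. (i, j) \<in> r \<and> t i j x = t i j y))"

lemma elementwise_colimitD:
  assumes "elementwise_colimit L \<iota>"
  shows "\<And>i x. i \<in> I \<Longrightarrow> x \<in> X i \<Longrightarrow> \<iota> i x \<in> L"
    and "\<And>i j x. (i, j) \<in> r \<Longrightarrow> x \<in> X i \<Longrightarrow> \<iota> j (t i j x) = \<iota> i x"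
    and "\<And>l. l \<in> L \<Longrightarrow> \<exists>i\<in>I. \<exists>x\<in>X i. \<iota> i x = l"
    and "\<And>i x y. i \<in> I \<Longrightarrow> x \<in> X i \<Longrightarrow> y \<in> X i \<Longrightarrow> \<iota> i x = \<iota> i y \<Longrightarrow>
           \<exists>j. (i, j) \<in> r \<and> t i j x = t i j y"
  using assms unfolding elementwise_colimit_def by blast+

lemma elementwise_colimitI:
  assumes "\<And>i x. i \<in> I \<Longrightarrow> x \<in> X i \<Longrightarrow> \<iota> i x \<in> L"
    and "\<And>i j x. (i, j) \<in> r \<Longrightarrow> x \<in> X i \<Longrightarrow> \<iota> j (t i j x) = \<iota> i x"
    and "\<And>l. l \<in> L \<Longrightarrow> \<exists>i\<in>I. \<exists>x\<in>X i. \<iota> i x = l"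
    and "\<And>i x y. i \<in> I \<Longrightarrow> x \<in> X i \<Longrightarrow> y \<in> X i \<Longrightarrow> \<iota> i x = \<iota> i y \<Longrightarrow>
           \<exists>j. (i, j) \<in> r \<and> t i j x = t i j y"
  shows "elementwise_colimit L \<iota>"
  using assms unfolding elementwise_colimit_def by blast

lemma r_memb: "(i, j) \<in> r \<Longrightarrow> i \<in> I" "(i, j) \<in> r \<Longrightarrow> j \<in> I"
  using r_closed by auto

lemma index_nonempty: "\<exists>i. i \<in> I"
  using upper_bound[of "{}"] less_finite by auto

lemma upper_bound2: "i \<in> I \<Longrightarrow> j \<in> I \<Longrightarrow> \<exists>k. (i, k) \<in> r \<and> (j, k) \<in> r"
  using upper_bound[of "{i, j}"] less_finite[of "{i, j}"] by auto

lemma elementwise_eqD: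
  assumes L: "elementwise_colimit L \<iota>"
    and ij: "i \<in> I" "j \<in> I" "x \<in> X i" "y \<in> X j" and eq: "\<iota> i x = \<iota> j y"
  shows "\<exists>k. (i, k) \<in> r \<and> (j, k) \<in> r \<and> t i k x = t j k y"
proof -
  obtain m where m: "(i, m) \<in> r" "(j, m) \<in> r" using upper_bound2 ij by blast
  have "\<iota> m (t i m x) = \<iota> m (t j m y)" using elementwise_colimitD(2)[OF L] m ij eq by simp
  then obtain k where k: "(m, k) \<in> r" "t m k (t i m x) = t m k (t j m y)"
    using elementwise_colimitD(4)[OF L r_memb(2)[OF m(1)] t_closed[OF m(1)] t_closed[OF m(2)]] ij
    by blast
  then show ?thesis using m ij r_trans t_comp by metis
qed

text \<open>
  The universal property of a directed colimit of sets: compatible families of maps factor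
  through the elements of \<open>L\<close>, because any two names of an element agree further along the
  diagram.
\<close>

lemma elementwise_factor:
  assumes L: "elementwise_colimit L \<iota>"
    and \<kappa>: "\<And>i j x. (i, j) \<in> r \<Longrightarrow> x \<in> X i \<Longrightarrow> \<kappa> j (t i j x) = \<kappa> i x"
  shows "\<exists>h. \<forall>i\<in>I. \<forall>x\<in>X i. h (\<iota> i x) = \<kappa> i x"
proof -
  have wd: "\<kappa> i x = \<kappa> j y" if ij: "i \<in> I" "j \<in> I" "x \<in> X i" "y \<in> X j" "\<iota> i x = \<iota> j y" for i j x y
    using elementwise_eqD[OF L ij] \<kappa> ij(3,4) by metis
  define h where "h l = (let p = SOME p. fst p \<in> I \<and> snd p \<in> X (fst p) \<and> \<iota> (fst p) (snd p) = l
    in \<kappa> (fst p) (snd p))" for l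
  have "h (\<iota> i x) = \<kappa> i x" if "i \<in> I" "x \<in> X i" for i x
  proof -
    let ?P = "\<lambda>p. fst p \<in> I \<and> snd p \<in> X (fst p) \<and> \<iota> (fst p) (snd p) = \<iota> i x"
    have "?P (Eps ?P)" by (rule someI[of ?P "(i, x)"]) (simp add: that)
    then show ?thesis unfolding h_def Let_def using wd that by blast
  qed
  then show ?thesis by blast
qed

text \<open>
  This is where \<open>\<mu>\<close>-directedness enters: the stages at which single elements are defined, or
  single equations become true, have a common upper bound if there are fewer than \<open>\<mu>\<close> of them.
\<close>

lemma elementwise_lift:
  assumes L: "elementwise_colimit L \<iota>" and W: "|W| <o \<mu>" and l: "\<And>w. w \<in> W \<Longrightarrow> l w \<in> L"
  shows "\<exists>i\<in>I. \<exists>x. \<forall>w\<in>W. x w \<in> X i \<and> \<iota> i (x w) = l w"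
proof -
  have "\<forall>w\<in>W. \<exists>i x. i \<in> I \<and> x \<in> X i \<and> \<iota> i x = l w"
    using elementwise_colimitD(3)[OF L l] by blast
  then obtain i x where ix: "\<And>w. w \<in> W \<Longrightarrow> i w \<in> I \<and> x w \<in> X (i w) \<and> \<iota> (i w) (x w) = l w"
    by metis
  have "i ` W \<subseteq> I" using ix by auto
  from upper_bound[OF this less_image[OF W]]
  obtain j where j: "j \<in> I" "\<And>w. w \<in> W \<Longrightarrow> (i w, j) \<in> r" by auto
  then have "\<forall>w\<in>W. t (i w) j (x w) \<in> X j \<and> \<iota> j (t (i w) j (x w)) = l w"
    using ix t_closed elementwise_colimitD(2)[OF L] by metis
  then show ?thesis
    using j(1) by (intro bexI[of _ j] exI[of _ "\<lambda>w. t (i w) j (x w)"])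
qed

lemma elementwise_equalize:
  assumes L: "elementwise_colimit L \<iota>" and W: "|W| <o \<mu>" and i: "i \<in> I"
    and xy: "\<And>w. w \<in> W \<Longrightarrow> x w \<in> X i \<and> y w \<in> X i \<and> \<iota> i (x w) = \<iota> i (y w)"
  shows "\<exists>j. (i, j) \<in> r \<and> (\<forall>w\<in>W. t i j (x w) = t i j (y w))"
proof -
  have "\<forall>w\<in>W. \<exists>j. (i, j) \<in> r \<and> t i j (x w) = t i j (y w)"
    using elementwise_colimitD(4)[OF L i] xy by blast
  then obtain j where j: "\<And>w. w \<in> W \<Longrightarrow> (i, j w) \<in> r \<and> t i (j w) (x w) = t i (j w) (y w)"
    by metis
  have "|insert i (j ` W)| <o \<mu>" using less_Un[OF less_finite[of "{i}"] less_image[OF W]] by simp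
  moreover have "insert i (j ` W) \<subseteq> I" using i j r_memb(2) by blast
  ultimately obtain k where k: "(i, k) \<in> r" "\<And>w. w \<in> W \<Longrightarrow> (j w, k) \<in> r"
    using upper_bound[of "insert i (j ` W)"] by auto
  have "t i k (x w) = t i k (y w)" if w: "w \<in> W" for w
    using j[OF w] k(2)[OF w] xy[OF w] t_comp by metis
  then show ?thesis using k by blast
qed

end

lemma SetCat_simps [simp]:
  "Ob (SetCat U) = {A. small U A}" "Mor (SetCat U) A B = A \<rightarrow>\<^sub>E B"
  "Idn (SetCat U) A = (\<lambda>x\<in>A. x)" "Cmp (SetCat U) A B D g f = compose A g f"
  by (simp_all add: SetCat_def)

lemma directed_system_SetCat:
  assumes "regular_cardinal \<mu>" "directed_poset U \<mu> I r"
    "is_functor (poset_cat I r) (SetCat U) D"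
  shows "directed_system \<mu> I r (fob D) (\<lambda>i j. fmor D i j ())"
proof -
  interpret regular_cardinal \<mu> by fact
  note P = directed_posetD[OF assms(2)]
  note F = poset_functorD[OF assms(3) P(2), simplified]
  note r = partial_order_onE[OF P(2)]
  show ?thesis
  proof
    fix i j k x assume "(i, j) \<in> r" "(j, k) \<in> r" "x \<in> fob D i"
    then show "fmor D j k () (fmor D i j () x) = fmor D i k () x"
      using F(4)[of i j k] by (metis compose_eq)
  qed (use P F r in \<open>auto simp: PiE_def Pi_def\<close>)
qed

text \<open>
  A directed colimit of sets satisfies the elementwise description, tested against maps into a
  two-element set: two elements of \<open>D i\<close> are identified further along the diagram if and only
  if they are not separated by the cocone that sends an element to one of the two values
  according to whether it is eventually equal to the first of them.
\<close>

lemma (in small_universe) elementwise_SetCat_colimit: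
  fixes D :: "('u, unit, 'a set, 'a \<Rightarrow> 'a) funct" and a b :: 'a
  assumes \<mu>: "regular_cardinal \<mu>" and dir: "directed_poset U \<mu> I r"
    and D: "is_functor (poset_cat I r) (SetCat U) D"
    and colim: "is_colimit (poset_cat I r) (SetCat U) D L \<iota>" and ab: "a \<noteq> b"
  shows "directed_system.elementwise_colimit I r (fob D) (\<lambda>i j. fmor D i j ()) L \<iota>"
proof -
  interpret directed_system \<mu> I r "fob D" "\<lambda>i j. fmor D i j ()"
    by (rule directed_system_SetCat) fact+
  have cocone: "small U L" "\<And>i. i \<in> I \<Longrightarrow> \<iota> i \<in> fob D i \<rightarrow>\<^sub>E L"
    "\<And>i j. (i, j) \<in> r \<Longrightarrow> compose (fob D i) (\<iota> j) (fmor D i j ()) = \<iota> i"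
    using colim by (auto simp: is_colimit_def cocone_poset_iff[OF r_closed])
  have univ: "\<exists>!h. h \<in> L \<rightarrow>\<^sub>E T \<and> (\<forall>i\<in>I. compose (fob D i) h (\<iota> i) = \<kappa> i)"
    if "is_cocone (poset_cat I r) (SetCat U) D T \<kappa>" for T \<kappa>
    using colimit_factor[OF colim that] by simp
  show ?thesis
  proof (rule elementwise_colimitI)
    show mem: "\<iota> i x \<in> L" if "i \<in> I" "x \<in> fob D i" for i x using cocone(2) that by auto
    show nat: "\<iota> j (fmor D i j () x) = \<iota> i x" if "(i, j) \<in> r" "x \<in> fob D i" for i j x
      using cocone(3)[OF that(1)] that(2) by (metis compose_eq)
    show "\<exists>i\<in>I. \<exists>x\<in>fob D i. \<iota> i x = l" if l: "l \<in> L" for l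
    proof (rule ccontr)
      \<comment> \<open>Otherwise two maps that differ only at \<open>l\<close> would induce the same cocone.\<close>
      assume no: "\<not> (\<exists>i\<in>I. \<exists>x\<in>fob D i. \<iota> i x = l)"
      let ?\<kappa> = "\<lambda>i. \<lambda>x\<in>fob D i. a"
      have "is_cocone (poset_cat I r) (SetCat U) D {a, b} ?\<kappa>"
        using t_closed by (auto simp: cocone_poset_iff[OF r_closed] small_finite compose_def)
      note u = univ[OF this]
      let ?h = "\<lambda>c. \<lambda>x\<in>L. if x = l then c else a"
      have "?h c \<in> L \<rightarrow>\<^sub>E {a, b} \<and> (\<forall>i\<in>I. compose (fob D i) (?h c) (\<iota> i) = ?\<kappa> i)"
        if "c \<in> {a, b}" for c
      proof (intro conjI ballI ext)
        fix i x assume "i \<in> I"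
        then show "compose (fob D i) (?h c) (\<iota> i) x = ?\<kappa> i x"
          using no mem by (auto simp: compose_def)
      qed (use that in auto)
      then have "?h a = ?h b" using u by blast
      then have "?h a l = ?h b l" by (rule fun_cong)
      then show False using l ab by simp
    qed
    show "\<exists>j. (i, j) \<in> r \<and> fmor D i j () x = fmor D i j () y"
      if i: "i \<in> I" "x \<in> fob D i" "y \<in> fob D i" and eq: "\<iota> i x = \<iota> i y" for i x y
    proof -
      define P where "P j z \<longleftrightarrow> (\<exists>k. (i, k) \<in> r \<and> (j, k) \<in> r \<and> fmor D j k () z = fmor D i k () x)"
        for j z
      let ?\<kappa> = "\<lambda>j. \<lambda>z\<in>fob D j. if P j z then a else b"
      have P: "P j' (fmor D j j' () z) \<longleftrightarrow> P j z" if j: "(j, j') \<in> r" "z \<in> fob D j" for j j' z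
      proof
        assume "P j' (fmor D j j' () z)"
        then show "P j z" unfolding P_def using j r_trans t_comp by metis
      next
        assume "P j z"
        then obtain k where k: "(i, k) \<in> r" "(j, k) \<in> r" "fmor D j k () z = fmor D i k () x"
          unfolding P_def by blast
        obtain m where m: "(k, m) \<in> r" "(j', m) \<in> r" using upper_bound2 r_memb k j by meson
        have "fmor D j' m () (fmor D j j' () z) = fmor D j m () z" using t_comp j m by simp
        also have "\<dots> = fmor D k m () (fmor D j k () z)"
          using t_comp[of j k m z] k(2) m j by simp
        also have "\<dots> = fmor D i m () x" using t_comp k m i by simp
        finally show "P j' (fmor D j j' () z)" unfolding P_def using m k r_trans by blast
      qed
      have "is_cocone (poset_cat I r) (SetCat U) D {a, b} ?\<kappa>"
        using t_closed P
        by (auto simp: cocone_poset_iff[OF r_closed] small_finite compose_def fun_eq_iff)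
      from univ[OF this] obtain h where h: "\<And>j. j \<in> I \<Longrightarrow> compose (fob D j) h (\<iota> j) = ?\<kappa> j"
        by blast
      have "?\<kappa> i x = ?\<kappa> i y" using h[OF i(1)] eq i by (metis compose_eq)
      moreover have "P i x" unfolding P_def using i r_refl by blast
      ultimately have "P i y" using i ab by (simp split: if_splits)
      then show ?thesis unfolding P_def by metis
    qed
  qed
qed

lemma SetCat_colimit_elementwise:
  assumes \<mu>: "regular_cardinal \<mu>" and dir: "directed_poset U \<mu> I r"
    and D: "is_functor (poset_cat I r) (SetCat U) D"
    and L: "small U L" and \<iota>: "\<And>i. i \<in> I \<Longrightarrow> \<iota> i \<in> extensional (fob D i)"
    and colim: "directed_system.elementwise_colimit I r (fob D) (\<lambda>i j. fmor D i j ()) L \<iota>"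
  shows "is_colimit (poset_cat I r) (SetCat U) D L \<iota>"
proof -
  interpret directed_system \<mu> I r "fob D" "\<lambda>i j. fmor D i j ()"
    by (rule directed_system_SetCat) fact+
  note E = elementwise_colimitD[OF colim]
  show ?thesis unfolding is_colimit_def
  proof (intro conjI allI impI)
    have "compose (fob D i) (\<iota> j) (fmor D i j ()) = \<iota> i" if "(i, j) \<in> r" for i j
      by (rule extensionalityI[of _ "fob D i"])
        (use that \<iota> r_memb E(2) in \<open>auto simp: compose_eq\<close>)
    then show "is_cocone (poset_cat I r) (SetCat U) D L \<iota>"
      using L \<iota> E(1) by (auto simp: cocone_poset_iff[OF r_closed] PiE_def)
    fix T \<kappa> assume \<kappa>: "is_cocone (poset_cat I r) (SetCat U) D T \<kappa>"
    then have \<kappa>1: "\<And>i. i \<in> I \<Longrightarrow> \<kappa> i \<in> fob D i \<rightarrow>\<^sub>E T"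
      and \<kappa>2: "\<And>i j. (i, j) \<in> r \<Longrightarrow> compose (fob D i) (\<kappa> j) (fmor D i j ()) = \<kappa> i"
      by (auto simp: cocone_poset_iff[OF r_closed])
    have "\<And>i j x. (i, j) \<in> r \<Longrightarrow> x \<in> fob D i \<Longrightarrow> \<kappa> j (fmor D i j () x) = \<kappa> i x"
      using \<kappa>2 by (metis compose_eq)
    from elementwise_factor[OF colim, of \<kappa>, OF this] obtain h
      where h: "\<And>i x. i \<in> I \<Longrightarrow> x \<in> fob D i \<Longrightarrow> h (\<iota> i x) = \<kappa> i x" by blast
    show "\<exists>!h. h \<in> Mor (SetCat U) L T \<and>
        (\<forall>i\<in>Ob (poset_cat I r). Cmp (SetCat U) (fob D i) L T h (\<iota> i) = \<kappa> i)"
    proof (rule ex1I[of _ "restrict h L"], simp_all, intro conjI)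
      show "\<forall>i\<in>I. compose (fob D i) (restrict h L) (\<iota> i) = \<kappa> i"
      proof
        fix i assume i: "i \<in> I"
        show "compose (fob D i) (restrict h L) (\<iota> i) = \<kappa> i"
          by (rule extensionalityI[of _ "fob D i"]) (use i \<kappa>1[OF i] E(1) h in \<open>auto simp: compose_eq PiE_def\<close>)
      qed
      show "h \<in> L \<rightarrow> T"
      proof
        fix l assume "l \<in> L"
        then obtain i x where "i \<in> I" "x \<in> fob D i" "\<iota> i x = l" using E(3) by blast
        then show "h l \<in> T" using h \<kappa>1 by (metis PiE_mem)
      qed
    next
      fix g assume g: "g \<in> L \<rightarrow>\<^sub>E T \<and> (\<forall>i\<in>I. compose (fob D i) g (\<iota> i) = \<kappa> i)"
      show "g = restrict h L"
      proof (rule extensionalityI[of _ L])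
        fix l assume l: "l \<in> L"
        then obtain i x where "i \<in> I" "x \<in> fob D i" "\<iota> i x = l" using E(3) by blast
        then show "g l = restrict h L l" using h g l by (metis compose_eq restrict_apply)
      qed (use g in \<open>auto simp: PiE_def\<close>)
    qed
  qed
qed

section \<open>Presented objects in terms of elements\<close>

lemma hom_functor_set_functor:
  assumes C: "is_category C" "locally_small U C" and A: "A \<in> Ob C"
  shows "is_functor C (SetCat U) (hom_functor_set C A)"
  unfolding is_functor_def hom_functor_set_def
proof (simp, intro conjI ballI)
  fix X assume X: "X \<in> Ob C"
  show "small U (Mor C A X)" using C(2) A X by (simp add: locally_small_def)
  show "(\<lambda>g\<in>Mor C A X. Cmp C A X X (Idn C X) g) = (\<lambda>x\<in>Mor C A X. x)"
    using category_idl[OF C(1) A X] by auto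
  fix Y assume Y: "Y \<in> Ob C"
  fix f assume f: "f \<in> Mor C X Y"
  show "Cmp C A X Y f \<in> Mor C A X \<rightarrow> Mor C A Y"
    using category_cmp[OF C(1) A X Y _ f] by blast
  fix Z g assume Z: "Z \<in> Ob C" and g: "g \<in> Mor C Y Z"
  show "restrict (Cmp C A X Z (Cmp C X Y Z g f)) (Mor C A X) =
    compose (Mor C A X) (restrict (Cmp C A Y Z g) (Mor C A Y)) (restrict (Cmp C A X Y f) (Mor C A X))"
    using category_assoc[OF C(1) A X Y Z _ f g] category_cmp[OF C(1) A X Y _ f]
    by (auto simp: compose_def)
qed

text \<open>
  This is the elementwise form of the statement that \<open>Hom(A, -)\<close> preserves the colimit with legs
  \<open>\<iota> i : D i \<rightarrow> L\<close>.
\<close>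

definition factors_essentially_uniquely ::
  "('o, 'a, 'z) category_scheme \<Rightarrow> 'i set \<Rightarrow> 'i rel \<Rightarrow> ('i, unit, 'o, 'a) funct \<Rightarrow>
   'o \<Rightarrow> ('i \<Rightarrow> 'a) \<Rightarrow> 'o \<Rightarrow> bool" where
  "factors_essentially_uniquely C I r D L \<iota> A \<longleftrightarrow>
     (\<forall>f\<in>Mor C A L. \<exists>i\<in>I. \<exists>g\<in>Mor C A (fob D i). Cmp C A (fob D i) L (\<iota> i) g = f) \<and>
     (\<forall>i\<in>I. \<forall>g\<in>Mor C A (fob D i). \<forall>g'\<in>Mor C A (fob D i).
        Cmp C A (fob D i) L (\<iota> i) g = Cmp C A (fob D i) L (\<iota> i) g' \<longrightarrow>
        (\<exists>j. (i, j) \<in> r \<and> Cmp C A (fob D i) (fob D j) (fmor D i j ()) g =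
                          Cmp C A (fob D i) (fob D j) (fmor D i j ()) g'))"

lemma hom_elementwise_iff:
  assumes \<mu>: "regular_cardinal \<mu>" and dir: "directed_poset U \<mu> I r"
    and C: "is_category C" "locally_small U C" and A: "A \<in> Ob C"
    and D: "is_functor (poset_cat I r) C D" and L: "is_cocone (poset_cat I r) C D L \<iota>"
  shows "directed_system.elementwise_colimit I r (\<lambda>i. Mor C A (fob D i))
      (\<lambda>i j. \<lambda>g\<in>Mor C A (fob D i). Cmp C A (fob D i) (fob D j) (fmor D i j ()) g)
      (Mor C A L) (\<lambda>i. \<lambda>g\<in>Mor C A (fob D i). Cmp C A (fob D i) L (\<iota> i) g)
    \<longleftrightarrow> factors_essentially_uniquely C I r D L \<iota> A" (is "?E = ?F")
proof -
  note F = hom_functor_set_functor[OF C A]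
  interpret directed_system \<mu> I r "\<lambda>i. Mor C A (fob D i)"
      "\<lambda>i j. \<lambda>g\<in>Mor C A (fob D i). Cmp C A (fob D i) (fob D j) (fmor D i j ()) g"
    using directed_system_SetCat[OF \<mu> dir functor_fcomp[OF D F]]
    by (simp add: fcomp_def hom_functor_set_def)
  note D' = poset_functorD[OF D partial_order]
  have L': "L \<in> Ob C" "\<And>i. i \<in> I \<Longrightarrow> \<iota> i \<in> Mor C (fob D i) L"
    "\<And>i j. (i, j) \<in> r \<Longrightarrow> Cmp C (fob D i) (fob D j) L (\<iota> j) (fmor D i j ()) = \<iota> i"
    using L by (auto simp: cocone_poset_iff[OF r_closed])
  show ?thesis
  proof
    assume E: ?E
    show ?F unfolding factors_essentially_uniquely_def
    proof (intro conjI ballI impI)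
      fix f assume "f \<in> Mor C A L"
      then show "\<exists>i\<in>I. \<exists>g\<in>Mor C A (fob D i). Cmp C A (fob D i) L (\<iota> i) g = f"
        using elementwise_colimitD(3)[OF E] by (metis restrict_apply')
    next
      fix i g g' assume *: "i \<in> I" "g \<in> Mor C A (fob D i)" "g' \<in> Mor C A (fob D i)"
        "Cmp C A (fob D i) L (\<iota> i) g = Cmp C A (fob D i) L (\<iota> i) g'"
      then show "\<exists>j. (i, j) \<in> r \<and> Cmp C A (fob D i) (fob D j) (fmor D i j ()) g =
                          Cmp C A (fob D i) (fob D j) (fmor D i j ()) g'"
        using elementwise_colimitD(4)[OF E *(1-3)] by auto
    qed
  next
    assume F: ?F
    show ?E
    proof (rule elementwise_colimitI, goal_cases)
      case (1 i g)
      then show ?case using category_cmp[OF C(1) A D'(1) L'(1) _ L'(2)] by simp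
    next
      case (2 i j g)
      then have "Cmp C A (fob D i) (fob D j) (fmor D i j ()) g \<in> Mor C A (fob D j)"
        using category_cmp[OF C(1) A D'(1) D'(1) _ D'(2)] r_memb by blast
      then show ?case
        using 2 category_assoc[OF C(1) A D'(1) D'(1) L'(1) _ D'(2) L'(2)] L'(3) r_memb
        by simp
    next
      case (3 l)
      then show ?case using F unfolding factors_essentially_uniquely_def by (metis restrict_apply')
    next
      case (4 i g g')
      then show ?case using F unfolding factors_essentially_uniquely_def by simp
    qed
  qed
qed

lemma (in small_universe) presentedD:
  fixes C :: "('o, 'u, 'z) category_scheme"
  assumes \<mu>: "regular_cardinal \<mu>" and C: "is_category C" "locally_small U C"
    and A: "presented U \<mu> C A" and dir: "directed_poset U \<mu> I r"
    and D: "is_functor (poset_cat I r) C D" and L: "is_colimit (poset_cat I r) C D L \<iota>"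
  shows "factors_essentially_uniquely C I r D L \<iota> A"
proof -
  have A': "A \<in> Ob C" using A by (simp add: presented_def)
  note F = hom_functor_set_functor[OF C A']
  have "is_colimit (poset_cat I r) (SetCat U) (fcomp (hom_functor_set C A) D)
      (fob (hom_functor_set C A) L) (\<lambda>i. fmor (hom_functor_set C A) (fob D i) L (\<iota> i))"
    using A dir D L unfolding presented_def preserves_directed_colimits_def by blast
  moreover obtain a b :: 'u where "a \<noteq> b" using two_elements by blast
  ultimately have "directed_system.elementwise_colimit I r (fob (fcomp (hom_functor_set C A) D))
      (\<lambda>i j. fmor (fcomp (hom_functor_set C A) D) i j ())
      (fob (hom_functor_set C A) L) (\<lambda>i. fmor (hom_functor_set C A) (fob D i) L (\<iota> i))"
    by (rule elementwise_SetCat_colimit[OF \<mu> dir functor_fcomp[OF D F]])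
  then show ?thesis
    using hom_elementwise_iff[OF \<mu> dir C A' D] L
    by (simp add: fcomp_def hom_functor_set_def is_colimit_def)
qed

lemma presentedI:
  assumes \<mu>: "regular_cardinal \<mu>" and C: "is_category C" "locally_small U C" and A: "A \<in> Ob C"
    and fac: "\<And>I r D L \<iota>. directed_poset U \<mu> I r \<Longrightarrow> is_functor (poset_cat I r) C D \<Longrightarrow>
      is_colimit (poset_cat I r) C D L \<iota> \<Longrightarrow> factors_essentially_uniquely C I r D L \<iota> A"
  shows "presented U \<mu> C A"
  unfolding presented_def preserves_directed_colimits_def
proof (intro conjI allI impI A)
  fix I r D L \<iota>
  assume dir: "directed_poset U \<mu> I r" and D: "is_functor (poset_cat I r) C D"
    and L: "is_colimit (poset_cat I r) C D L \<iota>"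
  note F = hom_functor_set_functor[OF C A]
  have L': "is_cocone (poset_cat I r) C D L \<iota>" "L \<in> Ob C"
    using L by (auto simp: is_colimit_def is_cocone_def)
  show "is_colimit (poset_cat I r) (SetCat U) (fcomp (hom_functor_set C A) D)
      (fob (hom_functor_set C A) L) (\<lambda>i. fmor (hom_functor_set C A) (fob D i) L (\<iota> i))"
  proof (rule SetCat_colimit_elementwise[OF \<mu> dir functor_fcomp[OF D F]])
    show "small U (fob (hom_functor_set C A) L)" using functor_ob[OF F L'(2)] by simp
    show "directed_system.elementwise_colimit I r (fob (fcomp (hom_functor_set C A) D))
        (\<lambda>i j. fmor (fcomp (hom_functor_set C A) D) i j ())
        (fob (hom_functor_set C A) L) (\<lambda>i. fmor (hom_functor_set C A) (fob D i) L (\<iota> i))"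
      using hom_elementwise_iff[OF \<mu> dir C A D L'(1)] fac[OF dir D L]
      by (simp add: fcomp_def hom_functor_set_def)
  qed (simp add: fcomp_def hom_functor_set_def)
qed

section \<open>The category of abelian groups and its directed colimits\<close>

lemma Ab_simps [simp]:
  "G \<in> Ob (Ab U) \<longleftrightarrow> comm_group G \<and> small U (carrier G)"
  "f \<in> Mor (Ab U) G H \<longleftrightarrow> f \<in> hom G H \<and> f \<in> extensional (carrier G)"
  "Idn (Ab U) G = (\<lambda>x\<in>carrier G. x)"
  "Cmp (Ab U) G H K g f = compose (carrier G) g f"
  by (auto simp: Ab_def)

lemma Ab_mor_eqI:
  "f \<in> Mor (Ab U) G H \<Longrightarrow> g \<in> Mor (Ab U) G H \<Longrightarrow> (\<And>x. x \<in> carrier G \<Longrightarrow> f x = g x) \<Longrightarrow> f = g"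
  by (auto intro: extensionalityI)

lemma category_Ab: "is_category (Ab U)"
  unfolding is_category_def
proof (intro conjI ballI)
  fix G H K f g assume "G \<in> Ob (Ab U)" "f \<in> Mor (Ab U) G H" "g \<in> Mor (Ab U) H K"
  then show "Cmp (Ab U) G H K g f \<in> Mor (Ab U) G K"
    by (auto simp: hom_def compose_def Pi_def comm_groupE(1))
next
  fix W X Y Z f g h
  assume "f \<in> Mor (Ab U) W X"
  then show "Cmp (Ab U) W X Z (Cmp (Ab U) X Y Z h g) f = Cmp (Ab U) W Y Z h (Cmp (Ab U) W X Y g f)"
    by (auto simp: hom_def compose_assoc)
qed (auto simp: hom_def comm_groupE(1) Id_compose compose_Id)

lemma (in small_universe) locally_small_Ab: "locally_small U (Ab U)"
  unfolding locally_small_def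
proof (intro ballI)
  fix G H assume "G \<in> Ob (Ab U)" "H \<in> Ob (Ab U)"
  then have "small U (carrier G \<rightarrow>\<^sub>E carrier H)" by (simp add: small_PiE)
  then show "small U (Mor (Ab U) G H)"
    by (rule small_mono) (auto simp: hom_def PiE_def Pi_def)
qed

lemma hom_eq_iff_kernel:
  assumes "group_hom G H h" "x \<in> carrier G" "y \<in> carrier G"
  shows "h x = h y \<longleftrightarrow> h (x \<otimes>\<^bsub>G\<^esub> inv\<^bsub>G\<^esub> y) = \<one>\<^bsub>H\<^esub>"
proof -
  interpret group_hom G H h by fact
  show ?thesis using assms by simp (metis H.inv_solve_right' H.l_one H.one_closed hom_closed)
qed

text \<open>
  The groups with underlying set contained in \<open>K\<close>. The multiplication is pinned down outside the
  carrier, since otherwise its arbitrary values there would make this set as large as the universe.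
\<close>

definition groups_on :: "'u set \<Rightarrow> 'u monoid set" where
  "groups_on K = {G. comm_group G \<and> carrier G \<subseteq> K \<and>
     (\<forall>x y. x \<notin> carrier G \<or> y \<notin> carrier G \<longrightarrow> x \<otimes>\<^bsub>G\<^esub> y = undefined)}"

lemma (in small_universe) small_groups_on:
  fixes K :: "'a set"
  assumes "small U K"
  shows "small U (groups_on K)"
proof -
  let ?f = "\<lambda>G. (carrier G, {(x, y, z). x \<in> carrier G \<and> y \<in> carrier G \<and> z = x \<otimes>\<^bsub>G\<^esub> y}, \<one>\<^bsub>G\<^esub>)"
  have "inj_on ?f (groups_on K)"
  proof (rule inj_onI)
    fix G H :: "'a monoid"
    assume G: "G \<in> groups_on K" and H: "H \<in> groups_on K" and eq: "?f G = ?f H"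
    have "x \<otimes>\<^bsub>G\<^esub> y = x \<otimes>\<^bsub>H\<^esub> y" for x y
    proof (cases "x \<in> carrier G \<and> y \<in> carrier G")
      case True
      then have "(x, y, x \<otimes>\<^bsub>G\<^esub> y) \<in> {(x, y, z). x \<in> carrier G \<and> y \<in> carrier G \<and> z = x \<otimes>\<^bsub>G\<^esub> y}"
        by simp
      also have "\<dots> = {(x, y, z). x \<in> carrier H \<and> y \<in> carrier H \<and> z = x \<otimes>\<^bsub>H\<^esub> y}"
        using eq unfolding prod.inject by blast
      finally show ?thesis by simp
    next
      case False
      then show ?thesis using G H eq by (simp add: groups_on_def)
    qed
    then show "G = H" using eq by (intro monoid.equality) auto
  qed
  moreover have "?f ` groups_on K \<subseteq> Pow K \<times> Pow (K \<times> K \<times> K) \<times> K"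
    by (auto simp: groups_on_def intro: subsetD comm_groupE(1) comm_groupE(2))
  ultimately show ?thesis
    by (rule small_inj) (intro small_Sigma small_Pow assms)
qed

text \<open>
  An abelian group can be presented as a quotient of a set \<open>W\<close> of formal expressions; the
  equivalence relation is the kernel of a map \<open>q\<close> that the operations respect. If \<open>W\<close> embeds
  into \<open>K\<close>, the quotient can be carried by \<open>K\<close>, as the set of chosen representatives.
\<close>

lemma quotient_group_exists:
  fixes W :: "'w set" and q :: "'w \<Rightarrow> 'q" and j :: "'w \<Rightarrow> 'u"
  assumes j: "inj_on j W" "j ` W \<subseteq> K"
    and closed: "e \<in> W" "\<And>a b. a \<in> W \<Longrightarrow> b \<in> W \<Longrightarrow> m a b \<in> W"
    and cong: "\<And>a a' b b'. a \<in> W \<Longrightarrow> a' \<in> W \<Longrightarrow> b \<in> W \<Longrightarrow> b' \<in> W \<Longrightarrow> q a = q a' \<Longrightarrow> q b = q b'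
      \<Longrightarrow> q (m a b) = q (m a' b')"
    and assoc: "\<And>a b c. a \<in> W \<Longrightarrow> b \<in> W \<Longrightarrow> c \<in> W \<Longrightarrow> q (m (m a b) c) = q (m a (m b c))"
    and comm: "\<And>a b. a \<in> W \<Longrightarrow> b \<in> W \<Longrightarrow> q (m a b) = q (m b a)"
    and unit: "\<And>a. a \<in> W \<Longrightarrow> q (m e a) = q a"
    and inv: "\<And>a. a \<in> W \<Longrightarrow> \<exists>b\<in>W. q (m b a) = q e"
  shows "\<exists>G c. G \<in> groups_on K \<and> carrier G = c ` W \<and>
    (\<forall>a\<in>W. \<forall>b\<in>W. c (m a b) = c a \<otimes>\<^bsub>G\<^esub> c b \<and> (c a = c b \<longleftrightarrow> q a = q b))"
proof -
  define rep where "rep a = (SOME b. b \<in> W \<and> q b = q a)" for a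
  have rep: "rep a \<in> W \<and> q (rep a) = q a" if "a \<in> W" for a
    unfolding rep_def by (rule someI[of _ a]) (simp add: that)
  define c where "c a = j (rep a)" for a
  have c_eq: "c a = c b \<longleftrightarrow> q a = q b" if "a \<in> W" "b \<in> W" for a b
  proof
    assume "c a = c b"
    then have "rep a = rep b" using inj_onD[OF j(1)] rep that by (simp add: c_def)
    then show "q a = q b" using rep that by metis
  next
    assume "q a = q b" then show "c a = c b" by (simp add: c_def rep_def)
  qed
  define G where "G = \<lparr>carrier = c ` W,
    mult = (\<lambda>x y. if x \<in> c ` W \<and> y \<in> c ` W then c (m (inv_into W c x) (inv_into W c y)) else undefined),
    one = c e\<rparr>"
  have inv_c: "inv_into W c (c a) \<in> W" "q (inv_into W c (c a)) = q a" if "a \<in> W" for a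
  proof -
    show *: "inv_into W c (c a) \<in> W" by (rule inv_into_into) (use that in simp)
    have "c (inv_into W c (c a)) = c a" by (rule f_inv_into_f) (use that in simp)
    then show "q (inv_into W c (c a)) = q a" using c_eq[OF * that] by simp
  qed
  have mult: "c a \<otimes>\<^bsub>G\<^esub> c b = c (m a b)" if "a \<in> W" "b \<in> W" for a b
  proof -
    have "c a \<otimes>\<^bsub>G\<^esub> c b = c (m (inv_into W c (c a)) (inv_into W c (c b)))"
      using that by (simp add: G_def)
    also have "\<dots> = c (m a b)"
      using c_eq[OF closed(2)[OF inv_c(1)[OF that(1)] inv_c(1)[OF that(2)]] closed(2)[OF that]]
        cong[OF inv_c(1)[OF that(1)] that(1) inv_c(1)[OF that(2)] that(2) inv_c(2)[OF that(1)]
          inv_c(2)[OF that(2)]]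
      by blast
    finally show ?thesis .
  qed
  have carrier: "carrier G = c ` W" by (simp add: G_def)
  have "comm_group G"
  proof (rule comm_groupI)
    fix x y assume "x \<in> carrier G" "y \<in> carrier G"
    then obtain a b where ab: "a \<in> W" "b \<in> W" "x = c a" "y = c b" by (auto simp: carrier)
    show "x \<otimes>\<^bsub>G\<^esub> y \<in> carrier G" using ab mult closed by (simp add: carrier)
    show "x \<otimes>\<^bsub>G\<^esub> y = y \<otimes>\<^bsub>G\<^esub> x" using ab mult closed comm c_eq by simp
    fix z assume "z \<in> carrier G"
    then obtain d where "d \<in> W" "z = c d" by (auto simp: carrier)
    then show "(x \<otimes>\<^bsub>G\<^esub> y) \<otimes>\<^bsub>G\<^esub> z = x \<otimes>\<^bsub>G\<^esub> (y \<otimes>\<^bsub>G\<^esub> z)" using ab mult closed assoc c_eq by simp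
  next
    fix x assume "x \<in> carrier G"
    then obtain a where a: "a \<in> W" "x = c a" by (auto simp: carrier)
    have one: "\<one>\<^bsub>G\<^esub> = c e" by (simp add: G_def)
    show "\<one>\<^bsub>G\<^esub> \<otimes>\<^bsub>G\<^esub> x = x" using a one mult closed unit c_eq by simp
    obtain b where "b \<in> W" "q (m b a) = q e" using inv a by blast
    then show "\<exists>y\<in>carrier G. y \<otimes>\<^bsub>G\<^esub> x = \<one>\<^bsub>G\<^esub>"
      using a mult closed c_eq one by (intro bexI[of _ "c b"]) (auto simp: carrier)
  qed (use closed in \<open>auto simp: G_def\<close>)
  moreover have "c ` W \<subseteq> K" using j(2) rep by (auto simp: c_def)
  moreover have "x \<otimes>\<^bsub>G\<^esub> y = undefined" if "x \<notin> carrier G \<or> y \<notin> carrier G" for x y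
    using that by (auto simp: G_def)
  ultimately have "G \<in> groups_on K" by (simp add: groups_on_def carrier)
  then show ?thesis using carrier mult c_eq by (intro exI[of _ G] exI[of _ c]) simp
qed

lemma directed_system_Ab:
  assumes "regular_cardinal \<mu>" "directed_poset U \<mu> I r" "is_functor (poset_cat I r) (Ab U) D"
  shows "directed_system \<mu> I r (\<lambda>i. carrier (fob D i)) (\<lambda>i j. fmor D i j ())"
proof -
  interpret regular_cardinal \<mu> by fact
  note P = directed_posetD[OF assms(2)]
  note F = poset_functorD[OF assms(3) P(2), simplified]
  note r = partial_order_onE[OF P(2)]
  show ?thesis
  proof
    fix i j k x assume "(i, j) \<in> r" "(j, k) \<in> r" "x \<in> carrier (fob D i)"
    then show "fmor D j k () (fmor D i j () x) = fmor D i k () x"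
      using F(4)[of i j k] by (metis compose_eq)
  qed (use P F r in \<open>auto simp: hom_def Pi_def\<close>)
qed

lemma Ab_colimit_elementwise:
  assumes \<mu>: "regular_cardinal \<mu>" and dir: "directed_poset U \<mu> I r"
    and D: "is_functor (poset_cat I r) (Ab U) D"
    and L: "L \<in> Ob (Ab U)" and \<iota>: "\<And>i. i \<in> I \<Longrightarrow> \<iota> i \<in> Mor (Ab U) (fob D i) L"
    and colim: "directed_system.elementwise_colimit I r (\<lambda>i. carrier (fob D i))
      (\<lambda>i j. fmor D i j ()) (carrier L) \<iota>"
  shows "is_colimit (poset_cat I r) (Ab U) D L \<iota>"
proof -
  interpret directed_system \<mu> I r "\<lambda>i. carrier (fob D i)" "\<lambda>i j. fmor D i j ()"
    by (rule directed_system_Ab) fact+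
  note E = elementwise_colimitD[OF colim]
  note D' = poset_functorD[OF D partial_order, simplified]
  show ?thesis unfolding is_colimit_def
  proof (intro conjI allI impI)
    have "compose (carrier (fob D i)) (\<iota> j) (fmor D i j ()) = \<iota> i" if "(i, j) \<in> r" for i j
      by (rule extensionalityI[of _ "carrier (fob D i)"])
        (use that \<iota> r_memb E(2) in \<open>auto simp: compose_eq\<close>)
    then show cocone: "is_cocone (poset_cat I r) (Ab U) D L \<iota>"
      using L \<iota> by (auto simp: cocone_poset_iff[OF r_closed])
    fix T \<kappa> assume \<kappa>: "is_cocone (poset_cat I r) (Ab U) D T \<kappa>"
    then have T: "comm_group T" and \<kappa>1: "\<And>i. i \<in> I \<Longrightarrow> \<kappa> i \<in> Mor (Ab U) (fob D i) T"
      and \<kappa>2: "\<And>i j. (i, j) \<in> r \<Longrightarrow> compose (carrier (fob D i)) (\<kappa> j) (fmor D i j ()) = \<kappa> i"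
      by (auto simp: cocone_poset_iff[OF r_closed])
    have "\<And>i j x. (i, j) \<in> r \<Longrightarrow> x \<in> carrier (fob D i) \<Longrightarrow> \<kappa> j (fmor D i j () x) = \<kappa> i x"
      using \<kappa>2 by (metis compose_eq)
    from elementwise_factor[OF colim, of \<kappa>, OF this] obtain h
      where h: "\<And>i x. i \<in> I \<Longrightarrow> x \<in> carrier (fob D i) \<Longrightarrow> h (\<iota> i x) = \<kappa> i x" by blast
    have rep: "\<exists>i\<in>I. \<exists>x\<in>carrier (fob D i). l = \<iota> i x" if "l \<in> carrier L" for l
      using E(3) that by metis
    have h_closed: "h l \<in> carrier T" if l: "l \<in> carrier L" for l
    proof -
      obtain i x where "i \<in> I" "x \<in> carrier (fob D i)" "l = \<iota> i x" using rep l by blast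
      then show ?thesis using h \<kappa>1 hom_in_carrier by fastforce
    qed
    have h_mult: "h (l \<otimes>\<^bsub>L\<^esub> l') = h l \<otimes>\<^bsub>T\<^esub> h l'" if l: "l \<in> carrier L" "l' \<in> carrier L" for l l'
    proof -
      have "\<exists>i\<in>I. \<exists>x. \<forall>w\<in>{True, False}. x w \<in> carrier (fob D i) \<and>
          \<iota> i (x w) = (if w then l else l')"
        by (rule elementwise_lift[OF colim less_finite]) (use l in auto)
      then obtain i x where "i \<in> I" "\<forall>w\<in>{True, False}. x w \<in> carrier (fob D i) \<and>
          \<iota> i (x w) = (if w then l else l')" by blast
      then have i: "i \<in> I" "x True \<in> carrier (fob D i)" "x False \<in> carrier (fob D i)"
        and ll: "l = \<iota> i (x True)" "l' = \<iota> i (x False)" by auto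
      have cl: "x True \<otimes>\<^bsub>fob D i\<^esub> x False \<in> carrier (fob D i)"
        using D'(1)[OF i(1)] i by (simp add: comm_groupE(1))
      have "l \<otimes>\<^bsub>L\<^esub> l' = \<iota> i (x True \<otimes>\<^bsub>fob D i\<^esub> x False)"
        using \<iota>[OF i(1)] i ll by (simp add: hom_mult[of _ "fob D i" L])
      then show ?thesis using h[OF i(1)] cl i \<kappa>1[OF i(1)] ll
        by (simp add: hom_mult[of _ "fob D i" T])
    qed
    show "\<exists>!h. h \<in> Mor (Ab U) L T \<and>
        (\<forall>i\<in>Ob (poset_cat I r). Cmp (Ab U) (fob D i) L T h (\<iota> i) = \<kappa> i)"
    proof (rule ex1I[of _ "restrict h (carrier L)"], intro conjI ballI)
      show "restrict h (carrier L) \<in> Mor (Ab U) L T"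
        using h_closed h_mult L by (auto simp: hom_def comm_groupE(1))
      fix i assume "i \<in> Ob (poset_cat I r)"
      then have i: "i \<in> I" by simp
      show "Cmp (Ab U) (fob D i) L T (restrict h (carrier L)) (\<iota> i) = \<kappa> i"
        by (simp, rule extensionalityI[of _ "carrier (fob D i)"])
          (use i \<kappa>1[OF i] E(1) h in \<open>auto simp: compose_eq\<close>)
    next
      fix g assume g: "g \<in> Mor (Ab U) L T \<and>
        (\<forall>i\<in>Ob (poset_cat I r). Cmp (Ab U) (fob D i) L T g (\<iota> i) = \<kappa> i)"
      show "g = restrict h (carrier L)"
      proof (rule extensionalityI[of _ "carrier L"])
        fix l assume l: "l \<in> carrier L"
        then obtain i x where "i \<in> I" "x \<in> carrier (fob D i)" "l = \<iota> i x" using rep by blast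
        moreover have "compose (carrier (fob D i)) g (\<iota> i) = \<kappa> i" if "i \<in> I" for i
          using g that by simp
        ultimately show "g l = restrict h (carrier L) l" using h l by (metis compose_eq restrict_apply)
      qed (use g in auto)
    qed
  qed
qed

text \<open>
  The colimit consists of the pairs \<open>(i, x)\<close> with \<open>x \<in> D i\<close>, two pairs being identified if they
  become equal further along the diagram.
\<close>

lemma (in small_universe) elementwise_colimit_exists:
  assumes \<mu>: "regular_cardinal \<mu>" and dir: "directed_poset U \<mu> I r"
    and D: "is_functor (poset_cat I r) (Ab U) D"
  shows "\<exists>L \<iota>. L \<in> Ob (Ab U) \<and> (\<forall>i\<in>I. \<iota> i \<in> Mor (Ab U) (fob D i) L) \<and>
    directed_system.elementwise_colimit I r (\<lambda>i. carrier (fob D i)) (\<lambda>i j. fmor D i j ())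
      (carrier L) \<iota>"
proof -
  define t where "t i j = fmor D i j ()" for i j
  interpret directed_system \<mu> I r "\<lambda>i. carrier (fob D i)" t
    unfolding t_def by (rule directed_system_Ab) fact+
  note D' = poset_functorD[OF D partial_order, simplified, folded t_def]
  have t_hom: "t i j (x \<otimes>\<^bsub>fob D i\<^esub> y) = t i j x \<otimes>\<^bsub>fob D j\<^esub> t i j y"
    if "(i, j) \<in> r" "x \<in> carrier (fob D i)" "y \<in> carrier (fob D i)" for i j x y
    using D'(2) that by (simp add: hom_mult)
  have grp: "comm_group (fob D i)" if "i \<in> I" for i using D'(1) that by simp
  define W where "W = Sigma I (\<lambda>i. carrier (fob D i))"
  have "small U W" unfolding W_def
    by (rule small_Sigma) (use directed_posetD(1)[OF dir] D'(1) in auto)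
  then obtain e :: "'u \<times> 'u \<Rightarrow> 'u" where e: "inj_on e W" using small_embeds by blast
  have small: "small U (e ` W)" using \<open>small U W\<close> by (rule small_image)
  define R where "R = {(a, b). a \<in> W \<and> b \<in> W \<and> (\<exists>k. (fst a, k) \<in> r \<and> (fst b, k) \<in> r \<and>
    t (fst a) k (snd a) = t (fst b) k (snd b))}"
  have RI: "((i, x), (j, y)) \<in> R" if "(i, k) \<in> r" "(j, k) \<in> r" "x \<in> carrier (fob D i)"
    "y \<in> carrier (fob D j)" "t i k x = t j k y" for i j k x y
    using that r_memb by (auto simp: R_def W_def)
  have equiv: "equiv W R"
  proof (rule equivI)
    show "refl_on W R"
    proof (rule refl_onI)
      fix a assume "a \<in> W"
      then show "(a, a) \<in> R" using r_refl unfolding R_def W_def by (cases a) auto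
    qed
    show "sym R"
      by (rule symI) (auto simp: R_def)
    show "trans R"
    proof (rule transI, clarify)
      fix i x j y l z assume "((i, x), (j, y)) \<in> R" "((j, y), (l, z)) \<in> R"
      then obtain k k' where k: "(i, k) \<in> r" "(j, k) \<in> r" "t i k x = t j k y"
        and k': "(j, k') \<in> r" "(l, k') \<in> r" "t j k' y = t l k' z"
        and mem: "x \<in> carrier (fob D i)" "y \<in> carrier (fob D j)" "z \<in> carrier (fob D l)"
        by (auto simp: R_def W_def)
      obtain m where m: "(k, m) \<in> r" "(k', m) \<in> r" using upper_bound2 r_memb k k' by meson
      have "t i m x = t k m (t j k y)" using t_comp[OF k(1) m(1) mem(1)] k(3) by simp
      also have "\<dots> = t k' m (t j k' y)"
        using t_comp[OF k(2) m(1) mem(2)] t_comp[OF k'(1) m(2) mem(2)] by simp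
      also have "\<dots> = t l m z" using t_comp[OF k'(2) m(2) mem(3)] k'(3) by simp
      finally show "((i, x), (l, z)) \<in> R" using RI[of i m l x z] r_trans k k' m mem by blast
    qed
  qed (auto simp: R_def)
  define q where "q a = R `` {a}" for a
  have q_eq: "q a = q b \<longleftrightarrow> (a, b) \<in> R" if "a \<in> W" "b \<in> W" for a b
    unfolding q_def using eq_equiv_class_iff[OF equiv] that by blast
  have q_shift: "q (i, x) = q (k, t i k x)" if "(i, k) \<in> r" "x \<in> carrier (fob D i)" for i k x
  proof -
    have "((i, x), (k, t i k x)) \<in> R"
      by (rule RI[of i k k]) (use that r_refl r_memb t_closed t_id in auto)
    then show ?thesis using q_eq by (simp add: R_def)
  qed
  define ub where "ub i j = (SOME k. (i, k) \<in> r \<and> (j, k) \<in> r)" for i j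
  have ub: "(i, ub i j) \<in> r" "(j, ub i j) \<in> r" if "i \<in> I" "j \<in> I" for i j
    using someI_ex[OF upper_bound2[OF that]] by (auto simp: ub_def)
  define m where "m a b = (let k = ub (fst a) (fst b) in
    (k, t (fst a) k (snd a) \<otimes>\<^bsub>fob D k\<^esub> t (fst b) k (snd b)))" for a b
  have m_closed: "m a b \<in> W" if "a \<in> W" "b \<in> W" for a b
    using that ub[of "fst a" "fst b"] r_memb t_closed comm_groupE(1)[OF grp]
    by (auto simp: W_def m_def Let_def)
  \<comment> \<open>A product can be computed at any stage at which both factors live.\<close>
  have m_at: "q (m (i, x) (j, y)) = q (k, t i k x \<otimes>\<^bsub>fob D k\<^esub> t j k y)"
    if k: "(i, k) \<in> r" "(j, k) \<in> r" and mem: "x \<in> carrier (fob D i)" "y \<in> carrier (fob D j)"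
    for i j k x y
  proof -
    note ij = r_memb(1)[OF k(1)] r_memb(1)[OF k(2)]
    define l where "l = ub i j"
    have l: "(i, l) \<in> r" "(j, l) \<in> r" using ub[OF ij] by (simp_all add: l_def)
    obtain n where n: "(l, n) \<in> r" "(k, n) \<in> r" using upper_bound2 r_memb l k by meson
    have at: "q (p, t i p x \<otimes>\<^bsub>fob D p\<^esub> t j p y) = q (n, t i n x \<otimes>\<^bsub>fob D n\<^esub> t j n y)"
      if p: "(i, p) \<in> r" "(j, p) \<in> r" "(p, n) \<in> r" for p
      using q_shift[OF p(3), of "t i p x \<otimes>\<^bsub>fob D p\<^esub> t j p y"]
        t_hom[OF p(3) t_closed[OF p(1) mem(1)] t_closed[OF p(2) mem(2)]]
        t_comp[OF p(1) p(3) mem(1)] t_comp[OF p(2) p(3) mem(2)]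
        comm_groupE(1)[OF grp[OF r_memb(2)[OF p(1)]] t_closed[OF p(1) mem(1)] t_closed[OF p(2) mem(2)]]
      by simp
    show ?thesis using at[OF l n(1)] at[OF k n(2)] by (simp add: m_def Let_def l_def)
  qed
  have m_same: "q (m (k, x) (k, y)) = q (k, x \<otimes>\<^bsub>fob D k\<^esub> y)"
    if "k \<in> I" "x \<in> carrier (fob D k)" "y \<in> carrier (fob D k)" for k x y
    using m_at[of k k k x y] that r_refl t_id by simp
  have cong: "q (m a b) = q (m a' b')"
    if mem: "a \<in> W" "a' \<in> W" "b \<in> W" "b' \<in> W" and eq: "q a = q a'" "q b = q b'" for a a' b b'
  proof -
    obtain i x i' x' j y j' y' where ab: "a = (i, x)" "a' = (i', x')" "b = (j, y)" "b' = (j', y')"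
      by (metis surj_pair)
    obtain k where k: "(i, k) \<in> r" "(i', k) \<in> r" "t i k x = t i' k x'"
      using eq q_eq mem ab by (auto simp: R_def)
    obtain l where l: "(j, l) \<in> r" "(j', l) \<in> r" "t j l y = t j' l y'"
      using eq q_eq mem ab by (auto simp: R_def)
    obtain n where n: "(k, n) \<in> r" "(l, n) \<in> r" using upper_bound2 r_memb l k by meson
    have mem': "x \<in> carrier (fob D i)" "x' \<in> carrier (fob D i')"
      "y \<in> carrier (fob D j)" "y' \<in> carrier (fob D j')"
      using mem ab by (auto simp: W_def)
    have "t i n x = t i' n x'" using t_comp[OF k(1) n(1)] t_comp[OF k(2) n(1)] k(3) mem' by metis
    moreover have "t j n y = t j' n y'"
      using t_comp[OF l(1) n(2)] t_comp[OF l(2) n(2)] l(3) mem' by metis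
    ultimately show ?thesis
      using m_at[OF r_trans[OF k(1) n(1)] r_trans[OF l(1) n(2)] mem'(1,3)]
        m_at[OF r_trans[OF k(2) n(1)] r_trans[OF l(2) n(2)] mem'(2,4)] ab by simp
  qed
  \<comment> \<open>Hence the group laws need only be checked for three elements of a common stage.\<close>
  have stage: "\<exists>k x y z. k \<in> I \<and> x \<in> carrier (fob D k) \<and> y \<in> carrier (fob D k) \<and>
      z \<in> carrier (fob D k) \<and> q a = q (k, x) \<and> q b = q (k, y) \<and> q c = q (k, z)"
    if mem: "a \<in> W" "b \<in> W" "c \<in> W" for a b c
  proof -
    have "{fst a, fst b, fst c} \<subseteq> I" using mem by (auto simp: W_def)
    from upper_bound[OF this less_finite] obtain k where k: "k \<in> I" "(fst a, k) \<in> r"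
      "(fst b, k) \<in> r" "(fst c, k) \<in> r" by auto
    have "q p = q (k, t (fst p) k (snd p)) \<and> t (fst p) k (snd p) \<in> carrier (fob D k)"
      if "p \<in> W" "(fst p, k) \<in> r" for p
      using q_shift[of "fst p" k "snd p"] t_closed[of "fst p" k "snd p"] that by (auto simp: W_def)
    then show ?thesis using k mem by blast
  qed
  obtain i0 where i0: "i0 \<in> I" using index_nonempty by blast
  have one: "q (k, \<one>\<^bsub>fob D k\<^esub>) = q (i0, \<one>\<^bsub>fob D i0\<^esub>)" if k: "k \<in> I" for k
  proof -
    obtain n where n: "(k, n) \<in> r" "(i0, n) \<in> r" using upper_bound2[OF k i0] by blast
    have "t l n \<one>\<^bsub>fob D l\<^esub> = \<one>\<^bsub>fob D n\<^esub>" if "(l, n) \<in> r" for l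
      using D'(2)[OF that] grp[OF r_memb(1)[OF that]] grp[OF r_memb(2)[OF that]]
      by (simp add: hom_one comm_group.axioms(2))
    then show ?thesis using q_shift[of k n] q_shift[of i0 n] n grp[THEN comm_groupE(2)] r_memb by metis
  qed
  have inW: "(k, x) \<in> W" if "k \<in> I" "x \<in> carrier (fob D k)" for k x using that by (simp add: W_def)
  have "\<exists>G c. G \<in> groups_on (e ` W) \<and> carrier G = c ` W \<and>
    (\<forall>a\<in>W. \<forall>b\<in>W. c (m a b) = c a \<otimes>\<^bsub>G\<^esub> c b \<and> (c a = c b \<longleftrightarrow> q a = q b))"
  proof (rule quotient_group_exists[where e = "(i0, \<one>\<^bsub>fob D i0\<^esub>)", OF e subset_refl])
    show i0W: "(i0, \<one>\<^bsub>fob D i0\<^esub>) \<in> W" using i0 grp comm_groupE(2) inW by blast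
    fix a assume a: "a \<in> W"
    obtain k x where k: "k \<in> I" "x \<in> carrier (fob D k)" "q a = q (k, x)" using stage[OF a a a] by blast
    note g = grp[OF k(1)]
    have "q (m (i0, \<one>\<^bsub>fob D i0\<^esub>) a) = q (m (k, \<one>\<^bsub>fob D k\<^esub>) (k, x))"
      using cong[OF i0W inW a inW] one[OF k(1)] k comm_groupE(2)[OF g] by metis
    also have "\<dots> = q (k, x)"
      using m_same k comm_groupE(2,5)[OF g] by metis
    finally show "q (m (i0, \<one>\<^bsub>fob D i0\<^esub>) a) = q a" using k by simp
    obtain y where y: "y \<in> carrier (fob D k)" "y \<otimes>\<^bsub>fob D k\<^esub> x = \<one>\<^bsub>fob D k\<^esub>"
      using comm_groupE(6)[OF g k(2)] by blast
    have "q (m (k, y) a) = q (m (k, y) (k, x))"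
      using cong[OF inW inW a inW, of k y k y k x] k y by blast
    also have "\<dots> = q (i0, \<one>\<^bsub>fob D i0\<^esub>)" using m_same k y one by simp
    finally show "\<exists>b\<in>W. q (m b a) = q (i0, \<one>\<^bsub>fob D i0\<^esub>)" using inW k y by blast
    fix b assume b: "b \<in> W"
    show "m a b \<in> W" using m_closed a b .
    obtain k x y where k: "k \<in> I" "x \<in> carrier (fob D k)" "y \<in> carrier (fob D k)"
      "q a = q (k, x)" "q b = q (k, y)" using stage[OF a b b] by blast
    have "q (m a b) = q (k, x \<otimes>\<^bsub>fob D k\<^esub> y)"
      using cong[OF a inW b inW] k m_same by metis
    also have "\<dots> = q (k, y \<otimes>\<^bsub>fob D k\<^esub> x)" using comm_groupE(4)[OF grp] k by metis
    also have "\<dots> = q (m b a)" using cong[OF b inW a inW] k m_same by metis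
    finally show "q (m a b) = q (m b a)" .
    fix c assume c: "c \<in> W"
    obtain k x y z where k: "k \<in> I" "x \<in> carrier (fob D k)" "y \<in> carrier (fob D k)"
      "z \<in> carrier (fob D k)" "q a = q (k, x)" "q b = q (k, y)" "q c = q (k, z)"
      using stage[OF a b c] by blast
    note cl = comm_groupE(1)[OF grp[OF k(1)]]
    have prod: "q (m u v) = q (k, x' \<otimes>\<^bsub>fob D k\<^esub> y')" if "u \<in> W" "v \<in> W" "x' \<in> carrier (fob D k)"
      "y' \<in> carrier (fob D k)" "q u = q (k, x')" "q v = q (k, y')" for u v x' y'
      using cong[OF that(1) inW that(2) inW] that k(1) m_same by metis
    have "q (m (m a b) c) = q (k, (x \<otimes>\<^bsub>fob D k\<^esub> y) \<otimes>\<^bsub>fob D k\<^esub> z)"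
      using prod[OF m_closed[OF a b] c cl[OF k(2,3)] k(4) prod[OF a b k(2,3) k(5,6)] k(7)] .
    also have "\<dots> = q (k, x \<otimes>\<^bsub>fob D k\<^esub> (y \<otimes>\<^bsub>fob D k\<^esub> z))"
      using comm_groupE(3)[OF grp] k by metis
    also have "\<dots> = q (m a (m b c))"
      using prod[OF a m_closed[OF b c] k(2) cl[OF k(3,4)] k(5) prod[OF b c k(3,4) k(6,7)]] ..
    finally show "q (m (m a b) c) = q (m a (m b c))" .
  qed (rule cong)
  then obtain L c where Lc: "L \<in> groups_on (e ` W) \<and> carrier L = c ` W \<and>
      (\<forall>a\<in>W. \<forall>b\<in>W. c (m a b) = c a \<otimes>\<^bsub>L\<^esub> c b \<and> (c a = c b \<longleftrightarrow> q a = q b))"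
    by (elim exE)
  then have L: "L \<in> groups_on (e ` W)" "carrier L = c ` W" by simp_all
  have c: "c (m a b) = c a \<otimes>\<^bsub>L\<^esub> c b" "c a = c b \<longleftrightarrow> q a = q b" if "a \<in> W" "b \<in> W" for a b
    using Lc that by simp_all
  let ?\<iota> = "\<lambda>i. \<lambda>x\<in>carrier (fob D i). c (i, x)"
  have "L \<in> Ob (Ab U)" using L small small_mono by (auto simp: groups_on_def)
  moreover have "?\<iota> i \<in> Mor (Ab U) (fob D i) L" if i: "i \<in> I" for i
  proof -
    have "c (i, x \<otimes>\<^bsub>fob D i\<^esub> y) = c (i, x) \<otimes>\<^bsub>L\<^esub> c (i, y)"
      if "x \<in> carrier (fob D i)" "y \<in> carrier (fob D i)" for x y
      using m_same[OF i that] c(1)[OF inW inW, of i x i y] c(2)[OF m_closed[OF inW inW] inW]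
        comm_groupE(1)[OF grp[OF i] that] i that by metis
    then show ?thesis using inW i L(2) comm_groupE(1)[OF grp[OF i]] by (auto simp: hom_def)
  qed
  moreover have "elementwise_colimit (carrier L) ?\<iota>"
  proof (rule elementwise_colimitI, goal_cases)
    case (1 i x) then show ?case using inW L(2) by simp
  next
    case (2 i j x)
    then have "(i, x) \<in> W" "(j, t i j x) \<in> W" using inW t_closed r_memb by auto
    then have "c (j, t i j x) = c (i, x)" using c(2) q_shift[OF 2] by simp
    then show ?case using 2 t_closed by simp
  next
    case (3 l) then show ?case using L(2) by (auto simp: W_def)
  next
    case (4 i x y)
    then have "((i, x), (i, y)) \<in> R" using c(2) q_eq inW by simp
    then show ?case by (auto simp: R_def)
  qed
  ultimately show ?thesis unfolding t_def by (intro exI[of _ L] exI[of _ ?\<iota>]) blast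
qed

lemma (in small_universe) has_directed_colimits_Ab:
  assumes \<mu>: "regular_cardinal \<mu>"
  shows "has_directed_colimits U \<mu> (Ab U)"
  unfolding has_directed_colimits_def
proof (intro allI impI)
  fix I r D assume dir: "directed_poset U \<mu> I r" and D: "is_functor (poset_cat I r) (Ab U) D"
  then show "\<exists>L \<iota>. is_colimit (poset_cat I r) (Ab U) D L \<iota>"
    using elementwise_colimit_exists[OF \<mu> dir D] Ab_colimit_elementwise[OF \<mu> dir D] by blast
qed

text \<open>
  Conversely every directed colimit has the elementwise description, since it is isomorphic to
  the one constructed from the elements.
\<close>

lemma (in small_universe) elementwise_Ab_colimit:
  assumes \<mu>: "regular_cardinal \<mu>" and dir: "directed_poset U \<mu> I r"
    and D: "is_functor (poset_cat I r) (Ab U) D"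
    and colim: "is_colimit (poset_cat I r) (Ab U) D L \<iota>"
  shows "directed_system.elementwise_colimit I r (\<lambda>i. carrier (fob D i)) (\<lambda>i j. fmor D i j ())
      (carrier L) \<iota>"
proof -
  interpret directed_system \<mu> I r "\<lambda>i. carrier (fob D i)" "\<lambda>i j. fmor D i j ()"
    by (rule directed_system_Ab) fact+
  obtain M \<kappa> where M: "M \<in> Ob (Ab U)" "\<And>i. i \<in> I \<Longrightarrow> \<kappa> i \<in> Mor (Ab U) (fob D i) M"
    and E: "elementwise_colimit (carrier M) \<kappa>"
    using elementwise_colimit_exists[OF \<mu> dir D] by blast
  note E' = elementwise_colimitD[OF E]
  have colim': "is_colimit (poset_cat I r) (Ab U) D M \<kappa>"
    by (rule Ab_colimit_elementwise[OF \<mu> dir D M E])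
  have L: "is_cocone (poset_cat I r) (Ab U) D L \<iota>" and M': "is_cocone (poset_cat I r) (Ab U) D M \<kappa>"
    using colim colim' by (auto simp: is_colimit_def)
  then have L': "comm_group L" "\<And>i. i \<in> I \<Longrightarrow> \<iota> i \<in> Mor (Ab U) (fob D i) L"
    "\<And>i j. (i, j) \<in> r \<Longrightarrow> compose (carrier (fob D i)) (\<iota> j) (fmor D i j ()) = \<iota> i"
    by (auto simp: cocone_poset_iff[OF r_closed])
  obtain h where h: "h \<in> Mor (Ab U) L M"
    "\<And>i. i \<in> I \<Longrightarrow> compose (carrier (fob D i)) h (\<iota> i) = \<kappa> i"
    using ex1_implies_ex[OF colimit_factor[OF colim M']] by auto
  obtain g where g: "g \<in> Mor (Ab U) M L"
    "\<And>i. i \<in> I \<Longrightarrow> compose (carrier (fob D i)) g (\<kappa> i) = \<iota> i"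
    using ex1_implies_ex[OF colimit_factor[OF colim' L]] by auto
  have h': "h (\<iota> i x) = \<kappa> i x" and g': "g (\<kappa> i x) = \<iota> i x" and \<iota>: "\<iota> i x \<in> carrier L"
    if "i \<in> I" "x \<in> carrier (fob D i)" for i x
    using h(2) g(2) that L'(2) by (metis compose_eq, metis compose_eq, auto simp: hom_def Pi_def)
  have gh: "g (h l) = l" if l: "l \<in> carrier L" for l
  proof -
    have LOb: "L \<in> Ob (Ab U)" using L by (simp add: is_cocone_def)
    have "\<exists>!k. k \<in> Mor (Ab U) L L \<and>
        (\<forall>i\<in>Ob (poset_cat I r). Cmp (Ab U) (fob D i) L L k (\<iota> i) = \<iota> i)"
      by (rule colimit_factor[OF colim L])
    moreover have "Cmp (Ab U) L M L g h \<in> Mor (Ab U) L L"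
      using category_cmp[OF category_Ab LOb M(1) LOb h(1) g(1)] .
    moreover have "Cmp (Ab U) (fob D i) L L (Cmp (Ab U) L M L g h) (\<iota> i) = \<iota> i" if "i \<in> I" for i
      by (simp, rule extensionalityI[of _ "carrier (fob D i)"])
        (use that L'(2)[OF that] h' g' \<iota> in \<open>auto simp: compose_eq\<close>)
    moreover have "Idn (Ab U) L \<in> Mor (Ab U) L L" using category_idn[OF category_Ab LOb] .
    moreover have "Cmp (Ab U) (fob D i) L L (Idn (Ab U) L) (\<iota> i) = \<iota> i" if "i \<in> I" for i
      by (simp, rule extensionalityI[of _ "carrier (fob D i)"])
        (use that L'(2)[OF that] \<iota> in \<open>auto simp: compose_eq\<close>)
    ultimately have "Cmp (Ab U) L M L g h = Idn (Ab U) L" by (metis poset_cat_simps(1))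
    then have "compose (carrier L) g h l = l" using l by simp
    then show ?thesis using l by (simp add: compose_eq)
  qed
  show ?thesis
  proof (rule elementwise_colimitI, goal_cases)
    case (1 i x) then show ?case by (rule \<iota>)
  next
    case (2 i j x) then show ?case using L'(3) by (metis compose_eq)
  next
    case (3 l)
    then have "h l \<in> carrier M" using h(1) by (auto simp: hom_def Pi_def)
    then obtain i x where "i \<in> I" "x \<in> carrier (fob D i)" "\<kappa> i x = h l" using E'(3) by blast
    then show ?case using g' gh[OF 3] by metis
  next
    case (4 i x y) then show ?case using h' E'(4) by metis
  qed
qed

section \<open>Groups generated by partial multiplication tables\<close>

definition partial_hom :: "('x, 'y) monoid_scheme \<Rightarrow> 'x set \<Rightarrow> ('h, 'z) monoid_scheme \<Rightarrow> ('x \<Rightarrow> 'h) \<Rightarrow> bool" where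
  "partial_hom G X H f \<longleftrightarrow> (\<forall>x\<in>X. f x \<in> carrier H) \<and>
     (\<forall>x\<in>X. \<forall>y\<in>X. x \<otimes>\<^bsub>G\<^esub> y \<in> X \<longrightarrow> f (x \<otimes>\<^bsub>G\<^esub> y) = f x \<otimes>\<^bsub>H\<^esub> f y)"

lemma partial_hom_subset: "partial_hom G Y H f \<Longrightarrow> X \<subseteq> Y \<Longrightarrow> partial_hom G X H f"
  unfolding partial_hom_def by blast

text \<open>
  \<open>D\<close> is the abelian group with generators \<open>X\<close> and the relations \<open>x \<cdot> y = z\<close> that hold in \<open>G\<close>
  between elements of \<open>X\<close>, described by its universal property.
\<close>

definition table_group :: "'u monoid \<Rightarrow> 'u set \<Rightarrow> 'u monoid \<Rightarrow> ('u \<Rightarrow> 'u) \<Rightarrow> bool" where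
  "table_group G X D e \<longleftrightarrow> comm_group D \<and> partial_hom G X D e \<and> carrier D = generate D (e ` X) \<and>
     (\<forall>(H :: 'u monoid) f. comm_group H \<longrightarrow> partial_hom G X H f \<longrightarrow>
        (\<exists>h\<in>hom D H. \<forall>x\<in>X. h (e x) = f x))"

lemma hom_eq_on_generate:
  assumes "group D" "group H" "h \<in> hom D H" "h' \<in> hom D H" "S \<subseteq> carrier D"
    and eq: "\<And>x. x \<in> S \<Longrightarrow> h x = h' x" and x: "x \<in> generate D S"
  shows "h x = h' x"
  using x
proof (induction rule: generate.induct)
  case one
  then show ?case using assms by (simp add: hom_one)
next
  case (incl y)
  then show ?case by (rule eq)
next
  case (inv y)
  interpret h: group_hom D H h using assms by (simp add: group_hom_def group_hom_axioms_def)
  interpret h': group_hom D H h' using assms by (simp add: group_hom_def group_hom_axioms_def)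
  show ?case using inv assms(5) eq[OF inv] by (simp add: subset_iff)
next
  case (eng y z)
  then have "y \<in> carrier D" "z \<in> carrier D"
    using group.generate_in_carrier[OF assms(1,5)] by auto
  then show ?case using eng assms(3,4) by (auto simp: hom_def)
qed

lemma table_group_hom_eq:
  assumes D: "table_group G X D e" and H: "H \<in> Ob (Ab U)"
    and "h \<in> Mor (Ab U) D H" "h' \<in> Mor (Ab U) D H" "\<And>x. x \<in> X \<Longrightarrow> h (e x) = h' (e x)"
  shows "h = h'"
proof (rule Ab_mor_eqI[OF assms(3,4)])
  fix d assume d: "d \<in> carrier D"
  have gen: "comm_group D" "e ` X \<subseteq> carrier D" "d \<in> generate D (e ` X)"
    using D d by (auto simp: table_group_def partial_hom_def)
  show "h d = h' d"
    by (rule hom_eq_on_generate[OF _ _ _ _ gen(2) _ gen(3)])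
      (use assms gen(1) in \<open>auto simp: comm_group.axioms(2)\<close>)
qed

lemma table_group_extend:
  assumes D: "table_group G X D e" and H: "H \<in> Ob (Ab U)" and f: "partial_hom G X H f"
  shows "\<exists>h\<in>Mor (Ab U) D H. \<forall>x\<in>X. h (e x) = f x"
proof -
  obtain h where h: "h \<in> hom D H" "\<forall>x\<in>X. h (e x) = f x"
    using D H f unfolding table_group_def Ab_simps by blast
  moreover have "e x \<in> carrier D" if "x \<in> X" for x
    using D that unfolding table_group_def partial_hom_def by blast
  moreover have "restrict h (carrier D) \<in> Mor (Ab U) D H"
  proof -
    have "comm_group D" using D by (simp add: table_group_def)
    then show ?thesis using h(1) by (auto simp: hom_def comm_groupE(1))
  qed
  ultimately show ?thesis by (intro bexI[of _ "restrict h (carrier D)"]) auto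
qed

text \<open>
  A letter \<open>(True, x)\<close> stands for the generator \<open>x\<close>, and \<open>(False, x)\<close> for its inverse.
\<close>

primrec word_value :: "('h, 'z) monoid_scheme \<Rightarrow> ('x \<Rightarrow> 'h) \<Rightarrow> (bool \<times> 'x) list \<Rightarrow> 'h" where
  "word_value H f [] = \<one>\<^bsub>H\<^esub>"
| "word_value H f (p # w) =
     (if fst p then f (snd p) else inv\<^bsub>H\<^esub> f (snd p)) \<otimes>\<^bsub>H\<^esub> word_value H f w"

context comm_group
begin

lemma word_value_closed:
  "f \<in> X \<rightarrow> carrier G \<Longrightarrow> w \<in> lists (UNIV \<times> X) \<Longrightarrow> word_value G f w \<in> carrier G"
  by (induction w) (auto simp: Pi_def)

lemma word_value_append:
  "f \<in> X \<rightarrow> carrier G \<Longrightarrow> v \<in> lists (UNIV \<times> X) \<Longrightarrow> w \<in> lists (UNIV \<times> X) \<Longrightarrow>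
   word_value G f (v @ w) = word_value G f v \<otimes> word_value G f w"
proof (induction v)
  case (Cons p v)
  then have "f (snd p) \<in> carrier G" "word_value G f v \<in> carrier G" "word_value G f w \<in> carrier G"
    using word_value_closed by (auto simp: Pi_def)
  then show ?case using Cons by (auto simp: m_assoc)
qed (simp add: word_value_closed)

lemma word_value_negate:
  "f \<in> X \<rightarrow> carrier G \<Longrightarrow> w \<in> lists (UNIV \<times> X) \<Longrightarrow>
   word_value G f (map (apfst Not) w) = inv (word_value G f w)"
proof (induction w)
  case (Cons p w)
  then have "f (snd p) \<in> carrier G" "word_value G f w \<in> carrier G"
    using word_value_closed by (auto simp: Pi_def)
  then show ?case using Cons by (cases p) (auto simp: inv_mult)
qed simp

end

text \<open>
  The group is realised by words in the generators and their inverses, two words being equal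
  if they take the same value under every partial homomorphism on \<open>X\<close>.  This makes every
  partial homomorphism extend without an analysis of the relations.
\<close>

lemma table_group_exists:
  fixes G :: "'u monoid" and j :: "(bool \<times> 'u) list \<Rightarrow> 'u"
  assumes j: "inj_on j (lists (UNIV \<times> X))" "j ` lists (UNIV \<times> X) \<subseteq> K"
  shows "\<exists>D\<in>groups_on K. \<exists>e. table_group G X D e"
proof -
  let ?W = "lists (UNIV \<times> X) :: (bool \<times> 'u) list set"
  define ok where "ok p \<longleftrightarrow> comm_group (fst p) \<and> partial_hom G X (fst p) (snd p)"
    for p :: "'u monoid \<times> ('u \<Rightarrow> 'u)"
  define q where "q w = (\<lambda>p. if ok p then word_value (fst p) (snd p) w else undefined)" for w
  have q_eq: "q v = q w \<longleftrightarrow> (\<forall>(H :: 'u monoid) f. comm_group H \<longrightarrow> partial_hom G X H f \<longrightarrow>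
      word_value H f v = word_value H f w)" for v w
    by (auto simp: q_def fun_eq_iff ok_def)
  have fX: "f \<in> X \<rightarrow> carrier H" if "partial_hom G X H f" for H :: "'u monoid" and f
    using that by (auto simp: partial_hom_def)
  note closed = comm_group.word_value_closed[OF _ fX]
    and append = comm_group.word_value_append[OF _ fX]
  have "\<exists>D c. D \<in> groups_on K \<and> carrier D = c ` ?W \<and>
      (\<forall>a\<in>?W. \<forall>b\<in>?W. c (a @ b) = c a \<otimes>\<^bsub>D\<^esub> c b \<and> (c a = c b \<longleftrightarrow> q a = q b))"
  proof (rule quotient_group_exists[where e = "[]", OF j])
    fix a assume a: "a \<in> ?W"
    have "q (map (apfst Not) a @ a) = q []"
      unfolding q_eq
    proof (intro allI impI)
      fix H :: "'u monoid" and f assume H: "comm_group H" and f: "partial_hom G X H f"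
      interpret comm_group H by fact
      have "map (apfst Not) a \<in> ?W" using a by (auto simp: in_lists_conv_set)
      then show "word_value H f (map (apfst Not) a @ a) = word_value H f []"
        using append[OF H f _ a] word_value_negate[OF fX[OF f] a] closed[OF H f a] by simp
    qed
    moreover have "map (apfst Not) a \<in> ?W" using a by (auto simp: in_lists_conv_set)
    ultimately show "\<exists>b\<in>?W. q (b @ a) = q []" by blast
    fix b assume b: "b \<in> ?W"
    show "a @ b \<in> ?W" using a b by simp
    show "q (a @ b) = q (b @ a)"
      unfolding q_eq
    proof (intro allI impI)
      fix H :: "'u monoid" and f assume H: "comm_group H" and f: "partial_hom G X H f"
      show "word_value H f (a @ b) = word_value H f (b @ a)"
        using append[OF H f] a b closed[OF H f] comm_groupE(4)[OF H] by metis
    qed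
  next
    fix a a' b b' assume mem: "a \<in> ?W" "a' \<in> ?W" "b \<in> ?W" "b' \<in> ?W" and eq: "q a = q a'" "q b = q b'"
    show "q (a @ b) = q (a' @ b')"
      unfolding q_eq
    proof (intro allI impI)
      fix H :: "'u monoid" and f assume H: "comm_group H" and f: "partial_hom G X H f"
      show "word_value H f (a @ b) = word_value H f (a' @ b')"
        using append[OF H f mem(1,3)] append[OF H f mem(2,4)] eq H f unfolding q_eq by simp
    qed
  qed simp_all
  then obtain D c where Dc: "D \<in> groups_on K \<and> carrier D = c ` ?W \<and>
      (\<forall>a\<in>?W. \<forall>b\<in>?W. c (a @ b) = c a \<otimes>\<^bsub>D\<^esub> c b \<and> (c a = c b \<longleftrightarrow> q a = q b))"
    by (elim exE)
  then have D: "D \<in> groups_on K" "carrier D = c ` ?W" by simp_all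
  have c: "c (a @ b) = c a \<otimes>\<^bsub>D\<^esub> c b" "c a = c b \<longleftrightarrow> q a = q b" if "a \<in> ?W" "b \<in> ?W" for a b
    using Dc that by simp_all
  have cgD: "comm_group D" using D(1) by (simp add: groups_on_def)
  interpret D: comm_group D by (rule cgD)
  define e where "e x = c [(True, x)]" for x
  have part: "partial_hom G X D e"
    unfolding partial_hom_def
  proof (intro conjI ballI impI)
    fix x assume x: "x \<in> X"
    then show "e x \<in> carrier D" by (auto simp: e_def D(2))
    fix y assume y: "y \<in> X" and xy: "x \<otimes>\<^bsub>G\<^esub> y \<in> X"
    have "q [(True, x \<otimes>\<^bsub>G\<^esub> y)] = q ([(True, x)] @ [(True, y)])"
      unfolding q_eq
    proof (intro allI impI)
      fix H :: "'u monoid" and f assume H: "comm_group H" and f: "partial_hom G X H f"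
      interpret comm_group H by fact
      show "word_value H f [(True, x \<otimes>\<^bsub>G\<^esub> y)] = word_value H f ([(True, x)] @ [(True, y)])"
        using f x y xy by (simp add: partial_hom_def)
    qed
    then show "e (x \<otimes>\<^bsub>G\<^esub> y) = e x \<otimes>\<^bsub>D\<^esub> e y"
      using c(1)[of "[(True, x)]" "[(True, y)]"]
        c(2)[of "[(True, x \<otimes>\<^bsub>G\<^esub> y)]" "[(True, x)] @ [(True, y)]"] x y xy
      by (simp add: e_def)
  qed
  have eX: "e ` X \<subseteq> carrier D" using part by (auto simp: partial_hom_def)
  have c_nil: "c [] = \<one>\<^bsub>D\<^esub>"
  proof -
    have "c [] \<otimes>\<^bsub>D\<^esub> c [] = c []" using c(1)[of "[]" "[]"] by simp
    moreover have "c [] \<in> carrier D" by (auto simp: D(2))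
    ultimately show ?thesis using D.l_cancel_one' by metis
  qed
  have letter: "c [(b, x)] \<in> generate D (e ` X)" if x: "x \<in> X" for b x
  proof (cases b)
    case True
    then show ?thesis using x by (auto simp: e_def intro: generate.incl)
  next
    case False
    have "q ([(False, x)] @ [(True, x)]) = q []"
      unfolding q_eq
    proof (intro allI impI)
      fix H :: "'u monoid" and f assume H: "comm_group H" and f: "partial_hom G X H f"
      interpret comm_group H by fact
      show "word_value H f ([(False, x)] @ [(True, x)]) = word_value H f []"
        using f x by (simp add: partial_hom_def)
    qed
    then have "c [(False, x)] \<otimes>\<^bsub>D\<^esub> e x = \<one>\<^bsub>D\<^esub>"
      using c(1)[of "[(False, x)]" "[(True, x)]"] c(2)[of "[(False, x)] @ [(True, x)]" "[]"] x c_nil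
      by (simp add: e_def)
    then have "c [(False, x)] = inv\<^bsub>D\<^esub> e x"
      using x eX by (intro D.inv_equality[symmetric]) (auto simp: D(2))
    then show ?thesis using False x by (auto intro: generate.inv)
  qed
  have "c w \<in> generate D (e ` X)" if "w \<in> ?W" for w
    using that
  proof (induction w)
    case Nil
    then show ?case using c_nil by (simp add: generate.one)
  next
    case (Cons p w)
    then have "c ([p] @ w) = c [p] \<otimes>\<^bsub>D\<^esub> c w" by (intro c(1)) auto
    then show ?case using Cons letter[of "snd p" "fst p"] by (auto intro: generate.eng)
  qed
  then have "carrier D \<subseteq> generate D (e ` X)" unfolding D(2) by (rule image_subsetI)
  then have gen: "carrier D = generate D (e ` X)"
    using D.generate_incl[OF eX] by (rule subset_antisym)
  have "\<exists>h\<in>hom D H. \<forall>x\<in>X. h (e x) = f x"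
    if H: "comm_group H" and f: "partial_hom G X H f" for H :: "'u monoid" and f
  proof -
    interpret H: comm_group H by fact
    define h where "h d = word_value H f (inv_into ?W c d)" for d
    have h: "h (c w) = word_value H f w" if w: "w \<in> ?W" for w
    proof -
      have "inv_into ?W c (c w) \<in> ?W" by (rule inv_into_into[OF imageI[OF w]])
      moreover have "c (inv_into ?W c (c w)) = c w" by (rule f_inv_into_f[OF imageI[OF w]])
      ultimately have "q (inv_into ?W c (c w)) = q w" using c(2)[OF _ w] by blast
      then show ?thesis using H f unfolding q_eq h_def by blast
    qed
    have "h \<in> hom D H"
    proof (rule homI)
      fix d assume "d \<in> carrier D"
      then obtain v where v: "v \<in> ?W" "d = c v" using D(2) by blast
      then show "h d \<in> carrier H" using h closed[OF H f] by simp
      fix d' assume "d' \<in> carrier D"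
      then obtain w where w: "w \<in> ?W" "d' = c w" using D(2) by blast
      have "d \<otimes>\<^bsub>D\<^esub> d' = c (v @ w)" using c(1) v w by simp
      then show "h (d \<otimes>\<^bsub>D\<^esub> d') = h d \<otimes>\<^bsub>H\<^esub> h d'"
        using h[of "v @ w"] h[OF v(1)] h[OF w(1)] append[OF H f v(1) w(1)] v w by simp
    qed
    moreover have "h (e x) = f x" if "x \<in> X" for x
      using h[of "[(True, x)]"] that f by (simp add: e_def partial_hom_def)
    ultimately show ?thesis by blast
  qed
  then show ?thesis using D(1) cgD part gen unfolding table_group_def by blast
qed

text \<open>
  A homomorphism out of the group is given by fewer than \<open>\<mu>\<close> elements subject to fewer than
  \<open>\<mu>\<close> equations, all of which can be met at one stage of a \<open>\<mu>\<close>-directed colimit.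
\<close>

lemma (in small_universe) table_group_presented:
  assumes \<mu>: "regular_cardinal \<mu>" and X: "|X| <o \<mu>" and D: "table_group G X D e"
    and small: "small U (carrier D)"
  shows "presented U \<mu> (Ab U) D"
proof (rule presentedI[OF \<mu> category_Ab locally_small_Ab])
  have cg: "comm_group D" and part: "partial_hom G X D e" using D by (auto simp: table_group_def)
  then show DOb: "D \<in> Ob (Ab U)" using small by simp
  have e: "e x \<in> carrier D" if "x \<in> X" for x using part that by (simp add: partial_hom_def)
  fix I r Dg L \<iota>
  assume dir: "directed_poset U \<mu> I r" and Dg: "is_functor (poset_cat I r) (Ab U) Dg"
    and L: "is_colimit (poset_cat I r) (Ab U) Dg L \<iota>"
  define t where "t i j = fmor Dg i j ()" for i j
  interpret directed_system \<mu> I r "\<lambda>i. carrier (fob Dg i)" t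
    unfolding t_def by (rule directed_system_Ab) fact+
  have E: "elementwise_colimit (carrier L) \<iota>"
    unfolding t_def by (rule elementwise_Ab_colimit[OF \<mu> dir Dg L])
  note Dg' = poset_functorD[OF Dg partial_order, folded t_def]
  have L': "L \<in> Ob (Ab U)" "\<And>i. i \<in> I \<Longrightarrow> \<iota> i \<in> Mor (Ab U) (fob Dg i) L"
    using L by (auto simp: is_colimit_def cocone_poset_iff[OF r_closed] simp del: Ab_simps)
  have mult: "x \<otimes>\<^bsub>fob Dg i\<^esub> y \<in> carrier (fob Dg i)"
    "\<iota> i (x \<otimes>\<^bsub>fob Dg i\<^esub> y) = \<iota> i x \<otimes>\<^bsub>L\<^esub> \<iota> i y"
    if "i \<in> I" "x \<in> carrier (fob Dg i)" "y \<in> carrier (fob Dg i)" for i x y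
    using Dg'(1)[of i] L'(2)[of i] that by (auto simp: comm_groupE(1) hom_mult[of _ "fob Dg i" L])
  show "factors_essentially_uniquely (Ab U) I r Dg L \<iota> D"
    unfolding factors_essentially_uniquely_def
  proof (intro conjI ballI impI)
    fix f assume f: "f \<in> Mor (Ab U) D L"
    have fe: "f (e x) \<in> carrier L" if "x \<in> X" for x using f e[OF that] by (auto simp: hom_def Pi_def)
    obtain i y where i: "i \<in> I" and y: "\<forall>x\<in>X. y x \<in> carrier (fob Dg i) \<and> \<iota> i (y x) = f (e x)"
      using elementwise_lift[OF E X, of "\<lambda>x. f (e x)"] fe by blast
    let ?P = "{p \<in> X \<times> X. fst p \<otimes>\<^bsub>G\<^esub> snd p \<in> X}"
    have "|?P| <o \<mu>" by (rule less_mono[OF _ less_Times[OF X X]]) auto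
    then have "\<exists>j. (i, j) \<in> r \<and> (\<forall>p\<in>?P. t i j (y (fst p \<otimes>\<^bsub>G\<^esub> snd p)) =
        t i j (y (fst p) \<otimes>\<^bsub>fob Dg i\<^esub> y (snd p)))"
    proof (rule elementwise_equalize[OF E _ i])
      fix p assume p: "p \<in> ?P"
      have "\<iota> i (y (fst p \<otimes>\<^bsub>G\<^esub> snd p)) = f (e (fst p) \<otimes>\<^bsub>D\<^esub> e (snd p))"
        using y p part by (auto simp: partial_hom_def)
      also have "\<dots> = f (e (fst p)) \<otimes>\<^bsub>L\<^esub> f (e (snd p))"
        using f p e by (auto simp: hom_mult[of _ D L])
      also have "\<dots> = \<iota> i (y (fst p) \<otimes>\<^bsub>fob Dg i\<^esub> y (snd p))" using mult(2)[OF i] y p by auto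
      finally show "y (fst p \<otimes>\<^bsub>G\<^esub> snd p) \<in> carrier (fob Dg i) \<and>
          y (fst p) \<otimes>\<^bsub>fob Dg i\<^esub> y (snd p) \<in> carrier (fob Dg i) \<and>
          \<iota> i (y (fst p \<otimes>\<^bsub>G\<^esub> snd p)) = \<iota> i (y (fst p) \<otimes>\<^bsub>fob Dg i\<^esub> y (snd p))"
        using y p mult(1)[OF i] by auto
    qed
    then obtain j where j: "(i, j) \<in> r" and eq: "\<forall>p\<in>?P. t i j (y (fst p \<otimes>\<^bsub>G\<^esub> snd p)) =
        t i j (y (fst p) \<otimes>\<^bsub>fob Dg i\<^esub> y (snd p))" by blast
    have jI: "j \<in> I" using j r_memb by blast
    have "partial_hom G X (fob Dg j) (\<lambda>x. t i j (y x))"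
      unfolding partial_hom_def
    proof (intro conjI ballI impI)
      fix x assume x: "x \<in> X"
      then show "t i j (y x) \<in> carrier (fob Dg j)" using t_closed[OF j] y by blast
      fix x' assume x': "x' \<in> X" "x \<otimes>\<^bsub>G\<^esub> x' \<in> X"
      then have "t i j (y (x \<otimes>\<^bsub>G\<^esub> x')) = t i j (y x \<otimes>\<^bsub>fob Dg i\<^esub> y x')"
        using x bspec[OF eq, of "(x, x')"] by simp
      then show "t i j (y (x \<otimes>\<^bsub>G\<^esub> x')) = t i j (y x) \<otimes>\<^bsub>fob Dg j\<^esub> t i j (y x')"
        using Dg'(2)[OF j] y x x' by (simp add: hom_mult[of _ "fob Dg i" "fob Dg j"])
    qed
    then obtain h where h: "h \<in> Mor (Ab U) D (fob Dg j)" "\<forall>x\<in>X. h (e x) = t i j (y x)"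
      using table_group_extend[OF D Dg'(1)[OF jI]] by blast
    have "Cmp (Ab U) D (fob Dg j) L (\<iota> j) h = f"
    proof (rule table_group_hom_eq[OF D L'(1) _ f])
      show "Cmp (Ab U) D (fob Dg j) L (\<iota> j) h \<in> Mor (Ab U) D L"
        by (rule category_cmp[OF category_Ab DOb Dg'(1)[OF jI] L'(1) h(1) L'(2)[OF jI]])
      fix x assume x: "x \<in> X"
      then show "Cmp (Ab U) D (fob Dg j) L (\<iota> j) h (e x) = f (e x)"
        using h(2) e y elementwise_colimitD(2)[OF E j] by (simp add: compose_eq)
    qed
    then show "\<exists>i\<in>I. \<exists>g\<in>Mor (Ab U) D (fob Dg i). Cmp (Ab U) D (fob Dg i) L (\<iota> i) g = f"
      using jI h(1) by blast
  next
    fix i g g' assume i: "i \<in> I" and g: "g \<in> Mor (Ab U) D (fob Dg i)" "g' \<in> Mor (Ab U) D (fob Dg i)"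
      and eq: "Cmp (Ab U) D (fob Dg i) L (\<iota> i) g = Cmp (Ab U) D (fob Dg i) L (\<iota> i) g'"
    have "\<exists>j. (i, j) \<in> r \<and> (\<forall>x\<in>X. t i j (g (e x)) = t i j (g' (e x)))"
    proof (rule elementwise_equalize[OF E X i])
      fix x assume "x \<in> X"
      then have ex: "e x \<in> carrier D" by (rule e)
      have "\<iota> i (g (e x)) = \<iota> i (g' (e x))" using eq ex by (simp, metis compose_eq)
      then show "g (e x) \<in> carrier (fob Dg i) \<and> g' (e x) \<in> carrier (fob Dg i) \<and>
          \<iota> i (g (e x)) = \<iota> i (g' (e x))"
        using g ex by (auto simp: hom_def Pi_def)
    qed
    then obtain j where j: "(i, j) \<in> r" "\<forall>x\<in>X. t i j (g (e x)) = t i j (g' (e x))" by blast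
    have jI: "j \<in> I" using j r_memb by blast
    have "Cmp (Ab U) D (fob Dg i) (fob Dg j) (t i j) g = Cmp (Ab U) D (fob Dg i) (fob Dg j) (t i j) g'"
    proof (rule table_group_hom_eq[OF D Dg'(1)[OF jI]])
      show "Cmp (Ab U) D (fob Dg i) (fob Dg j) (t i j) g \<in> Mor (Ab U) D (fob Dg j)"
        "Cmp (Ab U) D (fob Dg i) (fob Dg j) (t i j) g' \<in> Mor (Ab U) D (fob Dg j)"
        using category_cmp[OF category_Ab DOb Dg'(1)[OF i] Dg'(1)[OF jI] _ Dg'(2)[OF j(1)]] g by blast+
      fix x assume "x \<in> X"
      then show "Cmp (Ab U) D (fob Dg i) (fob Dg j) (t i j) g (e x) =
          Cmp (Ab U) D (fob Dg i) (fob Dg j) (t i j) g' (e x)"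
        using j(2) e by (simp add: compose_eq)
    qed
    then show "\<exists>j. (i, j) \<in> r \<and> Cmp (Ab U) D (fob Dg i) (fob Dg j) (fmor Dg i j ()) g =
        Cmp (Ab U) D (fob Dg i) (fob Dg j) (fmor Dg i j ()) g'"
      using j(1) unfolding t_def by blast
  qed
qed

section \<open>Accessibility of the category of abelian groups\<close>

text \<open>
  \<open>G\<close> is the directed colimit of the groups generated by the multiplication tables of its
  subsets \<open>X\<close> with fewer than \<open>\<mu>\<close> elements.  The maps to \<open>G\<close> are jointly injective because
  each element \<open>d\<close> over \<open>X\<close> becomes the generator named by its image in \<open>G\<close> after enlarging
  \<open>X\<close> by finitely many inverses and partial products.
\<close>

lemma (in small_universe) colimit_of_table_groups:
  fixes G :: "'u monoid"
  assumes \<mu>: "regular_cardinal \<mu>" and G: "G \<in> Ob (Ab U)" and K: "small U K"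
    and tables: "\<And>X. X \<subseteq> carrier G \<Longrightarrow> |X| <o \<mu> \<Longrightarrow> \<exists>D\<in>groups_on K. \<exists>e. table_group G X D e"
  shows "\<exists>I r Dg \<iota>. directed_poset U \<mu> I r \<and> is_functor (poset_cat I r) (Ab U) Dg \<and>
    (\<forall>i\<in>I. fob Dg i \<in> groups_on K \<and> presented U \<mu> (Ab U) (fob Dg i)) \<and>
    is_colimit (poset_cat I r) (Ab U) Dg G \<iota>"
proof -
  interpret \<mu>: regular_cardinal \<mu> by fact
  have cgG: "comm_group G" using G by simp
  interpret G: comm_group G by (rule cgG)
  define XX where "XX = {X. X \<subseteq> carrier G \<and> |X| <o \<mu>}"
  have "\<forall>X\<in>XX. \<exists>De. fst De \<in> groups_on K \<and> table_group G X (fst De) (snd De)"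
  proof
    fix X assume "X \<in> XX"
    then obtain D e where "D \<in> groups_on K" "table_group G X D e"
      using tables[of X] unfolding XX_def by blast
    then show "\<exists>De. fst De \<in> groups_on K \<and> table_group G X (fst De) (snd De)"
      by (intro exI[of _ "(D, e)"]) simp
  qed
  then obtain De where De: "\<forall>X\<in>XX. fst (De X) \<in> groups_on K \<and> table_group G X (fst (De X)) (snd (De X))"
    by (rule bchoice[THEN exE])
  define D where "D X = fst (De X)" for X
  define e where "e X = snd (De X)" for X
  have DK: "D X \<in> groups_on K" and tg: "table_group G X (D X) (e X)" if "X \<in> XX" for X
    using De that by (auto simp: D_def e_def)
  have cgD: "comm_group (D X)" and part: "partial_hom G X (D X) (e X)"
    and gen: "carrier (D X) = generate (D X) (e X ` X)" if "X \<in> XX" for X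
    using tg[OF that] by (auto simp: table_group_def)
  have eD: "e X x \<in> carrier (D X)" if "X \<in> XX" "x \<in> X" for X x
    using part[OF that(1)] that(2) by (simp add: partial_hom_def)
  have e_mult: "e X (x \<otimes>\<^bsub>G\<^esub> y) = e X x \<otimes>\<^bsub>D X\<^esub> e X y"
    if "X \<in> XX" "x \<in> X" "y \<in> X" "x \<otimes>\<^bsub>G\<^esub> y \<in> X" for X x y
    using part[OF that(1)] that(2-) unfolding partial_hom_def by blast
  have smallD: "small U (carrier (D X))" if "X \<in> XX" for X
    using DK[OF that] K small_mono by (auto simp: groups_on_def)
  have DOb: "D X \<in> Ob (Ab U)" if "X \<in> XX" for X using cgD smallD that by simp
  have Un: "X \<union> Y \<in> XX" if "X \<in> XX" "Y \<in> XX" for X Y using that \<mu>.less_Un by (auto simp: XX_def)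
  have fin: "X \<in> XX" if "finite X" "X \<subseteq> carrier G" for X using that \<mu>.less_finite by (auto simp: XX_def)
  have XG: "X \<subseteq> carrier G" if "X \<in> XX" for X using that by (simp add: XX_def)
  define T where "T X Y = (SOME h. h \<in> Mor (Ab U) (D X) (D Y) \<and> (\<forall>x\<in>X. h (e X x) = e Y x))" for X Y
  have T: "T X Y \<in> Mor (Ab U) (D X) (D Y) \<and> (\<forall>x\<in>X. T X Y (e X x) = e Y x)"
    if XY: "X \<in> XX" "Y \<in> XX" "X \<subseteq> Y" for X Y
  proof -
    have "\<exists>h\<in>Mor (Ab U) (D X) (D Y). \<forall>x\<in>X. h (e X x) = e Y x"
      by (rule table_group_extend[OF tg[OF XY(1)] DOb[OF XY(2)] partial_hom_subset[OF part[OF XY(2)] XY(3)]])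
    then have "\<exists>h. h \<in> Mor (Ab U) (D X) (D Y) \<and> (\<forall>x\<in>X. h (e X x) = e Y x)" by blast
    then show ?thesis unfolding T_def by (rule someI_ex)
  qed
  note TM = conjunct1[OF T] and Te = bspec[OF conjunct2[OF T]]
  define \<epsilon> where "\<epsilon> X = (SOME h. h \<in> Mor (Ab U) (D X) G \<and> (\<forall>x\<in>X. h (e X x) = x))" for X
  have \<epsilon>: "\<epsilon> X \<in> Mor (Ab U) (D X) G \<and> (\<forall>x\<in>X. \<epsilon> X (e X x) = x)" if X: "X \<in> XX" for X
  proof -
    have "partial_hom G X G (\<lambda>x. x)" using XG[OF X] by (auto simp: partial_hom_def)
    then have "\<exists>h\<in>Mor (Ab U) (D X) G. \<forall>x\<in>X. h (e X x) = x"
      by (rule table_group_extend[OF tg[OF X] G])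
    then have "\<exists>h. h \<in> Mor (Ab U) (D X) G \<and> (\<forall>x\<in>X. h (e X x) = x)" by blast
    then show ?thesis unfolding \<epsilon>_def by (rule someI_ex)
  qed
  note \<epsilon>M = conjunct1[OF \<epsilon>] and \<epsilon>e = bspec[OF conjunct2[OF \<epsilon>]]
  have T_id: "T X X = Idn (Ab U) (D X)" if X: "X \<in> XX" for X
    by (rule table_group_hom_eq[OF tg[OF X] DOb[OF X] TM[OF X X subset_refl]
          category_idn[OF category_Ab DOb[OF X]]])
      (simp add: Te X eD)
  have T_comp: "Cmp (Ab U) (D X) (D Y) (D Z) (T Y Z) (T X Y) = T X Z"
    if XYZ: "X \<in> XX" "Y \<in> XX" "Z \<in> XX" "X \<subseteq> Y" "Y \<subseteq> Z" for X Y Z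
  proof -
    have XZ: "X \<subseteq> Z" using XYZ by blast
    show ?thesis
    proof (rule table_group_hom_eq[OF tg[OF XYZ(1)] DOb[OF XYZ(3)] _ TM[OF XYZ(1,3) XZ]])
      show "Cmp (Ab U) (D X) (D Y) (D Z) (T Y Z) (T X Y) \<in> Mor (Ab U) (D X) (D Z)"
        by (rule category_cmp[OF category_Ab DOb[OF XYZ(1)] DOb[OF XYZ(2)] DOb[OF XYZ(3)]
              TM[OF XYZ(1,2,4)] TM[OF XYZ(2,3,5)]])
      fix x assume x: "x \<in> X"
      then have "x \<in> Y" using XYZ by blast
      then show "Cmp (Ab U) (D X) (D Y) (D Z) (T Y Z) (T X Y) (e X x) = T X Z (e X x)"
        using x XYZ XZ eD by (simp add: compose_eq Te)
    qed
  qed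
  have \<epsilon>_comp: "Cmp (Ab U) (D X) (D Y) G (\<epsilon> Y) (T X Y) = \<epsilon> X"
    if XY: "X \<in> XX" "Y \<in> XX" "X \<subseteq> Y" for X Y
  proof (rule table_group_hom_eq[OF tg[OF XY(1)] G _ \<epsilon>M[OF XY(1)]])
    show "Cmp (Ab U) (D X) (D Y) G (\<epsilon> Y) (T X Y) \<in> Mor (Ab U) (D X) G"
      by (rule category_cmp[OF category_Ab DOb[OF XY(1)] DOb[OF XY(2)] G TM[OF XY] \<epsilon>M[OF XY(2)]])
    fix x assume x: "x \<in> X"
    then have "x \<in> Y" using XY by blast
    then show "Cmp (Ab U) (D X) (D Y) G (\<epsilon> Y) (T X Y) (e X x) = \<epsilon> X (e X x)"
      using x XY eD by (simp add: compose_eq Te \<epsilon>e)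
  qed
  have e_one: "e Y \<one>\<^bsub>G\<^esub> = \<one>\<^bsub>D Y\<^esub>" if Y: "Y \<in> XX" "\<one>\<^bsub>G\<^esub> \<in> Y" for Y
  proof -
    interpret DY: comm_group "D Y" by (rule cgD[OF Y(1)])
    have "e Y (\<one>\<^bsub>G\<^esub> \<otimes>\<^bsub>G\<^esub> \<one>\<^bsub>G\<^esub>) = e Y \<one>\<^bsub>G\<^esub> \<otimes>\<^bsub>D Y\<^esub> e Y \<one>\<^bsub>G\<^esub>"
      by (rule e_mult[OF Y(1)]) (simp_all add: Y(2))
    then show ?thesis using eD[OF Y] DY.l_cancel_one' by (metis G.l_one G.one_closed)
  qed
  \<comment> \<open>Over \<open>Y\<close>, the element \<open>d\<close> has become a generator, hence is determined by its image in \<open>G\<close>.\<close>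
  define settled where "settled X d Y \<longleftrightarrow> Y \<in> XX \<and> X \<subseteq> Y \<and> \<epsilon> X d \<in> Y \<and> T X Y d = e Y (\<epsilon> X d)" for X d Y
  have settled_mono: "settled X d Z" if X: "X \<in> XX" "d \<in> carrier (D X)" and Y: "settled X d Y"
    and Z: "Z \<in> XX" "Y \<subseteq> Z" for X d Y Z
  proof -
    note Y' = Y[unfolded settled_def]
    have XY: "Y \<in> XX" "X \<subseteq> Y" using Y' by auto
    have "T X Z d = T Y Z (T X Y d)"
      using T_comp[OF X(1) XY(1) Z(1) XY(2) Z(2)] X(2) by (simp, metis compose_eq)
    also have "\<dots> = e Z (\<epsilon> X d)" using Y' Te[OF XY(1) Z] by simp
    finally show ?thesis using Y' Z unfolding settled_def by blast
  qed
  have settles: "\<exists>Y. settled X d Y" if X: "X \<in> XX" and d: "d \<in> carrier (D X)" for X d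
  proof -
    interpret DX: comm_group "D X" by (rule cgD[OF X])
    have hT: "group_hom (D X) (D Y) (T X Y)" if "Y \<in> XX" "X \<subseteq> Y" for Y
      using TM[OF X that] cgD[OF X] cgD[OF that(1)]
      by (simp add: group_hom_def group_hom_axioms_def comm_group.axioms(2))
    have h\<epsilon>: "group_hom (D X) G (\<epsilon> X)"
      using \<epsilon>M[OF X] cgD[OF X] cgG by (simp add: group_hom_def group_hom_axioms_def comm_group.axioms(2))
    have eXD: "e X ` X \<subseteq> carrier (D X)" using eD[OF X] by blast
    have "d \<in> generate (D X) (e X ` X)" using d gen[OF X] by simp
    then show ?thesis
    proof (induction rule: generate.induct)
      case one
      have Y: "insert \<one>\<^bsub>G\<^esub> X \<in> XX" "X \<subseteq> insert \<one>\<^bsub>G\<^esub> X" using Un[OF fin[of "{\<one>\<^bsub>G\<^esub>}"] X] by auto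
      have "settled X \<one>\<^bsub>D X\<^esub> (insert \<one>\<^bsub>G\<^esub> X)"
        using Y group_hom.hom_one[OF hT[OF Y]] group_hom.hom_one[OF h\<epsilon>] e_one[OF Y(1)]
        unfolding settled_def by simp
      then show ?case by blast
    next
      case (incl h)
      then obtain x where "x \<in> X" "h = e X x" by blast
      then have "settled X h X" using X Te[OF X X subset_refl] \<epsilon>e[OF X] by (simp add: settled_def)
      then show ?case by blast
    next
      case (inv h)
      then obtain x where x: "x \<in> X" "h = e X x" by blast
      define Y where "Y = {\<one>\<^bsub>G\<^esub>, inv\<^bsub>G\<^esub> x} \<union> X"
      have xG: "x \<in> carrier G" using x XG[OF X] by blast
      have Y: "Y \<in> XX" "X \<subseteq> Y" using Un[OF fin[of "{\<one>\<^bsub>G\<^esub>, inv\<^bsub>G\<^esub> x}"] X] xG by (auto simp: Y_def)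
      have mem: "\<one>\<^bsub>G\<^esub> \<in> Y" "inv\<^bsub>G\<^esub> x \<in> Y" "x \<in> Y" using x by (auto simp: Y_def)
      interpret DY: comm_group "D Y" by (rule cgD[OF Y(1)])
      have hD: "h \<in> carrier (D X)" using x eD[OF X] by simp
      have "e Y (inv\<^bsub>G\<^esub> x) \<otimes>\<^bsub>D Y\<^esub> e Y x = e Y (inv\<^bsub>G\<^esub> x \<otimes>\<^bsub>G\<^esub> x)"
        by (rule e_mult[OF Y(1), symmetric]) (use mem xG in simp_all)
      then have "e Y (inv\<^bsub>G\<^esub> x) \<otimes>\<^bsub>D Y\<^esub> e Y x = \<one>\<^bsub>D Y\<^esub>" using xG e_one[OF Y(1) mem(1)] by simp
      then have "e Y (inv\<^bsub>G\<^esub> x) = inv\<^bsub>D Y\<^esub> e Y x"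
        using DY.inv_equality eD[OF Y(1)] mem by metis
      moreover have "T X Y (inv\<^bsub>D X\<^esub> h) = inv\<^bsub>D Y\<^esub> e Y x"
        using group_hom.hom_inv[OF hT[OF Y] hD] Te[OF X Y x(1)] x(2) by simp
      moreover have "\<epsilon> X (inv\<^bsub>D X\<^esub> h) = inv\<^bsub>G\<^esub> x"
        using group_hom.hom_inv[OF h\<epsilon> hD] \<epsilon>e[OF X x(1)] x(2) by simp
      ultimately have "settled X (inv\<^bsub>D X\<^esub> h) Y" using Y mem by (simp add: settled_def)
      then show ?case by blast
    next
      case (eng h k)
      then obtain Y1 Y2 where Y1: "settled X h Y1" and Y2: "settled X k Y2" by blast
      have hk: "h \<in> carrier (D X)" "k \<in> carrier (D X)" using eng gen[OF X] by auto
      have \<epsilon>G: "\<epsilon> X h \<in> carrier G" "\<epsilon> X k \<in> carrier G" using group_hom.hom_closed[OF h\<epsilon>] hk by auto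
      define Z where "Z = {\<epsilon> X h \<otimes>\<^bsub>G\<^esub> \<epsilon> X k} \<union> (Y1 \<union> Y2)"
      have Z: "Z \<in> XX" unfolding Z_def
        by (rule Un[OF fin Un]) (use Y1 Y2 \<epsilon>G in \<open>auto simp: settled_def\<close>)
      have s: "settled X h Z" "settled X k Z"
        using settled_mono[OF X hk(1) Y1 Z] settled_mono[OF X hk(2) Y2 Z] by (auto simp: Z_def)
      then have XZ: "X \<subseteq> Z" by (simp add: settled_def)
      have mem: "\<epsilon> X h \<otimes>\<^bsub>G\<^esub> \<epsilon> X k \<in> Z" by (simp add: Z_def)
      have "e Z (\<epsilon> X h \<otimes>\<^bsub>G\<^esub> \<epsilon> X k) = e Z (\<epsilon> X h) \<otimes>\<^bsub>D Z\<^esub> e Z (\<epsilon> X k)"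
        by (rule e_mult[OF Z]) (use mem s in \<open>auto simp: settled_def\<close>)
      then have "settled X (h \<otimes>\<^bsub>D X\<^esub> k) Z"
        using group_hom.hom_mult[OF hT[OF Z XZ] hk] group_hom.hom_mult[OF h\<epsilon> hk] s mem
        by (simp add: settled_def)
      then show ?case by blast
    qed
  qed
  \<comment> \<open>Diagrams are indexed by subsets of the universe, so the subsets \<open>X\<close> are coded by elements.\<close>
  have "small U XX"
    by (rule small_mono[OF small_Pow[of "carrier G"]]) (use G in \<open>auto simp: XX_def\<close>)
  then obtain j :: "'u set \<Rightarrow> 'u" where j: "inj_on j XX" using small_embeds by blast
  define I where "I = j ` XX"
  define \<phi> where "\<phi> = inv_into XX j"
  have \<phi>: "\<phi> i \<in> XX" "j (\<phi> i) = i" if "i \<in> I" for i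
    using that by (auto simp: \<phi>_def I_def inv_into_into f_inv_into_f)
  have \<phi>j: "j X \<in> I \<and> \<phi> (j X) = X" if "X \<in> XX" for X using that j by (simp add: \<phi>_def I_def)
  define r where "r = {(a, b). a \<in> I \<and> b \<in> I \<and> \<phi> a \<subseteq> \<phi> b}"
  have dir: "directed_poset U \<mu> I r"
    unfolding directed_poset_def
  proof (intro conjI allI impI)
    show "small U I" unfolding I_def by (rule small_image) fact
    show "partial_order_on I r"
      unfolding partial_order_on_def preorder_on_def
      by (auto simp: r_def refl_on_def intro!: transI antisymI) (metis \<phi>(2) subset_antisym)
    fix A assume A: "A \<subseteq> I" "|A| <o \<mu>"
    have \<phi>A: "\<phi> a \<subseteq> carrier G" "|\<phi> a| <o \<mu>" if "a \<in> A" for a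
      using \<phi>(1)[of a] A(1) that by (auto simp: XX_def)
    have "(\<Union>a\<in>A. \<phi> a) \<in> XX"
      unfolding XX_def by (intro CollectI conjI UN_least \<mu>.less_UNION A(2) \<phi>A)
    then show "\<exists>b\<in>I. \<forall>a\<in>A. (a, b) \<in> r"
      using \<phi>j[of "\<Union>a\<in>A. \<phi> a"] A(1)
      by (intro bexI[of _ "j (\<Union>a\<in>A. \<phi> a)"]) (auto simp: r_def)
  qed
  define Dg where "Dg = \<lparr>fob = (\<lambda>i. D (\<phi> i)), fmor = (\<lambda>a b (u :: unit). T (\<phi> a) (\<phi> b))\<rparr>"
  have Dg: "is_functor (poset_cat I r) (Ab U) Dg"
    unfolding is_functor_def
  proof (intro conjI ballI)
    fix a assume "a \<in> Ob (poset_cat I r)"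
    then have a: "a \<in> I" by simp
    show "fob Dg a \<in> Ob (Ab U)" using DOb[OF \<phi>(1)[OF a]] by (simp add: Dg_def)
    show "fmor Dg a a (Idn (poset_cat I r) a) = Idn (Ab U) (fob Dg a)"
      using T_id[OF \<phi>(1)[OF a]] by (simp add: Dg_def)
    fix b and u :: unit assume b: "b \<in> Ob (poset_cat I r)" and u: "u \<in> Mor (poset_cat I r) a b"
    then show "fmor Dg a b u \<in> Mor (Ab U) (fob Dg a) (fob Dg b)"
      using TM[OF \<phi>(1) \<phi>(1), of a b] by (simp add: Dg_def r_def)
    fix c and v :: unit assume c: "c \<in> Ob (poset_cat I r)" and v: "v \<in> Mor (poset_cat I r) b c"
    show "fmor Dg a c (Cmp (poset_cat I r) a b c v u) =
        Cmp (Ab U) (fob Dg a) (fob Dg b) (fob Dg c) (fmor Dg b c v) (fmor Dg a b u)"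
      using T_comp[OF \<phi>(1) \<phi>(1) \<phi>(1), of a b c] a u v by (simp add: Dg_def r_def)
  qed
  interpret directed_system \<mu> I r "\<lambda>i. carrier (fob Dg i)" "\<lambda>i j. fmor Dg i j ()"
    by (rule directed_system_Ab[OF \<mu> dir Dg])
  have "is_colimit (poset_cat I r) (Ab U) Dg G (\<lambda>i. \<epsilon> (\<phi> i))"
  proof (rule Ab_colimit_elementwise[OF \<mu> dir Dg G])
    show \<epsilon>\<phi>: "\<epsilon> (\<phi> i) \<in> Mor (Ab U) (fob Dg i) G" if "i \<in> I" for i
      using \<epsilon>M[OF \<phi>(1)[OF that]] by (simp add: Dg_def)
    show "elementwise_colimit (carrier G) (\<lambda>i. \<epsilon> (\<phi> i))"
    proof (rule elementwise_colimitI, goal_cases)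
      case (1 i d)
      then show ?case using \<epsilon>\<phi>[of i] by (auto simp: hom_def Pi_def)
    next
      case (2 a b d)
      then have "\<phi> a \<in> XX" "\<phi> b \<in> XX" "\<phi> a \<subseteq> \<phi> b" using \<phi>(1) by (auto simp: r_def)
      from \<epsilon>_comp[OF this] show ?case using 2(2) by (simp add: Dg_def, metis compose_eq)
    next
      case (3 g)
      then have X: "{g} \<in> XX" using fin by simp
      have "\<epsilon> {g} (e {g} g) = g" using \<epsilon>e[OF X] by simp
      moreover have "e {g} g \<in> carrier (fob Dg (j {g}))"
        using \<phi>j[OF X] eD[OF X, of g] by (simp add: Dg_def)
      moreover have "j {g} \<in> I" "\<phi> (j {g}) = {g}" using \<phi>j[OF X] by simp_all
      ultimately show ?case by metis
    next
      case (4 i d d')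
      have X: "\<phi> i \<in> XX" using \<phi>(1) 4 by simp
      have d: "d \<in> carrier (D (\<phi> i))" "d' \<in> carrier (D (\<phi> i))" using 4 by (simp_all add: Dg_def)
      obtain Y Y' where Y: "settled (\<phi> i) d Y" "settled (\<phi> i) d' Y'" using settles X d by blast
      have Z: "Y \<union> Y' \<in> XX" using Y by (intro Un) (auto simp: settled_def)
      have s: "settled (\<phi> i) d (Y \<union> Y')" "settled (\<phi> i) d' (Y \<union> Y')"
        using settled_mono[OF X d(1) Y(1) Z] settled_mono[OF X d(2) Y(2) Z] by auto
      then have "T (\<phi> i) (Y \<union> Y') d = T (\<phi> i) (Y \<union> Y') d'" and "\<phi> i \<subseteq> Y \<union> Y'"
        using 4(4) by (auto simp: settled_def)
      then show ?case
        using \<phi>j[OF Z] 4(1) by (intro exI[of _ "j (Y \<union> Y')"]) (simp add: Dg_def r_def)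
    qed
  qed
  moreover have "fob Dg i \<in> groups_on K \<and> presented U \<mu> (Ab U) (fob Dg i)" if "i \<in> I" for i
    using \<phi>(1)[OF that] DK tg smallD table_group_presented[OF \<mu>, of "\<phi> i" G "D (\<phi> i)" "e (\<phi> i)"]
    by (auto simp: Dg_def XX_def)
  ultimately show ?thesis using dir Dg by blast
qed

text \<open>
  All the groups generated by tables with fewer than \<open>\<mu>\<close> elements can be carried by one small set
  \<open>K\<close>, so the presented groups carried by \<open>K\<close> are a small set of generators.
\<close>

lemma (in small_universe) accessible_Ab:
  fixes \<mu> :: "'l rel"
  assumes \<mu>: "regular_cardinal \<mu>" and less: "\<mu> <o |UNIV :: 'u set|"
  shows "accessible_category U \<mu> (Ab U)"
proof -
  interpret \<mu>: regular_cardinal \<mu> by fact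
  \<comment> \<open>One small set that can carry the words over any set of fewer than \<open>\<mu>\<close> generators.\<close>
  let ?W = "lists (UNIV \<times> Field \<mu>) :: (bool \<times> 'l) list set"
  have "small U (Field \<mu>)"
    unfolding small_def by (rule ordIso_ordLess_trans[OF card_of_Field_ordIso[OF \<mu>.card_order] less])
  then have small_W: "small U ?W" by (intro small_lists small_Sigma) (auto intro: small_finite)
  then obtain g :: "(bool \<times> 'l) list \<Rightarrow> 'u" where g: "inj_on g ?W" using small_embeds by blast
  define K where "K = g ` ?W"
  have K: "small U K" unfolding K_def by (rule small_image) fact
  have tables: "\<exists>D\<in>groups_on K. \<exists>e. table_group G X D e" if X: "|X| <o \<mu>"
    for G :: "'u monoid" and X
  proof -
    have "|X| \<le>o |Field \<mu>|"
      using ordLess_imp_ordLeq[OF X] card_of_Field_ordIso[OF \<mu>.card_order]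
      by (rule ordLeq_ordIso_trans[OF _ ordIso_symmetric])
    then obtain f where f: "inj_on f X" "f ` X \<subseteq> Field \<mu>" using card_of_ordLeq by metis
    let ?m = "map (map_prod (id :: bool \<Rightarrow> bool) f)"
    have "inj_on (map_prod id f) (UNIV \<times> X :: (bool \<times> 'u) set)"
      using f(1) by (auto simp: inj_on_def)
    then have inj: "inj_on ?m (lists (UNIV \<times> X))" by (rule inj_on_map_lists)
    have im: "?m ` lists (UNIV \<times> X) \<subseteq> ?W"
      unfolding lists_image[symmetric] by (rule lists_mono) (use f(2) in auto)
    show ?thesis
    proof (rule table_group_exists)
      show "inj_on (g \<circ> ?m) (lists (UNIV \<times> X))"
        by (rule comp_inj_on[OF inj inj_on_subset[OF g im]])
      show "(g \<circ> ?m) ` lists (UNIV \<times> X) \<subseteq> K" using im by (auto simp: K_def)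
    qed
  qed
  let ?S = "{D \<in> groups_on K. presented U \<mu> (Ab U) D}"
  have "small U ?S" by (rule small_mono[OF small_groups_on[OF K]]) auto
  moreover have "\<exists>I r D \<iota>. directed_poset U \<mu> I r \<and> is_functor (poset_cat I r) (Ab U) D \<and>
      (\<forall>i\<in>I. fob D i \<in> ?S) \<and> is_colimit (poset_cat I r) (Ab U) D G \<iota>"
    if "G \<in> Ob (Ab U)" for G
    using colimit_of_table_groups[OF \<mu> that K tables] by simp
  ultimately show ?thesis
    unfolding accessible_category_def
    using category_Ab locally_small_Ab has_directed_colimits_Ab[OF \<mu>]
    by (intro conjI exI[of _ ?S] ballI) auto
qed

section \<open>Products of abelian groups in terms of elements\<close>

text \<open>
  An infinite cyclic group, obtained from a one-element table \<open>{a}\<close> without relations: the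
  product \<open>a \<cdot> a\<close> is declared to lie outside the table.
\<close>

lemma (in small_universe) free_group_on_one_generator:
  "\<exists>Z\<in>Ob (Ab U). \<exists>z\<in>carrier Z. \<forall>H\<in>Ob (Ab U). \<forall>x\<in>carrier H.
     \<exists>!h. h \<in> Mor (Ab U) Z H \<and> h z = x"
proof -
  obtain a b :: 'u where ab: "a \<noteq> b" using two_elements by blast
  define T :: "'u monoid" where "T = \<lparr>carrier = UNIV, mult = (\<lambda>_ _. b), one = b\<rparr>"
  let ?W = "lists (UNIV \<times> {a}) :: (bool \<times> 'u) list set"
  have small: "small U ?W" by (intro small_lists small_finite) simp
  then obtain j :: "(bool \<times> 'u) list \<Rightarrow> 'u" where "inj_on j ?W" using small_embeds by blast
  from table_group_exists[OF this subset_refl] obtain Z e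
    where Z: "Z \<in> groups_on (j ` ?W)" and tg: "table_group T {a} Z e" by blast
  have ZOb: "Z \<in> Ob (Ab U)"
    using Z small_image[OF small] small_mono by (auto simp: groups_on_def)
  have ea: "e a \<in> carrier Z" using tg unfolding table_group_def partial_hom_def by blast
  have "\<exists>!h. h \<in> Mor (Ab U) Z H \<and> h (e a) = x" if H: "H \<in> Ob (Ab U)" and x: "x \<in> carrier H" for H x
  proof -
    have "partial_hom T {a} H (\<lambda>_. x)" using x ab by (simp add: partial_hom_def T_def)
    then obtain h where h: "h \<in> Mor (Ab U) Z H" "h (e a) = x"
      using table_group_extend[OF tg H] by blast
    show ?thesis
    proof (rule ex1I[of _ h])
      fix g assume "g \<in> Mor (Ab U) Z H \<and> g (e a) = x"
      then show "g = h" using table_group_hom_eq[OF tg H _ h(1)] h(2) by simp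
    qed (use h in blast)
  qed
  then show ?thesis using ZOb ea by blast
qed

text \<open>
  An element of a group is the same as a homomorphism from an infinite cyclic group to it.
\<close>

lemma (in small_universe) elementwise_Ab_product:
  assumes P: "is_product (Ab U) I X P \<pi>" and x: "\<And>i. i \<in> I \<Longrightarrow> x i \<in> carrier (X i)"
  shows "\<exists>!p. p \<in> carrier P \<and> (\<forall>i\<in>I. \<pi> i p = x i)"
proof -
  obtain Z z where Z: "Z \<in> Ob (Ab U)" "z \<in> carrier Z"
    and free: "\<And>H y. H \<in> Ob (Ab U) \<Longrightarrow> y \<in> carrier H \<Longrightarrow> \<exists>!h. h \<in> Mor (Ab U) Z H \<and> h z = y"
    using free_group_on_one_generator by blast
  have POb: "P \<in> Ob (Ab U)" and X: "\<And>i. i \<in> I \<Longrightarrow> X i \<in> Ob (Ab U)"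
    and \<pi>: "\<And>i. i \<in> I \<Longrightarrow> \<pi> i \<in> Mor (Ab U) P (X i)"
    using P unfolding is_product_def by blast+
  have "\<forall>i\<in>I. \<exists>f. f \<in> Mor (Ab U) Z (X i) \<and> f z = x i" using free X x by blast
  then obtain f where f: "\<forall>i\<in>I. f i \<in> Mor (Ab U) Z (X i) \<and> f i z = x i"
    by (rule bchoice[THEN exE])
  have univ: "\<exists>!h. h \<in> Mor (Ab U) Z P \<and> (\<forall>i\<in>I. Cmp (Ab U) Z P (X i) (\<pi> i) h = f i)"
    using P Z(1) f unfolding is_product_def by blast
  then obtain h where h: "h \<in> Mor (Ab U) Z P" "\<And>i. i \<in> I \<Longrightarrow> Cmp (Ab U) Z P (X i) (\<pi> i) h = f i"
    by blast
  show ?thesis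
  proof (rule ex1I[of _ "h z"], intro conjI ballI)
    show "h z \<in> carrier P" using h(1) Z(2) by (auto simp: hom_def Pi_def)
    fix i assume i: "i \<in> I"
    show "\<pi> i (h z) = x i" using fun_cong[OF h(2)[OF i], of z] f i Z(2) by (simp add: compose_eq)
  next
    fix p assume p: "p \<in> carrier P \<and> (\<forall>i\<in>I. \<pi> i p = x i)"
    then obtain g where g: "g \<in> Mor (Ab U) Z P" "g z = p" using free[OF POb] by blast
    have "Cmp (Ab U) Z P (X i) (\<pi> i) g = f i" if i: "i \<in> I" for i
    proof -
      have "Cmp (Ab U) Z P (X i) (\<pi> i) g \<in> Mor (Ab U) Z (X i)"
        by (rule category_cmp[OF category_Ab Z(1) POb X[OF i] g(1) \<pi>[OF i]])
      moreover have "Cmp (Ab U) Z P (X i) (\<pi> i) g z = x i"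
        using p g(2) i Z(2) by (simp add: compose_eq)
      ultimately show ?thesis using free[OF X[OF i] x[OF i]] f i by blast
    qed
    then have "g = h" using univ g(1) h by blast
    then show "p = h z" using g(2) by simp
  qed
qed

lemma Ab_product_elementwise:
  assumes P: "P \<in> Ob (Ab U)" and X: "\<And>i. i \<in> I \<Longrightarrow> X i \<in> Ob (Ab U)"
    and \<pi>: "\<And>i. i \<in> I \<Longrightarrow> \<pi> i \<in> Mor (Ab U) P (X i)"
    and ex: "\<And>x. (\<And>i. i \<in> I \<Longrightarrow> x i \<in> carrier (X i)) \<Longrightarrow> \<exists>p\<in>carrier P. \<forall>i\<in>I. \<pi> i p = x i"
    and un: "\<And>p p'. p \<in> carrier P \<Longrightarrow> p' \<in> carrier P \<Longrightarrow> (\<And>i. i \<in> I \<Longrightarrow> \<pi> i p = \<pi> i p') \<Longrightarrow> p = p'"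
  shows "is_product (Ab U) I X P \<pi>"
  unfolding is_product_def
proof (intro conjI ballI allI impI)
  fix T f assume T: "T \<in> Ob (Ab U)" and f: "\<forall>i\<in>I. f i \<in> Mor (Ab U) T (X i)"
  have "\<forall>t\<in>carrier T. \<exists>p. p \<in> carrier P \<and> (\<forall>i\<in>I. \<pi> i p = f i t)"
  proof
    fix t assume "t \<in> carrier T"
    then have "\<exists>p\<in>carrier P. \<forall>i\<in>I. \<pi> i p = f i t" using f by (intro ex) (auto simp: hom_def Pi_def)
    then show "\<exists>p. p \<in> carrier P \<and> (\<forall>i\<in>I. \<pi> i p = f i t)" by blast
  qed
  then obtain h where h: "\<forall>t\<in>carrier T. h t \<in> carrier P \<and> (\<forall>i\<in>I. \<pi> i (h t) = f i t)"
    by (rule bchoice[THEN exE])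
  have mult: "h (t \<otimes>\<^bsub>T\<^esub> t') = h t \<otimes>\<^bsub>P\<^esub> h t'" if t: "t \<in> carrier T" "t' \<in> carrier T" for t t'
  proof (rule un)
    have tt: "t \<otimes>\<^bsub>T\<^esub> t' \<in> carrier T" using T t by (simp add: comm_groupE(1))
    then show "h (t \<otimes>\<^bsub>T\<^esub> t') \<in> carrier P" using h by blast
    show "h t \<otimes>\<^bsub>P\<^esub> h t' \<in> carrier P" using P h t by (simp add: comm_groupE(1))
    fix i assume i: "i \<in> I"
    have "\<pi> i (h t \<otimes>\<^bsub>P\<^esub> h t') = f i t \<otimes>\<^bsub>X i\<^esub> f i t'"
      using \<pi>[OF i] h t i by (simp add: hom_mult[of _ P "X i"])
    then show "\<pi> i (h (t \<otimes>\<^bsub>T\<^esub> t')) = \<pi> i (h t \<otimes>\<^bsub>P\<^esub> h t')"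
      using bspec[OF h tt] bspec[OF f i] t i by (simp add: hom_mult[of _ T "X i"])
  qed
  show "\<exists>!h. h \<in> Mor (Ab U) T P \<and> (\<forall>i\<in>I. Cmp (Ab U) T P (X i) (\<pi> i) h = f i)"
  proof (rule ex1I[of _ "restrict h (carrier T)"], intro conjI ballI)
    show "restrict h (carrier T) \<in> Mor (Ab U) T P"
      using h mult T by (auto simp: hom_def comm_groupE(1))
    fix i assume i: "i \<in> I"
    show "Cmp (Ab U) T P (X i) (\<pi> i) (restrict h (carrier T)) = f i"
      by (simp, rule extensionalityI[of _ "carrier T"]) (use f h i in \<open>auto simp: compose_eq\<close>)
  next
    fix g assume g: "g \<in> Mor (Ab U) T P \<and> (\<forall>i\<in>I. Cmp (Ab U) T P (X i) (\<pi> i) g = f i)"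
    show "g = restrict h (carrier T)"
    proof (rule extensionalityI[of _ "carrier T"])
      fix t assume t: "t \<in> carrier T"
      have "g t = h t"
      proof (rule un)
        show "g t \<in> carrier P" using g t by (auto simp: hom_def Pi_def)
        show "h t \<in> carrier P" using h t by blast
        fix i assume i: "i \<in> I"
        have "compose (carrier T) (\<pi> i) g = f i" using g i by simp
        then show "\<pi> i (g t) = \<pi> i (h t)" using h i t by (metis compose_eq)
      qed
      then show "g t = restrict h (carrier T) t" using t by simp
    qed (use g in auto)
  qed
qed (use P X \<pi> in blast)+

section \<open>Additive categories and functors that preserve products\<close>

lemma preadditive_category: "is_preadditive C \<Longrightarrow> is_category C"
  by (simp add: is_preadditive_def)

lemma preadditive_group: "is_preadditive C \<Longrightarrow> X \<in> Ob C \<Longrightarrow> Y \<in> Ob C \<Longrightarrow> comm_group (hom_group C X Y)"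
  by (simp add: is_preadditive_def)

lemma preadditive_add:
  assumes "is_preadditive C" "X \<in> Ob C" "Y \<in> Ob C"
  shows "Zer C X Y \<in> Mor C X Y"
    and "f \<in> Mor C X Y \<Longrightarrow> g \<in> Mor C X Y \<Longrightarrow> Add C X Y f g \<in> Mor C X Y"
    and "f \<in> Mor C X Y \<Longrightarrow> Add C X Y f (Zer C X Y) = f"
    and "f \<in> Mor C X Y \<Longrightarrow> Add C X Y (Zer C X Y) f = f"
proof -
  interpret comm_group "hom_group C X Y" by (rule preadditive_group[OF assms])
  show "Zer C X Y \<in> Mor C X Y" using one_closed by (simp add: hom_group_def)
  show "Add C X Y f g \<in> Mor C X Y" if "f \<in> Mor C X Y" "g \<in> Mor C X Y"
    using m_closed[of f g] that by (simp add: hom_group_def)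
  show "Add C X Y f (Zer C X Y) = f" "Add C X Y (Zer C X Y) f = f" if "f \<in> Mor C X Y"
    using r_one[of f] l_one[of f] that by (simp_all add: hom_group_def)
qed

lemma preadditive_distrib_right:
  "is_preadditive C \<Longrightarrow> X \<in> Ob C \<Longrightarrow> Y \<in> Ob C \<Longrightarrow> Z \<in> Ob C \<Longrightarrow>
   f \<in> Mor C X Y \<Longrightarrow> g \<in> Mor C Y Z \<Longrightarrow> g' \<in> Mor C Y Z \<Longrightarrow>
   Cmp C X Y Z (Add C Y Z g g') f = Add C X Z (Cmp C X Y Z g f) (Cmp C X Y Z g' f)"
  unfolding is_preadditive_def by blast

lemma preadditive_distrib_left:
  "is_preadditive C \<Longrightarrow> X \<in> Ob C \<Longrightarrow> Y \<in> Ob C \<Longrightarrow> Z \<in> Ob C \<Longrightarrow>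
   f \<in> Mor C X Y \<Longrightarrow> f' \<in> Mor C X Y \<Longrightarrow> g \<in> Mor C Y Z \<Longrightarrow>
   Cmp C X Y Z g (Add C X Y f f') = Add C X Z (Cmp C X Y Z g f) (Cmp C X Y Z g f')"
  unfolding is_preadditive_def by blast

lemma preadditive_zero_cmp:
  assumes C: "is_preadditive C" and X: "X \<in> Ob C" and Y: "Y \<in> Ob C" and Z: "Z \<in> Ob C"
  shows "g \<in> Mor C Y Z \<Longrightarrow> Cmp C X Y Z g (Zer C X Y) = Zer C X Z"
    and "f \<in> Mor C X Y \<Longrightarrow> Cmp C X Y Z (Zer C Y Z) f = Zer C X Z"
proof -
  note cat = preadditive_category[OF C]
  interpret XZ: comm_group "hom_group C X Z" by (rule preadditive_group[OF C X Z])
  have idem: "h = Zer C X Z" if "h \<in> Mor C X Z" "Add C X Z h h = h" for h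
    using XZ.l_cancel_one'[of h h] that by (simp add: hom_group_def)
  show "Cmp C X Y Z g (Zer C X Y) = Zer C X Z" if g: "g \<in> Mor C Y Z"
  proof (rule idem)
    show "Cmp C X Y Z g (Zer C X Y) \<in> Mor C X Z"
      by (rule category_cmp[OF cat X Y Z preadditive_add(1)[OF C X Y] g])
    show "Add C X Z (Cmp C X Y Z g (Zer C X Y)) (Cmp C X Y Z g (Zer C X Y)) = Cmp C X Y Z g (Zer C X Y)"
      using preadditive_distrib_left[OF C X Y Z preadditive_add(1)[OF C X Y] preadditive_add(1)[OF C X Y] g]
        preadditive_add(3)[OF C X Y preadditive_add(1)[OF C X Y]] by simp
  qed
  show "Cmp C X Y Z (Zer C Y Z) f = Zer C X Z" if f: "f \<in> Mor C X Y"
  proof (rule idem)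
    show "Cmp C X Y Z (Zer C Y Z) f \<in> Mor C X Z"
      by (rule category_cmp[OF cat X Y Z f preadditive_add(1)[OF C Y Z]])
    show "Add C X Z (Cmp C X Y Z (Zer C Y Z) f) (Cmp C X Y Z (Zer C Y Z) f) = Cmp C X Y Z (Zer C Y Z) f"
      using preadditive_distrib_right[OF C X Y Z f preadditive_add(1)[OF C Y Z] preadditive_add(1)[OF C Y Z]]
        preadditive_add(3)[OF C Y Z preadditive_add(1)[OF C Y Z]] by simp
  qed
qed

lemma biproduct_is_product:
  assumes C: "is_preadditive C" and A: "A \<in> Ob C" and B: "B \<in> Ob C"
    and P: "is_biproduct C A B P p q i j" and uv: "u \<noteq> v"
  shows "is_product C {u, v} (\<lambda>k. if k = u then A else B) P (\<lambda>k. if k = u then p else q)"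
proof -
  note cat = preadditive_category[OF C]
  have POb: "P \<in> Ob C" and m: "p \<in> Mor C P A" "q \<in> Mor C P B" "i \<in> Mor C A P" "j \<in> Mor C B P"
    and pi: "Cmp C A P A p i = Idn C A" and qj: "Cmp C B P B q j = Idn C B"
    and qi: "Cmp C A P B q i = Zer C A B" and pj: "Cmp C B P A p j = Zer C B A"
    and sum: "Add C P P (Cmp C P A P i p) (Cmp C P B P j q) = Idn C P"
    using P unfolding is_biproduct_def by auto
  have key: "\<exists>!h. h \<in> Mor C T P \<and> Cmp C T P A p h = f \<and> Cmp C T P B q h = g"
    if T: "T \<in> Ob C" and fg: "f \<in> Mor C T A" "g \<in> Mor C T B" for T f g
  proof -
    define h where "h = Add C T P (Cmp C T A P i f) (Cmp C T B P j g)"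
    have if': "Cmp C T A P i f \<in> Mor C T P" and jg: "Cmp C T B P j g \<in> Mor C T P"
      using category_cmp[OF cat T A POb fg(1) m(3)] category_cmp[OF cat T B POb fg(2) m(4)] .
    have h: "h \<in> Mor C T P" unfolding h_def by (rule preadditive_add(2)[OF C T POb if' jg])
    have "Cmp C T P A p h = Add C T A (Cmp C T A A (Cmp C A P A p i) f) (Cmp C T B A (Cmp C B P A p j) g)"
      unfolding h_def preadditive_distrib_left[OF C T POb A if' jg m(1)]
      using category_assoc[OF cat T A POb A fg(1) m(3) m(1)] category_assoc[OF cat T B POb A fg(2) m(4) m(1)]
      by simp
    also have "\<dots> = f"
      using category_idl[OF cat T A fg(1)] preadditive_zero_cmp(2)[OF C T B A fg(2)]
        preadditive_add(3)[OF C T A fg(1)] by (simp add: pi pj)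
    finally have ph: "Cmp C T P A p h = f" .
    have "Cmp C T P B q h = Add C T B (Cmp C T A B (Cmp C A P B q i) f) (Cmp C T B B (Cmp C B P B q j) g)"
      unfolding h_def preadditive_distrib_left[OF C T POb B if' jg m(2)]
      using category_assoc[OF cat T A POb B fg(1) m(3) m(2)] category_assoc[OF cat T B POb B fg(2) m(4) m(2)]
      by simp
    also have "\<dots> = g"
      using category_idl[OF cat T B fg(2)] preadditive_zero_cmp(2)[OF C T A B fg(1)]
        preadditive_add(4)[OF C T B fg(2)] by (simp add: qi qj)
    finally have qh: "Cmp C T P B q h = g" .
    show ?thesis
    proof (rule ex1I[of _ h])
      fix k assume k: "k \<in> Mor C T P \<and> Cmp C T P A p k = f \<and> Cmp C T P B q k = g"
      then have kM: "k \<in> Mor C T P" by blast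
      have ip: "Cmp C P A P i p \<in> Mor C P P" and jq: "Cmp C P B P j q \<in> Mor C P P"
        using category_cmp[OF cat POb A POb m(1) m(3)] category_cmp[OF cat POb B POb m(2) m(4)] .
      have "k = Cmp C T P P (Idn C P) k" using category_idl[OF cat T POb kM] by simp
      also have "\<dots> = Add C T P (Cmp C T P P (Cmp C P A P i p) k) (Cmp C T P P (Cmp C P B P j q) k)"
        unfolding sum[symmetric] by (rule preadditive_distrib_right[OF C T POb POb kM ip jq])
      also have "\<dots> = h"
        using category_assoc[OF cat T POb A POb kM m(1) m(3)] category_assoc[OF cat T POb B POb kM m(2) m(4)] k
        by (simp add: h_def)
      finally show "k = h" .
    qed (use h ph qh in blast)
  qed
  show ?thesis
    unfolding is_product_def
  proof (intro conjI ballI allI impI)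
    fix T f assume T: "T \<in> Ob C" and f: "\<forall>k\<in>{u, v}. f k \<in> Mor C T (if k = u then A else B)"
    have "f u \<in> Mor C T A" "f v \<in> Mor C T B" using f uv by auto
    from key[OF T this] show "\<exists>!h. h \<in> Mor C T P \<and> (\<forall>k\<in>{u, v}. Cmp C T P (if k = u then A else B)
        (if k = u then p else q) h = f k)"
      using uv by auto
  qed (use POb A B m in auto)
qed

locale additive_accessible = small_universe U + regular_cardinal \<mu>
  for U :: "'u itself" and \<mu> :: "'l rel" +
  fixes C :: "('o, 'u) preadditive" and F :: "('o, 'u, 'u monoid, 'u \<Rightarrow> 'u) funct"
  assumes less_universe: "\<mu> <o |UNIV :: 'u set|"
    and accessible: "accessible_category U \<mu> C" and additive: "is_additive C"
    and products: "has_products U C" and is_functor: "is_functor C (Ab U) F"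
begin

lemma regular_mu: "regular_cardinal \<mu>" by (rule regular_cardinal_axioms)

lemma preadditive: "is_preadditive C"
  using additive by (simp add: is_additive_def)

lemma category: "is_category C" and locally_small: "locally_small U C"
  using accessible by (simp_all add: accessible_category_def)

lemmas cmp = category_cmp[OF category]
  and assoc = category_assoc[OF category]

lemma F_ob: "X \<in> Ob C \<Longrightarrow> fob F X \<in> Ob (Ab U)"
  by (rule functor_ob[OF is_functor])

lemma F_group: "X \<in> Ob C \<Longrightarrow> comm_group (fob F X)"
  using F_ob by simp

lemma F_mor: "X \<in> Ob C \<Longrightarrow> Y \<in> Ob C \<Longrightarrow> f \<in> Mor C X Y \<Longrightarrow> fmor F X Y f \<in> Mor (Ab U) (fob F X) (fob F Y)"
  by (rule functor_mor[OF is_functor])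

lemma F_closed:
  "X \<in> Ob C \<Longrightarrow> Y \<in> Ob C \<Longrightarrow> f \<in> Mor C X Y \<Longrightarrow> x \<in> carrier (fob F X) \<Longrightarrow> fmor F X Y f x \<in> carrier (fob F Y)"
  using F_mor[of X Y f] by (auto simp: hom_def Pi_def)

lemma F_hom:
  "X \<in> Ob C \<Longrightarrow> Y \<in> Ob C \<Longrightarrow> f \<in> Mor C X Y \<Longrightarrow> group_hom (fob F X) (fob F Y) (fmor F X Y f)"
  using F_mor[of X Y f] F_group
  by (simp add: group_hom_def group_hom_axioms_def comm_group.axioms(2))

lemma F_idn: "X \<in> Ob C \<Longrightarrow> x \<in> carrier (fob F X) \<Longrightarrow> fmor F X X (Idn C X) x = x"
  using functor_idn[OF is_functor] by simp

lemma F_cmp: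
  "X \<in> Ob C \<Longrightarrow> Y \<in> Ob C \<Longrightarrow> Z \<in> Ob C \<Longrightarrow> f \<in> Mor C X Y \<Longrightarrow> g \<in> Mor C Y Z \<Longrightarrow> x \<in> carrier (fob F X)
   \<Longrightarrow> fmor F X Z (Cmp C X Y Z g f) x = fmor F Y Z g (fmor F X Y f x)"
  using functor_cmp[OF is_functor, of X Y Z f g] by (simp add: compose_eq)

lemma F_product_elements:
  assumes F: "preserves_products U C (Ab U) F" and I: "small U (I :: 'u set)"
    and P: "is_product C I X P \<pi>" and x: "\<And>i. i \<in> I \<Longrightarrow> x i \<in> carrier (fob F (X i))"
  shows "\<exists>!p. p \<in> carrier (fob F P) \<and> (\<forall>i\<in>I. fmor F P (X i) (\<pi> i) p = x i)"
  by (rule elementwise_Ab_product[OF _ x]) (use F I P in \<open>auto simp: preserves_products_def\<close>)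

lemma F_product_unique:
  assumes F: "preserves_products U C (Ab U) F" and I: "small U (I :: 'u set)"
    and P: "is_product C I X P \<pi>" and x: "x \<in> carrier (fob F P)" "y \<in> carrier (fob F P)"
    and eq: "\<And>i. i \<in> I \<Longrightarrow> fmor F P (X i) (\<pi> i) x = fmor F P (X i) (\<pi> i) y"
  shows "x = y"
proof -
  have "fmor F P (X i) (\<pi> i) x \<in> carrier (fob F (X i))" if "i \<in> I" for i
    using F_closed[of P "X i" "\<pi> i" x] P that x by (simp add: is_product_def)
  from F_product_elements[OF F I P this] show ?thesis using x eq by metis
qed

text \<open>
  Preservation of the empty product gives \<open>F 0 = 0\<close>, and preservation of \<open>Y \<oplus> Y\<close> as a product
  gives additivity on morphisms, since \<open>f + g\<close> factors through \<open>Y \<oplus> Y\<close>.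
\<close>

lemma F_zero:
  assumes F: "preserves_products U C (Ab U) F" and X: "X \<in> Ob C" and Y: "Y \<in> Ob C"
    and x: "x \<in> carrier (fob F X)"
  shows "fmor F X Y (Zer C X Y) x = \<one>\<^bsub>fob F Y\<^esub>"
proof -
  obtain Z where Z: "is_zero_object C Z" using additive by (auto simp: is_additive_def)
  then have ZOb: "Z \<in> Ob C" by (simp add: is_zero_object_def)
  have prod: "is_product C ({} :: 'u set) (\<lambda>_. Z) Z (\<lambda>_. undefined)"
    using Z by (auto simp: is_product_def is_zero_object_def)
  have triv: "z = \<one>\<^bsub>fob F Z\<^esub>" if "z \<in> carrier (fob F Z)" for z
    by (rule F_product_unique[OF F small_finite prod that])
      (use comm_groupE(2)[OF F_group[OF ZOb]] in auto)
  have XZ: "Zer C X Z \<in> Mor C X Z" and ZY: "Zer C Z Y \<in> Mor C Z Y"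
    using preadditive_add(1)[OF preadditive] X Y ZOb by auto
  have "Zer C X Y = Cmp C X Z Y (Zer C Z Y) (Zer C X Z)"
    using preadditive_zero_cmp(1)[OF preadditive X ZOb Y ZY] by simp
  then have "fmor F X Y (Zer C X Y) x = fmor F Z Y (Zer C Z Y) (fmor F X Z (Zer C X Z) x)"
    using F_cmp[OF X ZOb Y XZ ZY x] by simp
  also have "\<dots> = fmor F Z Y (Zer C Z Y) \<one>\<^bsub>fob F Z\<^esub>"
    using triv[OF F_closed[OF X ZOb XZ x]] by simp
  also have "\<dots> = \<one>\<^bsub>fob F Y\<^esub>" by (rule group_hom.hom_one[OF F_hom[OF ZOb Y ZY]])
  finally show ?thesis .
qed

lemma F_add:
  assumes F: "preserves_products U C (Ab U) F" and X: "X \<in> Ob C" and Y: "Y \<in> Ob C"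
    and f: "f \<in> Mor C X Y" and g: "g \<in> Mor C X Y" and x: "x \<in> carrier (fob F X)"
  shows "fmor F X Y (Add C X Y f g) x = fmor F X Y f x \<otimes>\<^bsub>fob F Y\<^esub> fmor F X Y g x"
proof -
  note pre = preadditive
  obtain P p q i j where B: "is_biproduct C Y Y P p q i j"
    using additive Y unfolding is_additive_def by blast
  have POb: "P \<in> Ob C" and m: "p \<in> Mor C P Y" "q \<in> Mor C P Y" "i \<in> Mor C Y P" "j \<in> Mor C Y P"
    and pi: "Cmp C Y P Y p i = Idn C Y" and qj: "Cmp C Y P Y q j = Idn C Y"
    and qi: "Cmp C Y P Y q i = Zer C Y Y" and pj: "Cmp C Y P Y p j = Zer C Y Y"
    using B unfolding is_biproduct_def by auto
  obtain u v :: 'u where uv: "u \<noteq> v" using two_elements by blast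
  note prod = biproduct_is_product[OF pre Y Y B uv]
  interpret FY: comm_group "fob F Y" by (rule F_group[OF Y])
  interpret FP: comm_group "fob F P" by (rule F_group[OF POb])
  define fx where "fx = fmor F X Y f x"
  define gx where "gx = fmor F X Y g x"
  have fgx: "fx \<in> carrier (fob F Y)" "gx \<in> carrier (fob F Y)"
    unfolding fx_def gx_def using F_closed[OF X Y _ x] f g by auto
  \<comment> \<open>The element of \<open>F (Y \<oplus> Y)\<close> with components \<open>fx\<close> and \<open>gx\<close>.\<close>
  define z where "z = fmor F Y P i fx \<otimes>\<^bsub>fob F P\<^esub> fmor F Y P j gx"
  have ifx: "fmor F Y P i fx \<in> carrier (fob F P)" and jgx: "fmor F Y P j gx \<in> carrier (fob F P)"
    using F_closed[OF Y POb] m fgx by auto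
  have split: "fmor F P Y s z = fmor F Y Y (Cmp C Y P Y s i) fx \<otimes>\<^bsub>fob F Y\<^esub> fmor F Y Y (Cmp C Y P Y s j) gx"
    if s: "s \<in> Mor C P Y" for s
    using group_hom.hom_mult[OF F_hom[OF POb Y s] ifx jgx] F_cmp[OF Y POb Y m(3) s fgx(1)]
      F_cmp[OF Y POb Y m(4) s fgx(2)] by (simp add: z_def)
  have pz: "fmor F P Y p z = fx" and qz: "fmor F P Y q z = gx"
    using split[OF m(1)] split[OF m(2)] fgx
    by (simp_all add: pi pj qi qj F_idn[OF Y] F_zero[OF F Y Y])
  define h where "h = Add C X P (Cmp C X Y P i f) (Cmp C X Y P j g)"
  have ifg: "Cmp C X Y P i f \<in> Mor C X P" "Cmp C X Y P j g \<in> Mor C X P"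
    using cmp[OF X Y POb] f g m by auto
  have h: "h \<in> Mor C X P" unfolding h_def by (rule preadditive_add(2)[OF pre X POb ifg])
  have sh: "Cmp C X P Y s h = Add C X Y (Cmp C X Y Y (Cmp C Y P Y s i) f) (Cmp C X Y Y (Cmp C Y P Y s j) g)"
    if s: "s \<in> Mor C P Y" for s
    unfolding h_def preadditive_distrib_left[OF pre X POb Y ifg s]
    using assoc[OF X Y POb Y f m(3) s] assoc[OF X Y POb Y g m(4) s] by simp
  have ph: "Cmp C X P Y p h = f" and qh: "Cmp C X P Y q h = g"
    using sh[OF m(1)] sh[OF m(2)] f g
    by (simp_all add: pi pj qi qj category_idl[OF category X Y] preadditive_zero_cmp(2)[OF pre X Y Y]
        preadditive_add(3,4)[OF pre X Y])
  have hz: "fmor F X P h x = z"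
  proof (rule F_product_unique[OF F _ prod])
    show "fmor F X P h x \<in> carrier (fob F P)" by (rule F_closed[OF X POb h x])
    show "z \<in> carrier (fob F P)" unfolding z_def using ifx jgx by simp
    fix k assume "k \<in> {u, v}"
    then show "fmor F P (if k = u then Y else Y) (if k = u then p else q) (fmor F X P h x) =
        fmor F P (if k = u then Y else Y) (if k = u then p else q) z"
      using F_cmp[OF X POb Y h m(1) x] F_cmp[OF X POb Y h m(2) x] pz qz ph qh
      by (auto simp: fx_def gx_def)
  qed (simp add: small_finite)
  \<comment> \<open>The codiagonal \<open>Y \<oplus> Y \<rightarrow> Y\<close>.\<close>
  define s where "s = Add C P Y p q"
  have s: "s \<in> Mor C P Y" unfolding s_def by (rule preadditive_add(2)[OF pre POb Y m(1,2)])
  have si: "Cmp C Y P Y s i = Idn C Y" and sj: "Cmp C Y P Y s j = Idn C Y"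
    unfolding s_def
    using preadditive_distrib_right[OF pre Y POb Y m(3) m(1,2)]
      preadditive_distrib_right[OF pre Y POb Y m(4) m(1,2)]
      preadditive_add(3,4)[OF pre Y Y category_idn[OF category Y]]
    by (simp_all add: pi pj qi qj)
  have "Add C X Y f g = Cmp C X P Y s h"
    unfolding s_def preadditive_distrib_right[OF pre X POb Y h m(1,2)] by (simp add: ph qh)
  then have "fmor F X Y (Add C X Y f g) x = fmor F P Y s z"
    using F_cmp[OF X POb Y h s x] hz by simp
  also have "\<dots> = fx \<otimes>\<^bsub>fob F Y\<^esub> gx" using split[OF s] fgx by (simp add: si sj F_idn[OF Y])
  finally show ?thesis by (simp add: fx_def gx_def)
qed

section \<open>Functors with a presentation are accessible and preserve products\<close>

lemma F_colimit_system:
  assumes dir: "directed_poset U \<mu> I r" and D: "is_functor (poset_cat I r) C D"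
  shows "directed_system \<mu> I r (\<lambda>i. carrier (fob F (fob D i)))
    (\<lambda>i j. fmor F (fob D i) (fob D j) (fmor D i j ()))"
  using directed_system_Ab[OF regular_mu dir functor_fcomp[OF D is_functor]] by (simp add: fcomp_def)

lemma presented_factors:
  assumes "presented U \<mu> C A" "directed_poset U \<mu> I r" "is_functor (poset_cat I r) C D"
    "is_colimit (poset_cat I r) C D L \<iota>"
  shows "factors_essentially_uniquely C I r D L \<iota> A"
  by (rule presentedD[OF regular_mu category locally_small assms])

end

locale presentation = additive_accessible U \<mu> C F
  for U :: "'u itself" and \<mu> :: "'l rel" and C :: "('o, 'u) preadditive" and F +
  fixes A B \<alpha> \<beta>
  assumes A: "presented U \<mu> C A" and B: "presented U \<mu> C B"
    and exact: "right_exact_sequence U C (hom_functor C B) (hom_functor C A) F \<alpha> \<beta>"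
begin

lemma A_ob: "A \<in> Ob C" and B_ob: "B \<in> Ob C"
  using A B by (simp_all add: presented_def)

lemma \<alpha>_closed: "X \<in> Ob C \<Longrightarrow> h \<in> Mor C B X \<Longrightarrow> \<alpha> X h \<in> Mor C A X"
  using exact
  by (auto simp: right_exact_sequence_def is_nat_trans_def hom_functor_def hom_group_def hom_def Pi_def)

lemma \<beta>_hom: "X \<in> Ob C \<Longrightarrow> group_hom (hom_group C A X) (fob F X) (\<beta> X)"
  using exact F_group preadditive_group[OF preadditive A_ob]
  by (simp add: right_exact_sequence_def is_nat_trans_def hom_functor_def group_hom_def
      group_hom_axioms_def comm_group.axioms(2))

lemma \<beta>_closed: "X \<in> Ob C \<Longrightarrow> g \<in> Mor C A X \<Longrightarrow> \<beta> X g \<in> carrier (fob F X)"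
  using group_hom.hom_closed[OF \<beta>_hom] by (simp add: hom_group_def)

lemma \<alpha>_natural:
  assumes X: "X \<in> Ob C" "Y \<in> Ob C" and f: "f \<in> Mor C X Y" and h: "h \<in> Mor C B X"
  shows "\<alpha> Y (Cmp C B X Y f h) = Cmp C A X Y f (\<alpha> X h)"
proof -
  have "compose (Mor C B X) (\<alpha> Y) (\<lambda>g\<in>Mor C B X. Cmp C B X Y f g) =
      compose (Mor C B X) (\<lambda>g\<in>Mor C A X. Cmp C A X Y f g) (\<alpha> X)"
    using exact X f
    by (simp add: right_exact_sequence_def is_nat_trans_def hom_functor_def hom_group_def)
  from fun_cong[OF this, of h] show ?thesis using h \<alpha>_closed[OF X(1) h] by (simp add: compose_eq)
qed

lemma \<beta>_natural:
  assumes X: "X \<in> Ob C" "Y \<in> Ob C" and f: "f \<in> Mor C X Y" and g: "g \<in> Mor C A X"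
  shows "\<beta> Y (Cmp C A X Y f g) = fmor F X Y f (\<beta> X g)"
proof -
  have "compose (Mor C A X) (\<beta> Y) (\<lambda>g\<in>Mor C A X. Cmp C A X Y f g) =
      compose (Mor C A X) (fmor F X Y f) (\<beta> X)"
    using exact X f
    by (simp add: right_exact_sequence_def is_nat_trans_def hom_functor_def hom_group_def)
  from fun_cong[OF this, of g] show ?thesis using g by (simp add: compose_eq)
qed

lemma images:
  assumes "X \<in> Ob C"
  shows "\<alpha> X ` Mor C B X = {g \<in> Mor C A X. \<beta> X g = \<one>\<^bsub>fob F X\<^esub>}"
    and "\<beta> X ` Mor C A X = carrier (fob F X)"
  using exact assms
  by (simp_all add: right_exact_sequence_def hom_functor_def hom_group_def kernel_def)

lemma \<beta>_surj: "X \<in> Ob C \<Longrightarrow> x \<in> carrier (fob F X) \<Longrightarrow> \<exists>g\<in>Mor C A X. \<beta> X g = x"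
  by (metis images(2) imageE)

lemma \<beta>_kernel: "X \<in> Ob C \<Longrightarrow> g \<in> Mor C A X \<Longrightarrow> \<beta> X g = \<one>\<^bsub>fob F X\<^esub> \<Longrightarrow> \<exists>h\<in>Mor C B X. \<alpha> X h = g"
  using images(1)[of X] by (force simp: set_eq_iff)

lemma \<beta>_\<alpha>: "X \<in> Ob C \<Longrightarrow> h \<in> Mor C B X \<Longrightarrow> \<beta> X (\<alpha> X h) = \<one>\<^bsub>fob F X\<^esub>"
  using images(1) by blast

text \<open>
  Elements of \<open>F L\<close> and relations between them come from maps \<open>A \<rightarrow> L\<close> and \<open>B \<rightarrow> L\<close>, which
  factor through a stage of the colimit.
\<close>

lemma colimits_preserved: "preserves_directed_colimits U \<mu> C (Ab U) F"
  unfolding preserves_directed_colimits_def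
proof (intro allI impI)
  fix I r D L \<iota>
  assume dir: "directed_poset U \<mu> I r" and D: "is_functor (poset_cat I r) C D"
    and L: "is_colimit (poset_cat I r) C D L \<iota>"
  interpret S: directed_system \<mu> I r "\<lambda>i. carrier (fob F (fob D i))"
    "\<lambda>i j. fmor F (fob D i) (fob D j) (fmor D i j ())"
    by (rule F_colimit_system[OF dir D])
  note D' = poset_functorD[OF D S.partial_order]
  have L': "L \<in> Ob C" "\<And>i. i \<in> I \<Longrightarrow> \<iota> i \<in> Mor C (fob D i) L"
    "\<And>i j. (i, j) \<in> r \<Longrightarrow> Cmp C (fob D i) (fob D j) L (\<iota> j) (fmor D i j ()) = \<iota> i"
    using L by (auto simp: is_colimit_def cocone_poset_iff[OF S.r_closed])
  note fA = presented_factors[OF A dir D L, unfolded factors_essentially_uniquely_def]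
    and fB = presented_factors[OF B dir D L, unfolded factors_essentially_uniquely_def]
  have ij: "fob D i \<in> Ob C" "fob D j \<in> Ob C" "fmor D i j () \<in> Mor C (fob D i) (fob D j)"
    "i \<in> I" "j \<in> I" if "(i, j) \<in> r" for i j
    using D' S.r_memb that by blast+
  have kernel: "\<exists>j. (i, j) \<in> r \<and> fmor F (fob D i) (fob D j) (fmor D i j ()) x = \<one>\<^bsub>fob F (fob D j)\<^esub>"
    if i: "i \<in> I" and x: "x \<in> carrier (fob F (fob D i))"
      and one: "fmor F (fob D i) L (\<iota> i) x = \<one>\<^bsub>fob F L\<^esub>" for i x
  proof -
    note Di = D'(1)[OF i]
    obtain g where g: "g \<in> Mor C A (fob D i)" "\<beta> (fob D i) g = x" using \<beta>_surj[OF Di x] by blast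
    have \<iota>g: "Cmp C A (fob D i) L (\<iota> i) g \<in> Mor C A L" by (rule cmp[OF A_ob Di L'(1) g(1) L'(2)[OF i]])
    have "\<beta> L (Cmp C A (fob D i) L (\<iota> i) g) = \<one>\<^bsub>fob F L\<^esub>"
      using \<beta>_natural[OF Di L'(1) L'(2)[OF i] g(1)] g(2) one by simp
    then obtain h where h: "h \<in> Mor C B L" "\<alpha> L h = Cmp C A (fob D i) L (\<iota> i) g"
      using \<beta>_kernel[OF L'(1) \<iota>g] by blast
    obtain k h' where k: "k \<in> I" and h': "h' \<in> Mor C B (fob D k)" "Cmp C B (fob D k) L (\<iota> k) h' = h"
      using fB h(1) by blast
    obtain m where m: "(i, m) \<in> r" "(k, m) \<in> r" using S.upper_bound2[OF i k] by blast
    note im = ij[OF m(1)] and km = ij[OF m(2)]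
    define g1 where "g1 = Cmp C A (fob D i) (fob D m) (fmor D i m ()) g"
    define h1 where "h1 = Cmp C B (fob D k) (fob D m) (fmor D k m ()) h'"
    have g1: "g1 \<in> Mor C A (fob D m)" unfolding g1_def by (rule cmp[OF A_ob im(1,2) g(1) im(3)])
    have h1: "h1 \<in> Mor C B (fob D m)" unfolding h1_def by (rule cmp[OF B_ob km(1,2) h'(1) km(3)])
    have \<alpha>h1: "\<alpha> (fob D m) h1 \<in> Mor C A (fob D m)" by (rule \<alpha>_closed[OF km(2) h1])
    have "Cmp C A (fob D m) L (\<iota> m) g1 = Cmp C A (fob D i) L (\<iota> i) g"
      using assoc[OF A_ob im(1,2) L'(1) g(1) im(3) L'(2)[OF im(5)]] L'(3)[OF m(1)] by (simp add: g1_def)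
    also have "\<dots> = \<alpha> L (Cmp C B (fob D m) L (\<iota> m) h1)"
      using assoc[OF B_ob km(1,2) L'(1) h'(1) km(3) L'(2)[OF km(5)]] L'(3)[OF m(2)] h(2) h'(2)
      by (simp add: h1_def)
    also have "\<dots> = Cmp C A (fob D m) L (\<iota> m) (\<alpha> (fob D m) h1)"
      by (rule \<alpha>_natural[OF km(2) L'(1) L'(2)[OF km(5)] h1])
    finally obtain n where n: "(m, n) \<in> r" and eq: "Cmp C A (fob D m) (fob D n) (fmor D m n ()) g1 =
        Cmp C A (fob D m) (fob D n) (fmor D m n ()) (\<alpha> (fob D m) h1)"
      using fA im(5) g1 \<alpha>h1 by blast
    note mn = ij[OF n]
    have "fmor F (fob D i) (fob D n) (fmor D i n ()) x =
        fmor F (fob D m) (fob D n) (fmor D m n ()) (fmor F (fob D i) (fob D m) (fmor D i m ()) x)"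
      using S.t_comp[OF m(1) n x] by simp
    also have "fmor F (fob D i) (fob D m) (fmor D i m ()) x = \<beta> (fob D m) g1"
      using \<beta>_natural[OF im(1,2,3) g(1)] g(2) by (simp add: g1_def)
    also have "fmor F (fob D m) (fob D n) (fmor D m n ()) (\<beta> (fob D m) g1) =
        \<beta> (fob D n) (\<alpha> (fob D n) (Cmp C B (fob D m) (fob D n) (fmor D m n ()) h1))"
      using \<beta>_natural[OF mn(1,2,3) g1] eq \<alpha>_natural[OF mn(1,2,3) h1] by simp
    also have "\<dots> = \<one>\<^bsub>fob F (fob D n)\<^esub>" by (rule \<beta>_\<alpha>[OF mn(2) cmp[OF B_ob mn(1,2) h1 mn(3)]])
    finally show ?thesis using S.r_trans[OF m(1) n] by blast
  qed
  show "is_colimit (poset_cat I r) (Ab U) (fcomp F D) (fob F L) (\<lambda>i. fmor F (fob D i) L (\<iota> i))"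
  proof (rule Ab_colimit_elementwise[OF regular_mu dir functor_fcomp[OF D is_functor] F_ob[OF L'(1)]])
    show "fmor F (fob D i) L (\<iota> i) \<in> Mor (Ab U) (fob (fcomp F D) i) (fob F L)" if "i \<in> I" for i
      using F_mor[OF D'(1)[OF that] L'(1) L'(2)[OF that]] by (simp add: fcomp_def)
    have "S.elementwise_colimit (carrier (fob F L)) (\<lambda>i. fmor F (fob D i) L (\<iota> i))"
    proof (rule S.elementwise_colimitI)
      show "fmor F (fob D i) L (\<iota> i) x \<in> carrier (fob F L)"
        if "i \<in> I" "x \<in> carrier (fob F (fob D i))" for i x
        by (rule F_closed[OF D'(1)[OF that(1)] L'(1) L'(2)[OF that(1)] that(2)])
      show "fmor F (fob D j) L (\<iota> j) (fmor F (fob D i) (fob D j) (fmor D i j ()) x) =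
          fmor F (fob D i) L (\<iota> i) x"
        if "(i, j) \<in> r" "x \<in> carrier (fob F (fob D i))" for i j x
        using F_cmp[OF ij(1,2)[OF that(1)] L'(1) ij(3)[OF that(1)] L'(2)[OF ij(5)[OF that(1)]] that(2)]
          L'(3)[OF that(1)] by simp
      show "\<exists>i\<in>I. \<exists>x\<in>carrier (fob F (fob D i)). fmor F (fob D i) L (\<iota> i) x = l"
        if l: "l \<in> carrier (fob F L)" for l
      proof -
        obtain g where g: "g \<in> Mor C A L" "\<beta> L g = l" using \<beta>_surj[OF L'(1) l] by blast
        then obtain i g' where i: "i \<in> I" and g': "g' \<in> Mor C A (fob D i)"
          "Cmp C A (fob D i) L (\<iota> i) g' = g" using fA by blast
        have "fmor F (fob D i) L (\<iota> i) (\<beta> (fob D i) g') = l"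
          using \<beta>_natural[OF D'(1)[OF i] L'(1) L'(2)[OF i] g'(1)] g g'(2) by simp
        then show ?thesis using i \<beta>_closed[OF D'(1)[OF i] g'(1)] by blast
      qed
      show "\<exists>j. (i, j) \<in> r \<and> fmor F (fob D i) (fob D j) (fmor D i j ()) x =
          fmor F (fob D i) (fob D j) (fmor D i j ()) y"
        if i: "i \<in> I" and xy: "x \<in> carrier (fob F (fob D i))" "y \<in> carrier (fob F (fob D i))"
          and eq: "fmor F (fob D i) L (\<iota> i) x = fmor F (fob D i) L (\<iota> i) y" for i x y
      proof -
        interpret Fi: comm_group "fob F (fob D i)" by (rule F_group[OF D'(1)[OF i]])
        have z: "x \<otimes>\<^bsub>fob F (fob D i)\<^esub> inv\<^bsub>fob F (fob D i)\<^esub> y \<in> carrier (fob F (fob D i))" using xy by simp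
        have "fmor F (fob D i) L (\<iota> i) (x \<otimes>\<^bsub>fob F (fob D i)\<^esub> inv\<^bsub>fob F (fob D i)\<^esub> y) = \<one>\<^bsub>fob F L\<^esub>"
          using hom_eq_iff_kernel[OF F_hom[OF D'(1)[OF i] L'(1) L'(2)[OF i]] xy] eq by blast
        from kernel[OF i z this] obtain j where j: "(i, j) \<in> r" "fmor F (fob D i) (fob D j) (fmor D i j ())
            (x \<otimes>\<^bsub>fob F (fob D i)\<^esub> inv\<^bsub>fob F (fob D i)\<^esub> y) = \<one>\<^bsub>fob F (fob D j)\<^esub>" by blast
        then show ?thesis using hom_eq_iff_kernel[OF F_hom[OF ij(1,2,3)[OF j(1)]] xy] by blast
      qed
    qed
    then show "directed_system.elementwise_colimit I r (\<lambda>i. carrier (fob (fcomp F D) i))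
        (\<lambda>i j. fmor (fcomp F D) i j ()) (carrier (fob F L)) (\<lambda>i. fmor F (fob D i) L (\<iota> i))"
      by (simp add: fcomp_def)
  qed
qed

text \<open>
  A family of elements of the \<open>F (X i)\<close> lifts to maps \<open>A \<rightarrow> X i\<close>, that is, to one map into the
  product. If an element of \<open>F P\<close> has trivial components, the maps \<open>B \<rightarrow> X i\<close> that witness this
  likewise assemble to one map \<open>B \<rightarrow> P\<close>.
\<close>

lemma products_preserved: "preserves_products U C (Ab U) F"
  unfolding preserves_products_def
proof (intro allI impI)
  fix I :: "'u set" and X P \<pi>
  assume prod: "is_product C I X P \<pi>"
  have P: "P \<in> Ob C" and X: "\<And>i. i \<in> I \<Longrightarrow> X i \<in> Ob C" and \<pi>: "\<And>i. i \<in> I \<Longrightarrow> \<pi> i \<in> Mor C P (X i)"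
    and univ: "\<And>T f. T \<in> Ob C \<Longrightarrow> (\<forall>i\<in>I. f i \<in> Mor C T (X i)) \<Longrightarrow>
        \<exists>!h. h \<in> Mor C T P \<and> (\<forall>i\<in>I. Cmp C T P (X i) (\<pi> i) h = f i)"
    using prod unfolding is_product_def by blast+
  have kernel: "x = \<one>\<^bsub>fob F P\<^esub>"
    if x: "x \<in> carrier (fob F P)" and one: "\<And>i. i \<in> I \<Longrightarrow> fmor F P (X i) (\<pi> i) x = \<one>\<^bsub>fob F (X i)\<^esub>" for x
  proof -
    obtain g where g: "g \<in> Mor C A P" "\<beta> P g = x" using \<beta>_surj[OF P x] by blast
    have \<pi>g: "Cmp C A P (X i) (\<pi> i) g \<in> Mor C A (X i)" if "i \<in> I" for i
      by (rule cmp[OF A_ob P X[OF that] g(1) \<pi>[OF that]])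
    have "\<forall>i\<in>I. \<exists>h. h \<in> Mor C B (X i) \<and> \<alpha> (X i) h = Cmp C A P (X i) (\<pi> i) g"
    proof
      fix i assume i: "i \<in> I"
      have "\<beta> (X i) (Cmp C A P (X i) (\<pi> i) g) = \<one>\<^bsub>fob F (X i)\<^esub>"
        using \<beta>_natural[OF P X[OF i] \<pi>[OF i] g(1)] g(2) one[OF i] by simp
      then show "\<exists>h. h \<in> Mor C B (X i) \<and> \<alpha> (X i) h = Cmp C A P (X i) (\<pi> i) g"
        using \<beta>_kernel[OF X[OF i] \<pi>g[OF i]] by blast
    qed
    then obtain h where h: "\<forall>i\<in>I. h i \<in> Mor C B (X i) \<and> \<alpha> (X i) (h i) = Cmp C A P (X i) (\<pi> i) g"
      by (rule bchoice[THEN exE])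
    then have "\<exists>!k. k \<in> Mor C B P \<and> (\<forall>i\<in>I. Cmp C B P (X i) (\<pi> i) k = h i)"
      by (intro univ[OF B_ob]) blast
    then obtain k where k: "k \<in> Mor C B P" "\<And>i. i \<in> I \<Longrightarrow> Cmp C B P (X i) (\<pi> i) k = h i" by blast
    have "\<forall>i\<in>I. Cmp C A P (X i) (\<pi> i) (\<alpha> P k) = Cmp C A P (X i) (\<pi> i) g"
      using \<alpha>_natural[OF P X \<pi> k(1)] k(2) h by simp
    moreover have "\<exists>!f. f \<in> Mor C A P \<and> (\<forall>i\<in>I. Cmp C A P (X i) (\<pi> i) f = Cmp C A P (X i) (\<pi> i) g)"
      by (rule univ[OF A_ob]) (use \<pi>g in blast)
    ultimately have "\<alpha> P k = g" using g(1) \<alpha>_closed[OF P k(1)] by blast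
    then show ?thesis using \<beta>_\<alpha>[OF P k(1)] g(2) by simp
  qed
  show "is_product (Ab U) I (\<lambda>i. fob F (X i)) (fob F P) (\<lambda>i. fmor F P (X i) (\<pi> i))"
  proof (rule Ab_product_elementwise[OF F_ob[OF P] F_ob[OF X] F_mor[OF P X \<pi>]])
    fix x assume x: "\<And>i. i \<in> I \<Longrightarrow> x i \<in> carrier (fob F (X i))"
    have "\<forall>i\<in>I. \<exists>g. g \<in> Mor C A (X i) \<and> \<beta> (X i) g = x i" using \<beta>_surj X x by blast
    then obtain g where g: "\<forall>i\<in>I. g i \<in> Mor C A (X i) \<and> \<beta> (X i) (g i) = x i"
      by (rule bchoice[THEN exE])
    then have "\<exists>!k. k \<in> Mor C A P \<and> (\<forall>i\<in>I. Cmp C A P (X i) (\<pi> i) k = g i)"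
      by (intro univ[OF A_ob]) blast
    then obtain k where k: "k \<in> Mor C A P" "\<And>i. i \<in> I \<Longrightarrow> Cmp C A P (X i) (\<pi> i) k = g i" by blast
    have "\<forall>i\<in>I. fmor F P (X i) (\<pi> i) (\<beta> P k) = x i"
      using \<beta>_natural[OF P X \<pi> k(1)] k(2) g by simp
    then show "\<exists>p\<in>carrier (fob F P). \<forall>i\<in>I. fmor F P (X i) (\<pi> i) p = x i"
      using \<beta>_closed[OF P k(1)] by blast
  next
    fix p p' assume p: "p \<in> carrier (fob F P)" "p' \<in> carrier (fob F P)"
      and eq: "\<And>i. i \<in> I \<Longrightarrow> fmor F P (X i) (\<pi> i) p = fmor F P (X i) (\<pi> i) p'"
    interpret FP: comm_group "fob F P" by (rule F_group[OF P])
    have "p \<otimes>\<^bsub>fob F P\<^esub> inv\<^bsub>fob F P\<^esub> p' = \<one>\<^bsub>fob F P\<^esub>"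
    proof (rule kernel)
      fix i assume i: "i \<in> I"
      show "fmor F P (X i) (\<pi> i) (p \<otimes>\<^bsub>fob F P\<^esub> inv\<^bsub>fob F P\<^esub> p') = \<one>\<^bsub>fob F (X i)\<^esub>"
        using hom_eq_iff_kernel[OF F_hom[OF P X[OF i] \<pi>[OF i]] p] eq[OF i] by blast
    qed (use p in simp)
    then show "p = p'" using p by (metis FP.inv_closed FP.inv_equality FP.inv_inv)
  qed
qed

end

section \<open>Accessible functors that preserve products have a presentation\<close>

context additive_accessible
begin

text \<open>
  A set-valued functor \<open>E\<close> that lifts elements to products and to stages of directed colimits
  is generated by one element of its value at a presented object: the product of a copy of \<open>s\<close> for
  each pair \<open>(s, e)\<close> with \<open>e \<in> E s\<close>, for \<open>s\<close> in a small set of presented generators, carries an element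
  with all the components \<open>e\<close>, and this element comes from a stage of a directed colimit.
\<close>

lemma generated_by_one_element:
  fixes E :: "'o \<Rightarrow> 'u set" and m :: "'o \<Rightarrow> 'o \<Rightarrow> 'u \<Rightarrow> 'u \<Rightarrow> 'u"
  assumes small: "\<And>X. X \<in> Ob C \<Longrightarrow> small U (E X)"
    and m_cmp: "\<And>X Y Z f g e. X \<in> Ob C \<Longrightarrow> Y \<in> Ob C \<Longrightarrow> Z \<in> Ob C \<Longrightarrow> f \<in> Mor C X Y \<Longrightarrow> g \<in> Mor C Y Z
      \<Longrightarrow> e \<in> E X \<Longrightarrow> m X Z (Cmp C X Y Z g f) e = m Y Z g (m X Y f e)"
    and lift_product: "\<And>(I :: 'u set) X P \<pi> e. small U I \<Longrightarrow> is_product C I X P \<pi> \<Longrightarrow>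
      (\<And>i. i \<in> I \<Longrightarrow> e i \<in> E (X i)) \<Longrightarrow> \<exists>p\<in>E P. \<forall>i\<in>I. m P (X i) (\<pi> i) p = e i"
    and lift_colimit: "\<And>I r D L \<iota> e. directed_poset U \<mu> I r \<Longrightarrow> is_functor (poset_cat I r) C D \<Longrightarrow>
      is_colimit (poset_cat I r) C D L \<iota> \<Longrightarrow> e \<in> E L \<Longrightarrow>
      \<exists>i\<in>I. \<exists>d\<in>E (fob D i). m (fob D i) L (\<iota> i) d = e"
  shows "\<exists>A a. presented U \<mu> C A \<and> a \<in> E A \<and> (\<forall>X\<in>Ob C. \<forall>e\<in>E X. \<exists>f\<in>Mor C A X. m A X f a = e)"
proof -
  obtain S where S: "small U S" "\<And>A. A \<in> S \<Longrightarrow> presented U \<mu> C A"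
    and gen: "\<And>X. X \<in> Ob C \<Longrightarrow> \<exists>I r D \<iota>. directed_poset U \<mu> I r \<and> is_functor (poset_cat I r) C D \<and>
           (\<forall>i\<in>I. fob D i \<in> S) \<and> is_colimit (poset_cat I r) C D X \<iota>"
    using accessible unfolding accessible_category_def by blast
  have S_ob: "s \<in> Ob C" if "s \<in> S" for s using S(2)[OF that] by (simp add: presented_def)
  have from_S: "\<exists>s\<in>S. \<exists>f\<in>Mor C s X. \<exists>d\<in>E s. m s X f d = e" if X: "X \<in> Ob C" and e: "e \<in> E X" for X e
  proof -
    obtain I r D \<iota> where 1: "directed_poset U \<mu> I r" "is_functor (poset_cat I r) C D"
      "\<forall>i\<in>I. fob D i \<in> S" "is_colimit (poset_cat I r) C D X \<iota>" using gen[OF X] by blast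
    obtain i d where i: "i \<in> I" "d \<in> E (fob D i)" "m (fob D i) X (\<iota> i) d = e"
      using lift_colimit[OF 1(1,2,4) e] by blast
    have "\<iota> i \<in> Mor C (fob D i) X" using 1(4) i(1) by (simp add: is_colimit_def is_cocone_def)
    then show ?thesis using i 1(3) by blast
  qed
  define W where "W = Sigma S E"
  have "small U W" unfolding W_def by (rule small_Sigma[OF S(1) small[OF S_ob]])
  then obtain j :: "'o \<times> 'u \<Rightarrow> 'u" where j: "inj_on j W" using small_embeds by blast
  have small_I: "small U (j ` W)" by (rule small_image) fact
  define w where "w = inv_into W j"
  have w: "w i \<in> W" if "i \<in> j ` W" for i unfolding w_def using that by (rule inv_into_into)
  have wj: "w (j x) = x" if "x \<in> W" for x unfolding w_def using j that by simp
  have "fst (w i) \<in> Ob C" "snd (w i) \<in> E (fst (w i))" if "i \<in> j ` W" for i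
    using w[OF that] S_ob by (auto simp: W_def)
  note w_ob = this(1) and w_el = this(2)
  obtain P \<pi> where P: "is_product C (j ` W) (\<lambda>i. fst (w i)) P \<pi>"
    using products small_I w_ob unfolding has_products_def by meson
  have P_ob: "P \<in> Ob C" and \<pi>: "\<And>i. i \<in> j ` W \<Longrightarrow> \<pi> i \<in> Mor C P (fst (w i))"
    using P by (auto simp: is_product_def)
  obtain p where p: "p \<in> E P" "\<forall>i\<in>j ` W. m P (fst (w i)) (\<pi> i) p = snd (w i)"
    using lift_product[OF small_I P w_el] by blast
  obtain A q a where A: "A \<in> S" and q: "q \<in> Mor C A P" and a: "a \<in> E A" "m A P q a = p"
    using from_S[OF P_ob p(1)] by blast
  note A_ob = S_ob[OF A]
  have "\<exists>f\<in>Mor C A X. m A X f a = e" if X: "X \<in> Ob C" and e: "e \<in> E X" for X e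
  proof -
    obtain s f d where s: "s \<in> S" and f: "f \<in> Mor C s X" and d: "d \<in> E s" "m s X f d = e"
      using from_S[OF X e] by blast
    define i where "i = j (s, d)"
    have sd: "(s, d) \<in> W" using s d by (simp add: W_def)
    have i: "i \<in> j ` W" "w i = (s, d)" using sd wj by (auto simp: i_def)
    have \<pi>i: "\<pi> i \<in> Mor C P s" using \<pi>[OF i(1)] i(2) by simp
    define g where "g = Cmp C A P s (\<pi> i) q"
    have g: "g \<in> Mor C A s" unfolding g_def by (rule cmp[OF A_ob P_ob S_ob[OF s] q \<pi>i])
    have "m A s g a = m P s (\<pi> i) p"
      using m_cmp[OF A_ob P_ob S_ob[OF s] q \<pi>i a(1)] a(2) by (simp add: g_def)
    also have "\<dots> = d" using bspec[OF p(2) i(1)] i(2) by simp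
    finally have "m A X (Cmp C A s X f g) a = e"
      using m_cmp[OF A_ob S_ob[OF s] X g f a(1)] d(2) by simp
    then show ?thesis using cmp[OF A_ob S_ob[OF s] X g f] by blast
  qed
  then show ?thesis using S(2)[OF A] a(1) by blast
qed

text \<open>
  The generating element \<open>a \<in> F A\<close> gives an epimorphism \<open>Hom(A, -) \<rightarrow> F\<close>. Its kernel, the
  functor of maps \<open>f\<close> from \<open>A\<close> with \<open>F f a\<close> trivial, again satisfies the hypotheses of the previous
  lemma, and a generator \<open>b : A \<rightarrow> B\<close> of the kernel gives the map \<open>Hom(B, -) \<rightarrow> Hom(A, -)\<close>.
\<close>

lemma presentation_exists:
  assumes colimits: "preserves_directed_colimits U \<mu> C (Ab U) F"
    and prods: "preserves_products U C (Ab U) F"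
  shows "\<exists>A B \<alpha> \<beta>. presented U \<mu> C A \<and> presented U \<mu> C B \<and>
    right_exact_sequence U C (hom_functor C B) (hom_functor C A) F \<alpha> \<beta>"
proof -
  have F_colimit: "directed_system.elementwise_colimit I r (\<lambda>i. carrier (fob F (fob D i)))
      (\<lambda>i j. fmor F (fob D i) (fob D j) (fmor D i j ())) (carrier (fob F L))
      (\<lambda>i. fmor F (fob D i) L (\<iota> i))"
    if "directed_poset U \<mu> I r" "is_functor (poset_cat I r) C D"
      "is_colimit (poset_cat I r) C D L \<iota>" for I r D L \<iota>
  proof -
    have "is_colimit (poset_cat I r) (Ab U) (fcomp F D) (fob F L) (\<lambda>i. fmor F (fob D i) L (\<iota> i))"
      using colimits that unfolding preserves_directed_colimits_def by blast
    from elementwise_Ab_colimit[OF regular_mu that(1) functor_fcomp[OF that(2) is_functor] this]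
    show ?thesis by (simp add: fcomp_def)
  qed
  have "\<exists>A a. presented U \<mu> C A \<and> a \<in> carrier (fob F A) \<and>
      (\<forall>X\<in>Ob C. \<forall>e\<in>carrier (fob F X). \<exists>f\<in>Mor C A X. fmor F A X f a = e)"
  proof (rule generated_by_one_element)
    show "small U (carrier (fob F X))" if "X \<in> Ob C" for X using F_ob[OF that] by simp
    show "\<exists>p\<in>carrier (fob F P). \<forall>i\<in>I. fmor F P (X i) (\<pi> i) p = e i"
      if "small U I" "is_product C I X P \<pi>" "\<And>i. i \<in> I \<Longrightarrow> e i \<in> carrier (fob F (X i))"
      for I :: "'u set" and X P \<pi> e
      using F_product_elements[OF prods that] by blast
    show "\<exists>i\<in>I. \<exists>d\<in>carrier (fob F (fob D i)). fmor F (fob D i) L (\<iota> i) d = e"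
      if "directed_poset U \<mu> I r" "is_functor (poset_cat I r) C D"
        "is_colimit (poset_cat I r) C D L \<iota>" "e \<in> carrier (fob F L)" for I r D L \<iota> e
      using directed_system.elementwise_colimitD(3)[OF F_colimit_system[OF that(1,2)] F_colimit[OF that(1-3)] that(4)] .
  qed (rule F_cmp)
  then obtain A a where A: "presented U \<mu> C A" and a: "a \<in> carrier (fob F A)"
    and gen: "\<And>X e. X \<in> Ob C \<Longrightarrow> e \<in> carrier (fob F X) \<Longrightarrow> \<exists>f\<in>Mor C A X. fmor F A X f a = e"
    by blast
  have A_ob: "A \<in> Ob C" using A by (simp add: presented_def)
  define E where "E X = {f \<in> Mor C A X. fmor F A X f a = \<one>\<^bsub>fob F X\<^esub>}" for X
  have "\<exists>B b. presented U \<mu> C B \<and> b \<in> E B \<and>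
      (\<forall>X\<in>Ob C. \<forall>f\<in>E X. \<exists>h\<in>Mor C B X. Cmp C A B X h b = f)"
  proof (rule generated_by_one_element)
    show "small U (E X)" if "X \<in> Ob C" for X
      by (rule small_mono[of "Mor C A X"])
        (use locally_small A_ob that in \<open>auto simp: E_def locally_small_def\<close>)
    show "Cmp C A X Z (Cmp C X Y Z g f) e = Cmp C A Y Z g (Cmp C A X Y f e)"
      if "X \<in> Ob C" "Y \<in> Ob C" "Z \<in> Ob C" "f \<in> Mor C X Y" "g \<in> Mor C Y Z" "e \<in> E X" for X Y Z f g e
      using assoc[OF A_ob that(1-3) _ that(4,5)] that(6) by (simp add: E_def)
    show "\<exists>p\<in>E P. \<forall>i\<in>I. Cmp C A P (X i) (\<pi> i) p = e i"
      if I: "small U I" and P: "is_product C I X P \<pi>" and e: "\<And>i. i \<in> I \<Longrightarrow> e i \<in> E (X i)"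
      for I :: "'u set" and X P \<pi> e
    proof -
      have P': "P \<in> Ob C" "\<And>i. i \<in> I \<Longrightarrow> X i \<in> Ob C" "\<And>i. i \<in> I \<Longrightarrow> \<pi> i \<in> Mor C P (X i)"
        using P by (auto simp: is_product_def)
      have "\<forall>i\<in>I. e i \<in> Mor C A (X i)" using e by (auto simp: E_def)
      then obtain p where p: "p \<in> Mor C A P" "\<forall>i\<in>I. Cmp C A P (X i) (\<pi> i) p = e i"
        using P A_ob unfolding is_product_def by blast
      have "fmor F A P p a = \<one>\<^bsub>fob F P\<^esub>"
      proof (rule F_product_unique[OF prods I P])
        show "fmor F A P p a \<in> carrier (fob F P)" by (rule F_closed[OF A_ob P'(1) p(1) a])
        show "\<one>\<^bsub>fob F P\<^esub> \<in> carrier (fob F P)" by (rule comm_groupE(2)[OF F_group[OF P'(1)]])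
        fix i assume i: "i \<in> I"
        have "fmor F P (X i) (\<pi> i) (fmor F A P p a) = fmor F A (X i) (e i) a"
          using F_cmp[OF A_ob P'(1) P'(2)[OF i] p(1) P'(3)[OF i] a] p(2) i by simp
        also have "\<dots> = \<one>\<^bsub>fob F (X i)\<^esub>" using e[OF i] by (simp add: E_def)
        also have "\<dots> = fmor F P (X i) (\<pi> i) \<one>\<^bsub>fob F P\<^esub>"
          using group_hom.hom_one[OF F_hom[OF P'(1) P'(2)[OF i] P'(3)[OF i]]] by simp
        finally show "fmor F P (X i) (\<pi> i) (fmor F A P p a) = fmor F P (X i) (\<pi> i) \<one>\<^bsub>fob F P\<^esub>" .
      qed
      then have "p \<in> E P" using p(1) by (simp add: E_def)
      then show ?thesis using p(2) by blast
    qed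
    show "\<exists>i\<in>I. \<exists>d\<in>E (fob D i). Cmp C A (fob D i) L (\<iota> i) d = e"
      if dir: "directed_poset U \<mu> I r" and D: "is_functor (poset_cat I r) C D"
        and L: "is_colimit (poset_cat I r) C D L \<iota>" and e: "e \<in> E L" for I r D L \<iota> e
    proof -
      interpret S: directed_system \<mu> I r "\<lambda>i. carrier (fob F (fob D i))"
        "\<lambda>i j. fmor F (fob D i) (fob D j) (fmor D i j ())"
        by (rule F_colimit_system[OF dir D])
      note D' = poset_functorD[OF D S.partial_order]
      have L': "L \<in> Ob C" "\<And>i. i \<in> I \<Longrightarrow> \<iota> i \<in> Mor C (fob D i) L"
        "\<And>i j. (i, j) \<in> r \<Longrightarrow> Cmp C (fob D i) (fob D j) L (\<iota> j) (fmor D i j ()) = \<iota> i"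
        using L by (auto simp: is_colimit_def cocone_poset_iff[OF S.r_closed])
      have eM: "e \<in> Mor C A L" and e1: "fmor F A L e a = \<one>\<^bsub>fob F L\<^esub>" using e by (auto simp: E_def)
      obtain i g where i: "i \<in> I" and g: "g \<in> Mor C A (fob D i)" "Cmp C A (fob D i) L (\<iota> i) g = e"
        using presented_factors[OF A dir D L] eM unfolding factors_essentially_uniquely_def by blast
      note Di = D'(1)[OF i]
      have ga: "fmor F A (fob D i) g a \<in> carrier (fob F (fob D i))" by (rule F_closed[OF A_ob Di g(1) a])
      have one: "\<one>\<^bsub>fob F (fob D i)\<^esub> \<in> carrier (fob F (fob D i))" by (rule comm_groupE(2)[OF F_group[OF Di]])
      have "fmor F (fob D i) L (\<iota> i) (fmor F A (fob D i) g a) = \<one>\<^bsub>fob F L\<^esub>"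
        using F_cmp[OF A_ob Di L'(1) g(1) L'(2)[OF i] a] g(2) e1 by simp
      also have "\<dots> = fmor F (fob D i) L (\<iota> i) \<one>\<^bsub>fob F (fob D i)\<^esub>"
        using group_hom.hom_one[OF F_hom[OF Di L'(1) L'(2)[OF i]]] by simp
      finally obtain j where j: "(i, j) \<in> r"
        and eq: "fmor F (fob D i) (fob D j) (fmor D i j ()) (fmor F A (fob D i) g a) =
          fmor F (fob D i) (fob D j) (fmor D i j ()) \<one>\<^bsub>fob F (fob D i)\<^esub>"
        using S.elementwise_colimitD(4)[OF F_colimit[OF dir D L] i ga one] by blast
      have jI: "j \<in> I" using S.r_memb j by blast
      note Dj = D'(1)[OF jI] and tij = D'(2)[OF j]
      define d where "d = Cmp C A (fob D i) (fob D j) (fmor D i j ()) g"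
      have "d \<in> Mor C A (fob D j)" unfolding d_def by (rule cmp[OF A_ob Di Dj g(1) tij])
      moreover have "fmor F A (fob D j) d a = \<one>\<^bsub>fob F (fob D j)\<^esub>"
        using F_cmp[OF A_ob Di Dj g(1) tij a] eq group_hom.hom_one[OF F_hom[OF Di Dj tij]]
        by (simp add: d_def)
      moreover have "Cmp C A (fob D j) L (\<iota> j) d = e"
        using assoc[OF A_ob Di Dj L'(1) g(1) tij L'(2)[OF jI]] L'(3)[OF j] g(2) by (simp add: d_def)
      ultimately show ?thesis using jI by (auto simp: E_def)
    qed
  qed
  then obtain B b where B: "presented U \<mu> C B" and b: "b \<in> E B"
    and gen': "\<And>X f. X \<in> Ob C \<Longrightarrow> f \<in> E X \<Longrightarrow> \<exists>h\<in>Mor C B X. Cmp C A B X h b = f"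
    by blast
  have B_ob: "B \<in> Ob C" using B by (simp add: presented_def)
  have bM: "b \<in> Mor C A B" and b1: "fmor F A B b a = \<one>\<^bsub>fob F B\<^esub>" using b by (auto simp: E_def)
  define \<alpha> where "\<alpha> X = (\<lambda>h\<in>Mor C B X. Cmp C A B X h b)" for X
  define \<beta> where "\<beta> X = (\<lambda>f\<in>Mor C A X. fmor F A X f a)" for X
  note pre = preadditive
  have "right_exact_sequence U C (hom_functor C B) (hom_functor C A) F \<alpha> \<beta>"
    unfolding right_exact_sequence_def is_nat_trans_def
  proof (intro conjI ballI)
    fix X assume X: "X \<in> Ob C"
    have "Cmp C A B X h b \<in> Mor C A X" if "h \<in> Mor C B X" for h
      by (rule cmp[OF A_ob B_ob X bM that])
    then show "\<alpha> X \<in> Mor (Ab U) (fob (hom_functor C B) X) (fob (hom_functor C A) X)"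
      using preadditive_distrib_right[OF pre A_ob B_ob X bM] preadditive_add(2)[OF pre B_ob X]
      by (auto simp: \<alpha>_def hom_functor_def hom_group_def hom_def)
    show "\<beta> X \<in> Mor (Ab U) (fob (hom_functor C A) X) (fob F X)"
      using F_closed[OF A_ob X _ a] F_add[OF prods A_ob X _ _ a] preadditive_add(2)[OF pre A_ob X]
      by (auto simp: \<beta>_def hom_functor_def hom_group_def hom_def)
    show "\<alpha> X ` carrier (fob (hom_functor C B) X) = kernel (fob (hom_functor C A) X) (fob F X) (\<beta> X)"
    proof (intro subset_antisym subsetI)
      fix f assume "f \<in> \<alpha> X ` carrier (fob (hom_functor C B) X)"
      then obtain h where h: "h \<in> Mor C B X" "f = Cmp C A B X h b"
        by (auto simp: \<alpha>_def hom_functor_def hom_group_def)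
      have "fmor F A X f a = \<one>\<^bsub>fob F X\<^esub>"
        using F_cmp[OF A_ob B_ob X bM h(1) a] b1 group_hom.hom_one[OF F_hom[OF B_ob X h(1)]] h(2) by simp
      then show "f \<in> kernel (fob (hom_functor C A) X) (fob F X) (\<beta> X)"
        using cmp[OF A_ob B_ob X bM h(1)] h(2)
        by (simp add: kernel_def \<beta>_def hom_functor_def hom_group_def)
    next
      fix f assume "f \<in> kernel (fob (hom_functor C A) X) (fob F X) (\<beta> X)"
      then have "f \<in> E X" by (auto simp: kernel_def \<beta>_def hom_functor_def hom_group_def E_def)
      then obtain h where "h \<in> Mor C B X" "Cmp C A B X h b = f" using gen'[OF X] by blast
      then show "f \<in> \<alpha> X ` carrier (fob (hom_functor C B) X)"
        by (auto simp: \<alpha>_def hom_functor_def hom_group_def)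
    qed
    show "\<beta> X ` carrier (fob (hom_functor C A) X) = carrier (fob F X)"
      using gen[OF X] F_closed[OF A_ob X _ a] by (auto simp: \<beta>_def hom_functor_def hom_group_def)
    fix Y f assume Y: "Y \<in> Ob C" and f: "f \<in> Mor C X Y"
    show "Cmp (Ab U) (fob (hom_functor C B) X) (fob (hom_functor C B) Y) (fob (hom_functor C A) Y)
        (\<alpha> Y) (fmor (hom_functor C B) X Y f) =
      Cmp (Ab U) (fob (hom_functor C B) X) (fob (hom_functor C A) X) (fob (hom_functor C A) Y)
        (fmor (hom_functor C A) X Y f) (\<alpha> X)"
      using cmp[OF B_ob X Y _ f] cmp[OF A_ob B_ob X bM] assoc[OF A_ob B_ob X Y bM _ f]
      by (auto simp: \<alpha>_def hom_functor_def hom_group_def compose_def)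
    show "Cmp (Ab U) (fob (hom_functor C A) X) (fob (hom_functor C A) Y) (fob F Y)
        (\<beta> Y) (fmor (hom_functor C A) X Y f) =
      Cmp (Ab U) (fob (hom_functor C A) X) (fob F X) (fob F Y) (fmor F X Y f) (\<beta> X)"
      using cmp[OF A_ob X Y _ f] F_cmp[OF A_ob X Y _ f a]
      by (auto simp: \<beta>_def hom_functor_def hom_group_def compose_def)
  qed
  then show ?thesis using A B by blast
qed

end

theorem theorem2p4:
  fixes C :: "('o, 'u) preadditive"
    and F :: "('o, 'u, 'u monoid, 'u \<Rightarrow> 'u) funct"
    and \<mu> :: "'l rel"
  assumes "inaccessible_universe TYPE('u)"
    and "Card_order \<mu>" and "cinfinite \<mu>" and "regularCard \<mu>"
    and "\<mu> <o |UNIV :: 'u set|"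
    and "accessible_category TYPE('u) \<mu> C"
    and "is_additive C"
    and "has_products TYPE('u) C"
    and "is_functor C (Ab TYPE('u)) F"
  shows "(accessible_functor TYPE('u) \<mu> C (Ab TYPE('u)) F \<and>
          preserves_products TYPE('u) C (Ab TYPE('u)) F)
     \<longleftrightarrow>
         (\<exists>A B \<alpha> \<beta>. presented TYPE('u) \<mu> C A \<and> presented TYPE('u) \<mu> C B \<and>
            right_exact_sequence TYPE('u) C (hom_functor C B) (hom_functor C A) F \<alpha> \<beta>)"
    (is "?a \<longleftrightarrow> ?b")
proof -
  interpret additive_accessible "TYPE('u)" \<mu> C F
    by unfold_locales fact+
  show ?thesis
  proof
    assume ?a
    then show ?b by (intro presentation_exists) (simp_all add: accessible_functor_def)
  next
    assume ?b
    then obtain A B \<alpha> \<beta> where "presented TYPE('u) \<mu> C A" "presented TYPE('u) \<mu> C B"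
      "right_exact_sequence TYPE('u) C (hom_functor C B) (hom_functor C A) F \<alpha> \<beta>" by blast
    then interpret presentation "TYPE('u)" \<mu> C F A B \<alpha> \<beta> by unfold_locales
    show ?a
      using accessible accessible_Ab[OF regular_mu less_universe] is_functor
        colimits_preserved products_preserved
      by (simp add: accessible_functor_def)
  qed
qed

end
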